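(* Let $\mathcal M$ be a Carnot--Carath\'eodory space (with $C^1$-smooth basis vector fields). 1) Let $g\in\mathcal M$. There exist a neighborhood $U$ of $g$ and a number $L\in\mathbb N$ such that every pair of points $u,v\in U$ can be joined by an absolutely continuous horizontal curve $\gamma$ constituted of at most $L$ segments of integral lines of basic horizontal vector fields, where $L$ is independent of the choice of the points $u,v\in U$. 2) Every pair of points $u,v$ in the connected Carnot--Carath\'eodory space $\mathcal M$ can be joined by an absolutely continuous horizontal curve $\gamma$ constituted of a finite number of segments of integral lines of basic horizontal vector fields.
   Context: **Carnot--Carath\'eodory space.** A connected Riemannian $C^\infty$-manifold $\mathcal M$ of dimension $N$ whose tangent bundle has a filtration by subbundles $H\mathcal M=H_1\mathcal M\subsetneq\dots\subsetneq H_M\mathcal M=T\mathcal M$ such that each point $g\in\mathcal M$ has a neighborhood $U(g)$ with $C^1$-smooth vector fields $X_1,\dots,X_N$ forming a basis of $T_v\mathcal M$ for every $v\in U(g)$ and such that for all $v\in U(g)$: (1) $H_i(v)=\operatorname{span}\{X_1(v),\dots,X_{\dim H_i}(v)\}$ has constant dimension $\dim H_i$; (2) $H_{j+1}=\operatorname{span}\{H_j,[H_1,H_j],[H_2,H_{j-1}],\dots,[H_k,H_{j+1-k}]\}$ with $k=\lfloor (j+1)/2\rfloor$, $j=1,\dots,M-1$. The fields $X_1,\dots,X_{\dim H_1}$ are the basic horizontal vector fields (local fields: near each point they belong to the frame fixed there). An absolutely continuous curve $\gamma:[0,T]\to\mathcal M$ is horizontal if $\dot\gamma(t)\in H_{\gamma(t)}\mathcal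 M$ for almost all $t\in[0,T]$. *)

theory Defs
  imports "HOL-Analysis.Analysis" "HOL-Library.Function_Algebras"
begin

text \<open>The pointwise vector space structure on functions; tangent vectors below are functions
  from charts to coordinate vectors, and this makes \<open>span\<close>, \<open>dim\<close>, ... available for them.\<close>

instantiation "fun" :: (type, real_vector) real_vector
begin

definition scaleR_fun :: "real \<Rightarrow> ('a \<Rightarrow> 'b) \<Rightarrow> 'a \<Rightarrow> 'b"
  where "scaleR_fun r f = (\<lambda>x. r *\<^sub>R f x)"

instance
  by standard (auto simp: scaleR_fun_def plus_fun_def fun_eq_iff scaleR_add_right scaleR_add_left)

end


section \<open>Smooth manifolds\<close>

text \<open>\<open>C_k_on k f S\<close> is only used for open \<open>S\<close>.\<close>

fun C_k_on :: "nat \<Rightarrow> ('a::euclidean_space \<Rightarrow> 'b::real_normed_vector) \<Rightarrow> 'a set \<Rightarrow> bool" where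
  "C_k_on 0 f S \<longleftrightarrow> continuous_on S f"
| "C_k_on (Suc k) f S \<longleftrightarrow>
     (\<forall>x\<in>S. f differentiable (at x)) \<and>
     (\<forall>a. C_k_on k (\<lambda>x. frechet_derivative f (at x) a) S)"

definition smooth_on :: "('a::euclidean_space \<Rightarrow> 'b::real_normed_vector) \<Rightarrow> 'a set \<Rightarrow> bool"
  where "smooth_on f S \<longleftrightarrow> (\<forall>k. C_k_on k f S)"

text \<open>A chart is a pair of a domain and a coordinate map; the values of the coordinate map outside
  the domain carry no meaning.\<close>

type_synonym ('m, 'e) chart = "'m set \<times> ('m \<Rightarrow> 'e)"

abbreviation chart_dom :: "('m, 'e) chart \<Rightarrow> 'm set"
  where "chart_dom \<equiv> fst"

abbreviation chart_map :: "('m, 'e) chart \<Rightarrow> 'm \<Rightarrow> 'e"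
  where "chart_map \<equiv> snd"

definition chart_inv :: "('m, 'e) chart \<Rightarrow> 'e \<Rightarrow> 'm"
  where "chart_inv c = inv_into (chart_dom c) (chart_map c)"

definition is_chart :: "('m::topological_space, 'e::euclidean_space) chart \<Rightarrow> bool"
  where "is_chart c \<longleftrightarrow> open (chart_dom c) \<and> open (chart_map c ` chart_dom c) \<and>
    homeomorphism (chart_dom c) (chart_map c ` chart_dom c) (chart_map c) (chart_inv c)"

definition transition :: "('m, 'e) chart \<Rightarrow> ('m, 'e) chart \<Rightarrow> 'e \<Rightarrow> 'e"
  where "transition c c' = chart_map c' \<circ> chart_inv c"

text \<open>The atlas need not be maximal. The manifold is the whole type \<open>'m\<close>, its dimension is
  \<open>DIM('e)\<close>.\<close>

definition smooth_atlas :: "('m::topological_space, 'e::euclidean_space) chart set \<Rightarrow> bool"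
  where "smooth_atlas A \<longleftrightarrow>
    (\<forall>c\<in>A. is_chart c) \<and> (\<Union>c\<in>A. chart_dom c) = UNIV \<and>
    (\<forall>c\<in>A. \<forall>c'\<in>A. smooth_on (transition c c') (chart_map c ` (chart_dom c \<inter> chart_dom c')))"


section \<open>Tangent vectors and vector fields\<close>

text \<open>A tangent vector at \<open>p\<close> assigns to every chart around \<open>p\<close> a coordinate vector, subject to
  the usual transformation law. At all other arguments it is \<open>0\<close>, so that tangent spaces
  are honest linear subspaces of a function space.\<close>

type_synonym ('m, 'e) tvec = "('m, 'e) chart \<Rightarrow> 'e"

definition tangent_space :: "('m, 'e::euclidean_space) chart set \<Rightarrow> 'm \<Rightarrow> ('m, 'e) tvec set"
  where "tangent_space A p = {w.
    (\<forall>c. \<not> (c \<in> A \<and> p \<in> chart_dom c) \<longrightarrow> w c = 0) \<and>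
    (\<forall>c\<in>A. \<forall>c'\<in>A. p \<in> chart_dom c \<inter> chart_dom c' \<longrightarrow>
       w c' = frechet_derivative (transition c c') (at (chart_map c p)) (w c))}"

text \<open>The tangent vector at \<open>p\<close> whose coordinate vector in the chart \<open>c\<close> is \<open>a\<close>.\<close>

definition tvec_of :: "('m, 'e::euclidean_space) chart set \<Rightarrow> ('m, 'e) chart \<Rightarrow> 'm \<Rightarrow> 'e \<Rightarrow> ('m, 'e) tvec"
  where "tvec_of A c p a = (\<lambda>c'. if c' \<in> A \<and> p \<in> chart_dom c'
    then frechet_derivative (transition c c') (at (chart_map c p)) a else 0)"

text \<open>The coordinate expression of a vector field \<open>X\<close> in the chart \<open>c\<close>, as a map on the
  coordinate domain of \<open>c\<close>.\<close>

definition coord :: "('m, 'e) chart \<Rightarrow> ('m \<Rightarrow> ('m, 'e) tvec) \<Rightarrow> 'e \<Rightarrow> 'e"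
  where "coord c X = (\<lambda>x. X (chart_inv c x) c)"

definition C1_vector_field ::
    "('m, 'e::euclidean_space) chart set \<Rightarrow> 'm set \<Rightarrow> ('m \<Rightarrow> ('m, 'e) tvec) \<Rightarrow> bool"
  where "C1_vector_field A W X \<longleftrightarrow>
    (\<forall>p\<in>W. X p \<in> tangent_space A p) \<and>
    (\<forall>c\<in>A. C_k_on 1 (coord c X) (chart_map c ` (chart_dom c \<inter> W)))"

text \<open>In coordinates \<open>[X, Y] = DY X - DX Y\<close>.\<close>

definition lie_bracket :: "('m, 'e::euclidean_space) chart set \<Rightarrow>
    ('m \<Rightarrow> ('m, 'e) tvec) \<Rightarrow> ('m \<Rightarrow> ('m, 'e) tvec) \<Rightarrow> 'm \<Rightarrow> ('m, 'e) tvec"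
  where "lie_bracket A X Y p = (\<lambda>c. if c \<in> A \<and> p \<in> chart_dom c
    then frechet_derivative (coord c Y) (at (chart_map c p)) (X p c)
       - frechet_derivative (coord c X) (at (chart_map c p)) (Y p c)
    else 0)"

definition riemannian_metric :: "('m, 'e::euclidean_space) chart set \<Rightarrow>
    ('m \<Rightarrow> ('m, 'e) tvec \<Rightarrow> ('m, 'e) tvec \<Rightarrow> real) \<Rightarrow> bool"
  where "riemannian_metric A G \<longleftrightarrow>
    (\<forall>p. \<forall>u\<in>tangent_space A p. \<forall>v\<in>tangent_space A p. \<forall>w\<in>tangent_space A p. \<forall>r.
       G p (u + v) w = G p u w + G p v w \<and> G p (r *\<^sub>R u) w = r * G p u w \<and>
       G p u v = G p v u \<and> (u \<noteq> 0 \<longrightarrow> G p u u > 0)) \<and>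
    (\<forall>c\<in>A. \<forall>a b. smooth_on
       (\<lambda>x. G (chart_inv c x) (tvec_of A c (chart_inv c x) a) (tvec_of A c (chart_inv c x) b))
       (chart_map c ` chart_dom c))"


section \<open>Curves\<close>

text \<open>\<open>w\<close> is the velocity of \<open>\<gamma>\<close> at the parameter \<open>t\<close>, relative to the parameter set \<open>I\<close>
  (hence one-sided at the ends of an interval). Continuity guarantees that \<open>\<gamma>\<close> stays in the
  domain of a chart around \<open>\<gamma> t\<close> for parameters near \<open>t\<close>.\<close>

definition has_velocity :: "('m::topological_space, 'e::euclidean_space) chart set \<Rightarrow>
    (real \<Rightarrow> 'm) \<Rightarrow> ('m, 'e) tvec \<Rightarrow> real \<Rightarrow> real set \<Rightarrow> bool"
  where "has_velocity A \<gamma> w t I \<longleftrightarrow>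
    w \<in> tangent_space A (\<gamma> t) \<and> continuous (at t within I) \<gamma> \<and>
    (\<forall>c\<in>A. \<gamma> t \<in> chart_dom c \<longrightarrow>
       ((chart_map c \<circ> \<gamma>) has_vector_derivative w c) (at t within I))"

definition abs_continuous_on :: "real \<Rightarrow> real \<Rightarrow> (real \<Rightarrow> 'a::metric_space) \<Rightarrow> bool"
  where "abs_continuous_on a b f \<longleftrightarrow>
    (\<forall>\<epsilon>>0. \<exists>\<delta>>0. \<forall>(n::nat) s t.
       (\<forall>i<n. a \<le> s i \<and> s i \<le> t i \<and> t i \<le> b) \<and> (\<forall>i. Suc i < n \<longrightarrow> t i \<le> s (Suc i)) \<and>
       (\<Sum>i<n. t i - s i) < \<delta> \<longrightarrow> (\<Sum>i<n. dist (f (s i)) (f (t i))) < \<epsilon>)"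

text \<open>Absolute continuity of a curve in a manifold, tested in charts.\<close>

definition abs_continuous_curve :: "('m::topological_space, 'e::euclidean_space) chart set \<Rightarrow>
    real \<Rightarrow> (real \<Rightarrow> 'm) \<Rightarrow> bool"
  where "abs_continuous_curve A T \<gamma> \<longleftrightarrow> continuous_on {0..T} \<gamma> \<and>
    (\<forall>c\<in>A. \<forall>a b. 0 \<le> a \<and> a \<le> b \<and> b \<le> T \<and> \<gamma> ` {a..b} \<subseteq> chart_dom c \<longrightarrow>
       abs_continuous_on a b (chart_map c \<circ> \<gamma>))"

definition horizontal :: "('m::topological_space, 'e::euclidean_space) chart set \<Rightarrow>
    ('m \<Rightarrow> ('m, 'e) tvec set) \<Rightarrow> real \<Rightarrow> (real \<Rightarrow> 'm) \<Rightarrow> bool"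
  where "horizontal A K T \<gamma> \<longleftrightarrow>
    (AE t in lebesgue. t \<in> {0..T} \<longrightarrow> (\<exists>w\<in>K (\<gamma> t). has_velocity A \<gamma> w t {0..T}))"

text \<open>Here \<open>F\<close> is a set of local vector fields \<open>(W, Y)\<close>, with \<open>Y\<close> considered on \<open>W\<close> only. Each of the
  \<open>n\<close> pieces is a segment of an integral line of some \<open>Y\<close>, traversed forwards (\<open>\<sigma> = 1\<close>) or
  backwards (\<open>\<sigma> = -1\<close>).\<close>

definition integral_segments :: "('m::topological_space, 'e::euclidean_space) chart set \<Rightarrow>
    ('m set \<times> ('m \<Rightarrow> ('m, 'e) tvec)) set \<Rightarrow> nat \<Rightarrow> real \<Rightarrow> (real \<Rightarrow> 'm) \<Rightarrow> bool"
  where "integral_segments A F n T \<gamma> \<longleftrightarrow>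
    (\<exists>\<tau>::nat \<Rightarrow> real. \<tau> 0 = 0 \<and> \<tau> n = T \<and>
      (\<forall>i<n. \<tau> i \<le> \<tau> (Suc i) \<and>
        (\<exists>(W, Y)\<in>F. \<exists>\<sigma>\<in>{1, -1}. \<forall>t\<in>{\<tau> i..\<tau> (Suc i)}.
           \<gamma> t \<in> W \<and> has_velocity A \<gamma> (\<sigma> *\<^sub>R Y (\<gamma> t)) t {\<tau> i..\<tau> (Suc i)})))"

definition joined_by_segments :: "('m::topological_space, 'e::euclidean_space) chart set \<Rightarrow>
    ('m \<Rightarrow> ('m, 'e) tvec set) \<Rightarrow> ('m set \<times> ('m \<Rightarrow> ('m, 'e) tvec)) set \<Rightarrow>
    nat \<Rightarrow> 'm \<Rightarrow> 'm \<Rightarrow> bool"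
  where "joined_by_segments A K F n u v \<longleftrightarrow>
    (\<exists>T\<ge>0. \<exists>\<gamma>. \<gamma> 0 = u \<and> \<gamma> T = v \<and> abs_continuous_curve A T \<gamma> \<and> horizontal A K T \<gamma> \<and>
       integral_segments A F n T \<gamma>)"


section \<open>Carnot--Carath\'eodory spaces\<close>

definition C1_section :: "('m, 'e::euclidean_space) chart set \<Rightarrow> ('m \<Rightarrow> ('m, 'e) tvec set) \<Rightarrow>
    'm set \<Rightarrow> ('m \<Rightarrow> ('m, 'e) tvec) \<Rightarrow> bool"
  where "C1_section A K W X \<longleftrightarrow> C1_vector_field A W X \<and> (\<forall>p\<in>W. X p \<in> K p)"

text \<open>\<open>[K, L](v)\<close>: the values at \<open>v\<close> of all brackets of local \<open>C\<^sup>1\<close> sections of \<open>K\<close> and \<open>L\<close>.\<close>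

definition bracket_set :: "('m::topological_space, 'e::euclidean_space) chart set \<Rightarrow>
    ('m \<Rightarrow> ('m, 'e) tvec set) \<Rightarrow> ('m \<Rightarrow> ('m, 'e) tvec set) \<Rightarrow> 'm \<Rightarrow> ('m, 'e) tvec set"
  where "bracket_set A K L v = {lie_bracket A X Y v | X Y W.
    open W \<and> v \<in> W \<and> C1_section A K W X \<and> C1_section A L W Y}"

text \<open>\<open>H i\<close> is the subbundle \<open>H\<^sub>i\<close> of rank \<open>d i\<close>, for \<open>1 \<le> i \<le> M\<close>; \<open>U g\<close> is the neighbourhood
  and \<open>X g 1, ..., X g N\<close> the frame fixed at \<open>g\<close>, where \<open>N = DIM('e)\<close>. That \<open>H i\<close> is a (\<open>C\<^sup>1\<close>)
  subbundle is the content of \<open>H_span\<close> and \<open>H_dim\<close>. Strictness of the filtration is that of the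
  total spaces.\<close>

locale carnot_caratheodory_space =
  fixes A :: "('m::{t2_space, second_countable_topology}, 'e::euclidean_space) chart set"
    and G :: "'m \<Rightarrow> ('m, 'e) tvec \<Rightarrow> ('m, 'e) tvec \<Rightarrow> real"
    and M :: nat
    and H :: "nat \<Rightarrow> 'm \<Rightarrow> ('m, 'e) tvec set"
    and d :: "nat \<Rightarrow> nat"
    and U :: "'m \<Rightarrow> 'm set"
    and X :: "'m \<Rightarrow> nat \<Rightarrow> 'm \<Rightarrow> ('m, 'e) tvec"
  assumes atlas: "smooth_atlas A"
    and metric: "riemannian_metric A G"
    and connected: "connected (UNIV :: 'm set)"
    and M_pos: "1 \<le> M"
    and H_top: "H M = tangent_space A"
    and H_mono: "\<And>i p. 1 \<le> i \<Longrightarrow> i < M \<Longrightarrow> H i p \<subseteq> H (Suc i) p"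
    and H_strict: "\<And>i. 1 \<le> i \<Longrightarrow> i < M \<Longrightarrow> H i \<noteq> H (Suc i)"
    and nhd: "\<And>g. open (U g) \<and> g \<in> U g"
    and frame_C1: "\<And>g k. k \<in> {1..DIM('e)} \<Longrightarrow> C1_vector_field A (U g) (X g k)"
    and frame_inj: "\<And>g v. v \<in> U g \<Longrightarrow> inj_on (\<lambda>k. X g k v) {1..DIM('e)}"
    and frame_indep: "\<And>g v. v \<in> U g \<Longrightarrow> independent ((\<lambda>k. X g k v) ` {1..DIM('e)})"
    and frame_span: "\<And>g v. v \<in> U g \<Longrightarrow>
      span ((\<lambda>k. X g k v) ` {1..DIM('e)}) = tangent_space A v"
    and H_span: "\<And>g v i. v \<in> U g \<Longrightarrow> 1 \<le> i \<Longrightarrow> i \<le> M \<Longrightarrow>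
      H i v = span ((\<lambda>k. X g k v) ` {1..d i})"
    and H_dim: "\<And>g v i. v \<in> U g \<Longrightarrow> 1 \<le> i \<Longrightarrow> i \<le> M \<Longrightarrow> dim (H i v) = d i"
    and H_bracket: "\<And>g v j. v \<in> U g \<Longrightarrow> 1 \<le> j \<Longrightarrow> j \<le> M - 1 \<Longrightarrow>
      H (j + 1) v =
        span (H j v \<union> (\<Union>a\<in>{1..(j + 1) div 2}. bracket_set A (H a) (H (j + 1 - a)) v))"

text \<open>The basic horizontal vector fields belonging to the frame fixed at \<open>g\<close>, with their domain;
  the last argument is \<open>dim H\<^sub>1\<close>.\<close>

definition basic_horizontal_fields :: "('m \<Rightarrow> 'm set) \<Rightarrow> ('m \<Rightarrow> nat \<Rightarrow> 'm \<Rightarrow> ('m, 'e) tvec) \<Rightarrow>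
    nat \<Rightarrow> 'm \<Rightarrow> ('m set \<times> ('m \<Rightarrow> ('m, 'e) tvec)) set"
  where "basic_horizontal_fields U X d1 g = (\<lambda>k. (U g, X g k)) ` {1..d1}"

end

theory Submission
  imports Defs
begin

text \<open>The orbit of a point \<open>x0\<close> under the basic horizontal fields is examined in a chart, with the fields
  cut off to globally defined bounded \<open>C\<^sup>1\<close> fields on the Euclidean space. Composing their flows gives
  \<open>C\<^sup>1\<close> maps into the orbit; choose an immersion \<open>F\<close> of this kind with a parameter space of maximal
  dimension. By maximality all basic fields are tangent to the image \<open>S\<close> of \<open>F\<close>, so they are orthogonal to
  every proximal normal \<open>\<nu>\<close> of the closed set \<open>S\<close> (a \<open>\<nu>\<close> such that \<open>s\<close> is a point of \<open>S\<close> nearest to \<open>s + \<nu>\<close>).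
  A \<open>C\<^sup>1\<close> field orthogonal to all proximal normals has a flow preserving \<open>S\<close>; hence the commutator of the
  flows of two such fields, which is \<open>s + t\<^sup>2 [Z, W](s) + o(t\<^sup>2)\<close> already for \<open>C\<^sup>1\<close> fields, stays in \<open>S\<close>, and the
  bracket is again orthogonal to the proximal normals. By induction along the filtration all tangent
  vectors are, so \<open>S\<close> has no nonzero normals near the image of the centre of the parameter domain
  and contains a neighbourhood of that point.
  Flowing back to \<open>x0\<close> yields a neighbourhood of \<open>x0\<close> reached with a fixed number of segments.\<close>

section \<open>Ordinary differential equations\<close>

text \<open>The obstacle is regularity. Brackets of C^1 fields are only continuous, so they need not
  have a flow and cannot be bracketed again; and \<open>S\<close> is only a C^1 image, so the usual
  proof that brackets of tangent fields are tangent, by pulling the fields back to the parameter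
  space, loses a derivative. Orthogonality to proximal normals replaces tangency: it makes sense for
  any closed set and is linear in the vector at each point, so it passes from the fibres of
  \<open>H a\<close> to arbitrary C^1 sections, and each step of the filtration brackets only two
  such sections. \<open>S\<close> is the image of a closed disc, and tangency holds only away from
  the image of the boundary; hence the localisation to an open set around the image of the centre.
  The uniform bound arises as follows: \<open>n\<close> steps lead from \<open>x0\<close> to a full
  ball around that image, \<open>n\<close> steps lead from there back to a neighbourhood of
  \<open>x0\<close>, and \<open>u\<close> and \<open>v\<close> are joined through \<open>x0\<close>,
  which gives \<open>4 * n\<close> segments.\<close>

lemma antiderivative_exists:
  fixes f :: "real \<Rightarrow> 'a::banach"
  assumes "continuous_on UNIV f"
  shows "\<exists>J. J 0 = 0 \<and> (\<forall>t. (J has_vector_derivative f t) (at t))"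
proof -
  \<comment> \<open>For either sign of \<open>t\<close> one of the two intervals is empty or a
    single point, so this is the oriented integral from \<open>0\<close> to
    \<open>t\<close>.\<close>
  define J where "J t = integral {0..t} f - integral {t..0} f" for t
  have int: "f integrable_on {a..b}" for a b
    by (rule integrable_continuous_interval) (meson assms continuous_on_subset subset_UNIV)
  \<comment> \<open>A base point to the left of both \<open>0\<close> and \<open>t\<close> gives one
    formula on a neighbourhood of \<open>t\<close>, as needed for differentiating across
    \<open>0\<close>.\<close>
  have J_eq: "J t = integral {-R..t} f - integral {-R..0} f" if "\<bar>t\<bar> < R" for t R
  proof (cases "t \<ge> 0")
    case True
    then show ?thesis using that Henstock_Kurzweil_Integration.integral_combine[of "-R" 0 t f] int
      by (cases "t = 0") (auto simp: J_def algebra_simps)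
  next
    case False
    then show ?thesis using that Henstock_Kurzweil_Integration.integral_combine[of "-R" t 0 f] int
      by (auto simp: J_def algebra_simps)
  qed
  have "(J has_vector_derivative f t) (at t)" for t
  proof -
    define R where "R = \<bar>t\<bar> + 1"
    have "((\<lambda>u. integral {-R..u} f) has_vector_derivative f t) (at t within {-R..R})"
      by (rule integral_has_vector_derivative)
        (auto simp: R_def intro: continuous_on_subset[OF assms])
    then have "((\<lambda>u. integral {-R..u} f) has_vector_derivative f t) (at t within {-R<..<R})"
      by (rule has_vector_derivative_within_subset) auto
    moreover have "at t within {-R<..<R} = at t"
      by (rule at_within_open) (auto simp: R_def)
    ultimately have "((\<lambda>u. integral {-R..u} f - integral {-R..0} f) has_vector_derivative f t) (at t)"
      by (auto intro!: derivative_eq_intros)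
    then show ?thesis
    proof (rule has_vector_derivative_transform_within_open[of _ _ _ "{-R<..<R}"])
      show "integral {- R..u} f - integral {- R..0} f = J u" if "u \<in> {- R<..<R}" for u
        using that by (intro J_eq[symmetric]) auto
    qed (auto simp: R_def)
  qed
  moreover have "J 0 = 0" by (simp add: J_def)
  ultimately show ?thesis by blast
qed

lemma has_vector_derivative_reflect:
  fixes f :: "real \<Rightarrow> 'a::real_normed_vector"
  assumes "(f has_vector_derivative D) (at (- s))"
  shows "((\<lambda>s. f (- s)) has_vector_derivative - D) (at s)"
proof -
  have "(uminus has_vector_derivative - 1) (at s)"
    by (auto intro!: derivative_eq_intros)
  from vector_diff_chain_at[OF this assms] show ?thesis by (simp add: o_def)
qed

text \<open>Integrating the bound gives \<open>C / K * (exp (K * \<bar>t\<bar>) - 1)\<close>. In the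
  norm weighted by \<open>exp (- K * \<bar>t\<bar>)\<close>, antidifferentiation from
  \<open>0\<close> thus has norm at most \<open>1 / K\<close>, which makes the Picard operator
  contract for large \<open>K\<close>.\<close>

lemma norm_le_weight:
  fixes J :: "real \<Rightarrow> 'a::banach"
  assumes J: "\<And>t. (J has_vector_derivative J' t) (at t)" and "J 0 = 0" and K: "K > 0"
    and bd: "\<And>t. norm (J' t) \<le> C * exp (K * \<bar>t\<bar>)"
  shows "norm (J t) \<le> C / K * exp (K * \<bar>t\<bar>)"
proof -
  have *: "norm (j t) \<le> C / K * exp (K * t)"
    if "t \<ge> 0" "j 0 = 0" "\<And>t. (j has_vector_derivative j' t) (at t)"
      "\<And>t. t \<ge> 0 \<Longrightarrow> norm (j' t) \<le> C * exp (K * t)" for t j j'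
  proof (cases "t = 0")
    case True
    have "C \<ge> 0" using that(4)[of 0] by (simp add: order_trans[OF norm_ge_zero])
    then show ?thesis using True that K by simp
  next
    case False
    have "norm (j t - j 0) \<le> C / K * exp (K * t) - C / K * exp (K * 0)"
    proof (rule differentiable_bound_general[where f' = j' and \<phi>' = "\<lambda>t. C * exp (K * t)"])
      show "continuous_on {0..t} j"
        by (intro continuous_at_imp_continuous_on ballI has_vector_derivative_continuous[OF that(3)])
      show "((\<lambda>t. C / K * exp (K * t)) has_vector_derivative C * exp (K * x)) (at x)" for x
        using K by (auto intro!: derivative_eq_intros simp: has_real_derivative_iff_has_vector_derivative[symmetric])
    qed (use False that K in \<open>auto intro!: continuous_intros\<close>)
    moreover have "C \<ge> 0" using that(4)[of 0] by (simp add: order_trans[OF norm_ge_zero])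
    ultimately show ?thesis using that K by (simp add: order_trans)
  qed
  show ?thesis
  proof (cases "t \<ge> 0")
    case True
    then show ?thesis using *[of t J J'] J \<open>J 0 = 0\<close> bd by (metis abs_of_nonneg)
  next
    case False
    have "norm ((\<lambda>s. J (- s)) (-t)) \<le> C / K * exp (K * (-t))"
    proof (rule *[of "- t" "\<lambda>s. J (- s)" "\<lambda>s. - J' (- s)"])
      show "((\<lambda>s. J (- s)) has_vector_derivative - J' (- s)) (at s)" for s
        by (rule has_vector_derivative_reflect[OF J])
      show "norm (- J' (- t)) \<le> C * exp (K * t)" if "0 \<le> t" for t
        using bd[of "-t"] that by simp
    qed (use False \<open>J 0 = 0\<close> in auto)
    then show ?thesis using False by simp
  qed
qed

text \<open>Weighting the supremum norm by \<open>exp (- K \<bar>t\<bar>)\<close> makes the Picard operator a contraction on the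
  whole time axis at once.\<close>

lemma picard_global:
  fixes f :: "real \<Rightarrow> 'a::banach \<Rightarrow> 'a"
  assumes cont: "continuous_on UNIV (\<lambda>(t, x). f t x)"
    and lip: "\<And>t x y. norm (f t x - f t y) \<le> L * norm (x - y)" and L: "L > 0"
    and bd: "\<And>t. norm (f t x0) \<le> B"
  shows "\<exists>\<phi>. \<phi> 0 = x0 \<and> (\<forall>t. (\<phi> has_vector_derivative f t (\<phi> t)) (at t))"
proof -
  \<comment> \<open>The contraction factor is \<open>L / K\<close>, here \<open>1/2\<close>.\<close>
  define K where "K = 2 * L"
  have K: "K > 0" using L by (simp add: K_def)
  have B: "B \<ge> 0" using bd[of 0] norm_ge_zero order_trans by blast
  \<comment> \<open>The unknown \<open>u\<close> is the weighted deviation of the solution from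
    \<open>x0\<close>. It is bounded, so the complete space of bounded continuous functions is
    available although solutions may grow exponentially.\<close>
  define \<Phi> where "\<Phi> u s = x0 + exp (K * \<bar>s\<bar>) *\<^sub>R apply_bcontfun u s" for u :: "real \<Rightarrow>\<^sub>C 'a" and s
  have cu: "continuous_on UNIV (apply_bcontfun u)" for u :: "real \<Rightarrow>\<^sub>C 'a"
    using apply_bcontfun[of u] by (simp add: bcontfun_def)
  have cf: "continuous_on UNIV (\<lambda>s. f s (\<Phi> u s))" for u
  proof -
    have "continuous_on UNIV (\<lambda>s. (s, \<Phi> u s))"
      unfolding \<Phi>_def by (intro continuous_intros cu)
    from continuous_on_compose2[OF cont this] show ?thesis by simp
  qed
  define J where "J u = (SOME J. J 0 = 0 \<and> (\<forall>t. (J has_vector_derivative f t (\<Phi> u t)) (at t)))" for u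
  have J: "J u 0 = 0 \<and> (\<forall>t. (J u has_vector_derivative f t (\<Phi> u t)) (at t))" for u
    unfolding J_def using someI_ex[OF antiderivative_exists[OF cf[of u]]] .
  then have J0: "J u 0 = 0" and J': "(J u has_vector_derivative f t (\<Phi> u t)) (at t)" for u t
    by auto
  define P where "P u t = exp (- K * \<bar>t\<bar>) *\<^sub>R J u t" for u t
  have P_diff: "norm (P u t - P v t) \<le> (1/2) * dist u v" for u v t
  proof -
    have "norm (J u t - J v t) \<le> (L * dist u v) / K * exp (K * \<bar>t\<bar>)"
    proof (rule norm_le_weight[where J = "\<lambda>t. J u t - J v t"])
      show "((\<lambda>t. J u t - J v t) has_vector_derivative f t (\<Phi> u t) - f t (\<Phi> v t)) (at t)" for t
        by (intro has_vector_derivative_diff J')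
      fix s
      have "norm (f s (\<Phi> u s) - f s (\<Phi> v s)) \<le> L * norm (\<Phi> u s - \<Phi> v s)" by (rule lip)
      also have "norm (\<Phi> u s - \<Phi> v s) = exp (K * \<bar>s\<bar>) * dist (apply_bcontfun u s) (apply_bcontfun v s)"
        by (simp add: \<Phi>_def dist_norm flip: scaleR_diff_right)
      also have "\<dots> \<le> exp (K * \<bar>s\<bar>) * dist u v" by (simp add: dist_bounded)
      finally show "norm (f s (\<Phi> u s) - f s (\<Phi> v s)) \<le> L * dist u v * exp (K * \<bar>s\<bar>)"
        using L by (simp add: mult_ac)
    qed (use K J0 in auto)
    also have "L * dist u v / K = (1/2) * dist u v" using L by (simp add: K_def)
    finally have "exp (- (K * \<bar>t\<bar>)) * norm (J u t - J v t)
        \<le> exp (- (K * \<bar>t\<bar>)) * (1/2 * dist u v * exp (K * \<bar>t\<bar>))"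
      by (rule mult_left_mono) simp
    also have "\<dots> = 1/2 * dist u v" by (simp add: exp_minus)
    also have "exp (- (K * \<bar>t\<bar>)) * norm (J u t - J v t) = norm (P u t - P v t)"
      by (simp add: P_def flip: scaleR_diff_right)
    finally show ?thesis .
  qed
  have P_0: "norm (P 0 t) \<le> B / K" for t
  proof -
    have "norm (J 0 t) \<le> B / K * exp (K * \<bar>t\<bar>)"
    proof (rule norm_le_weight[OF J'])
      fix s
      have "norm (f s (\<Phi> 0 s)) \<le> B" using bd by (simp add: \<Phi>_def)
      also have "B \<le> B * exp (K * \<bar>s\<bar>)" using B K by (simp add: mult_le_cancel_left1)
      finally show "norm (f s (\<Phi> 0 s)) \<le> B * exp (K * \<bar>s\<bar>)" .
    qed (use K J0 in auto)
    then show ?thesis using K by (simp add: P_def exp_minus divide_simps)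
  qed
  have P_cont: "continuous_on UNIV (P u)" for u
    unfolding P_def
    by (intro continuous_intros continuous_at_imp_continuous_on ballI
        has_vector_derivative_continuous[OF J'])
  have P_in: "P u \<in> bcontfun" for u
  proof (rule bcontfun_normI[OF P_cont])
    fix t
    have "norm (P u t) \<le> norm (P u t - P 0 t) + norm (P 0 t)"
      by (metis diff_add_cancel norm_triangle_ineq)
    then show "norm (P u t) \<le> 1/2 * dist u 0 + B / K" using P_diff[of u t 0] P_0[of t] by linarith
  qed
  have "\<exists>!u. Bcontfun (P u) = u"
  proof (rule banach_fix_type[where c = "1/2"])
    show "\<forall>u v. dist (Bcontfun (P u)) (Bcontfun (P v)) \<le> 1/2 * dist u v"
      by (intro allI dist_bound, simp only: Bcontfun_inverse[OF P_in], subst dist_norm, rule P_diff)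
  qed auto
  then obtain u where u: "Bcontfun (P u) = u" by auto
  have "\<Phi> u = (\<lambda>t. x0 + J u t)"
  proof
    fix t
    have "apply_bcontfun u t = P u t" by (metis u Bcontfun_inverse[OF P_in])
    then show "\<Phi> u t = x0 + J u t" by (simp add: \<Phi>_def P_def exp_minus)
  qed
  then have "(\<Phi> u has_vector_derivative f t (\<Phi> u t)) (at t)" for t
    using J'[of u t] by (auto intro!: derivative_eq_intros)
  moreover have "\<Phi> u 0 = x0" using J0 \<open>\<Phi> u = (\<lambda>t. x0 + J u t)\<close> by simp
  ultimately show ?thesis by blast
qed

text \<open>The squared norm is differentiable also where \<open>e\<close> vanishes. Its derivative
  is at most \<open>2 * norm (e s) * (L * norm (e s) + \<eta>)\<close>, and
  \<open>2 * norm (e s) * \<eta>\<close> is absorbed by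
  \<open>(norm (e s))\<^sup>2 + \<eta>\<^sup>2\<close>; this is the origin of the rate
  \<open>2 * L + 1\<close>.\<close>

lemma gronwall_nonneg:
  fixes e :: "real \<Rightarrow> 'a::real_inner"
  assumes e: "\<And>s. (e has_vector_derivative e' s) (at s)"
    and bd: "\<And>s. 0 \<le> s \<Longrightarrow> s \<le> t \<Longrightarrow> norm (e' s) \<le> L * norm (e s) + \<eta>"
    and "0 \<le> t" "0 \<le> L"
  shows "(norm (e t))\<^sup>2 \<le> ((norm (e 0))\<^sup>2 + \<eta>\<^sup>2) * exp ((2 * L + 1) * t)"
proof -
  define K where "K = 2 * L + 1"
  define v where "v s = (e s \<bullet> e s + \<eta>\<^sup>2) * exp (- K * s)" for s
  have "v t \<le> v 0"
  proof (rule DERIV_nonpos_imp_nonincreasing[OF \<open>0 \<le> t\<close>])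
    fix s assume s: "0 \<le> s" "s \<le> t"
    have "((\<lambda>s. e s \<bullet> e s) has_vector_derivative (e s \<bullet> e' s + e' s \<bullet> e s)) (at s)"
      by (rule bounded_bilinear.has_vector_derivative[OF bounded_bilinear_inner e e])
    then have "((\<lambda>s. e s \<bullet> e s) has_real_derivative (2 * (e s \<bullet> e' s))) (at s)"
      by (simp add: has_real_derivative_iff_has_vector_derivative inner_commute)
    then have D: "(v has_real_derivative
        (2 * (e s \<bullet> e' s) * exp (- K * s) + (e s \<bullet> e s + \<eta>\<^sup>2) * (exp (- K * s) * - K))) (at s)"
      unfolding v_def by (auto intro!: derivative_eq_intros)
    have "2 * (e s \<bullet> e' s) \<le> 2 * (norm (e s) * norm (e' s))" by (simp add: norm_cauchy_schwarz)
    also have "\<dots> \<le> 2 * (norm (e s) * (L * norm (e s) + \<eta>))"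
      using bd[OF s] by (simp add: mult_left_mono)
    also have "\<dots> \<le> K * (e s \<bullet> e s) + \<eta>\<^sup>2"
      using zero_le_power2[of "norm (e s) - \<eta>"]
      by (simp add: K_def power2_norm_eq_inner[symmetric] power2_eq_square algebra_simps)
    also have "\<dots> \<le> K * (e s \<bullet> e s + \<eta>\<^sup>2)"
      using \<open>0 \<le> L\<close> by (simp add: K_def algebra_simps)
    finally have "(2 * (e s \<bullet> e' s) - K * (e s \<bullet> e s + \<eta>\<^sup>2)) * exp (- K * s) \<le> 0"
      by (intro mult_nonpos_nonneg) auto
    with D show "\<exists>y. DERIV v s :> y \<and> y \<le> 0"
      by (intro exI[of _ "2 * (e s \<bullet> e' s) * exp (- K * s) + (e s \<bullet> e s + \<eta>\<^sup>2) * (exp (- K * s) * - K)"] conjI)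
        (simp_all add: algebra_simps)
  qed
  then have "v t * exp (K * t) \<le> v 0 * exp (K * t)" by (simp add: mult_right_mono)
  moreover have "v t * exp (K * t) = e t \<bullet> e t + \<eta>\<^sup>2"
    by (simp add: v_def mult.assoc flip: exp_add)
  moreover have "v 0 = e 0 \<bullet> e 0 + \<eta>\<^sup>2" by (simp add: v_def)
  ultimately have "e t \<bullet> e t + \<eta>\<^sup>2 \<le> (e 0 \<bullet> e 0 + \<eta>\<^sup>2) * exp (K * t)" by (simp only:)
  then show ?thesis
    using zero_le_power2[of \<eta>] unfolding K_def power2_norm_eq_inner by linarith
qed

lemma gronwall:
  fixes e :: "real \<Rightarrow> 'a::real_inner"
  assumes e: "\<And>s. (e has_vector_derivative e' s) (at s)"
    and bd: "\<And>s. \<bar>s\<bar> \<le> \<bar>t\<bar> \<Longrightarrow> norm (e' s) \<le> L * norm (e s) + \<eta>" and "0 \<le> L"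
  shows "(norm (e t))\<^sup>2 \<le> ((norm (e 0))\<^sup>2 + \<eta>\<^sup>2) * exp ((2 * L + 1) * \<bar>t\<bar>)"
proof (cases "t \<ge> 0")
  case True
  then show ?thesis using gronwall_nonneg[OF e, of t L \<eta>] bd \<open>0 \<le> L\<close> by auto
next
  case False
  have "((\<lambda>s. e (- s)) has_vector_derivative - e' (- s)) (at s)" for s
    by (rule has_vector_derivative_reflect[OF e])
  from gronwall_nonneg[OF this, of "-t" L \<eta>] show ?thesis using False bd \<open>0 \<le> L\<close> by auto
qed

section \<open>Flows of \<open>C\<^sup>1\<close> vector fields\<close>

definition flow :: "('a::euclidean_space \<Rightarrow> 'a) \<Rightarrow> real \<Rightarrow> 'a \<Rightarrow> 'a" where
  "flow Y t x = (SOME \<phi>. \<phi> 0 = x \<and> (\<forall>s. (\<phi> has_vector_derivative Y (\<phi> s)) (at s))) t"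

text \<open>The fundamental solution of the variational equation along the flow line of
  \<open>x\<close>; \<open>flow_has_derivative\<close> shows that it is the derivative of the flow
  in the initial point.\<close>

definition dflow :: "('a::euclidean_space \<Rightarrow> 'a) \<Rightarrow> ('a \<Rightarrow> 'a \<Rightarrow>\<^sub>L 'a) \<Rightarrow> real \<Rightarrow> 'a \<Rightarrow> 'a \<Rightarrow>\<^sub>L 'a" where
  "dflow Y Y' t x = (SOME \<psi>. \<psi> 0 = id_blinfun \<and>
     (\<forall>s. (\<psi> has_vector_derivative (Y' (flow Y s x) o\<^sub>L \<psi> s)) (at s))) t"

text \<open>Gronwall bounds squares. As \<open>E\<close> is at least \<open>1\<close>, it may be
  enlarged to \<open>E\<^sup>2\<close>, and a factor \<open>E\<close> instead of its square root
  remains.\<close>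

lemma le_mult_if_power2_le:
  fixes a c E :: real
  assumes "a\<^sup>2 \<le> c\<^sup>2 * E" "1 \<le> E" "0 \<le> c"
  shows "a \<le> c * E"
proof (rule power2_le_imp_le)
  have "c\<^sup>2 * E \<le> c\<^sup>2 * E * E" using assms mult_left_mono[of 1 E "c\<^sup>2 * E"] by simp
  then show "a\<^sup>2 \<le> (c * E)\<^sup>2" using assms(1) by (simp only: power_mult_distrib) (simp add: power2_eq_square mult_ac)
qed (use assms in simp)

text \<open>The global bounds make the flow complete and the constants in all estimates independent
  of the base point; \<open>cutoff_exists\<close> produces such fields from locally given
  ones.\<close>

locale c1_field =
  fixes Y :: "'a::euclidean_space \<Rightarrow> 'a" and Y' :: "'a \<Rightarrow> 'a \<Rightarrow>\<^sub>L 'a" and L B :: real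
  assumes deriv: "\<And>x. (Y has_derivative blinfun_apply (Y' x)) (at x)"
    and cont_deriv: "continuous_on UNIV Y'"
    and L_pos: "L > 0" and norm_deriv_le: "\<And>x. norm (Y' x) \<le> L" and norm_le: "\<And>x. norm (Y x) \<le> B"
begin

lemma B_nonneg: "B \<ge> 0"
  using norm_le[of 0] norm_ge_zero order_trans by blast

lemma lipschitz: "norm (Y x - Y y) \<le> L * norm (x - y)"
  by (rule differentiable_bound[OF convex_UNIV, where f' = "\<lambda>x. blinfun_apply (Y' x)"])
    (use deriv norm_deriv_le in \<open>auto simp: norm_blinfun.rep_eq[symmetric] has_derivative_at_withinI\<close>)

lemma continuous: "continuous_on UNIV Y"
  using deriv by (meson has_derivative_continuous continuous_at_imp_continuous_on)

lemma norm_deriv_apply_le: "norm (Y' x v) \<le> L * norm v"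
  using norm_blinfun[of "Y' x" v] norm_deriv_le[of x] by (meson mult_right_mono norm_ge_zero order_trans)

lemma flow_ex: "\<exists>\<phi>. \<phi> 0 = x \<and> (\<forall>t. (\<phi> has_vector_derivative Y (\<phi> t)) (at t))"
proof (rule picard_global[OF _ lipschitz L_pos norm_le])
  show "continuous_on UNIV (\<lambda>(t::real, x). Y x)"
    unfolding case_prod_beta
    by (rule continuous_on_compose2[OF continuous]) (auto intro: continuous_intros)
qed

lemma flow_0 [simp]: "flow Y 0 x = x"
  and flow_deriv: "((\<lambda>t. flow Y t x) has_vector_derivative Y (flow Y t x)) (at t)"
  using someI_ex[OF flow_ex[of x]] unfolding flow_def by auto

lemma solution_lipschitz:
  assumes "\<And>t. (\<phi> has_vector_derivative Y (\<phi> t)) (at t)" "\<And>t. (\<psi> has_vector_derivative Y (\<psi> t)) (at t)"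
  shows "norm (\<phi> t - \<psi> t) \<le> norm (\<phi> 0 - \<psi> 0) * exp ((2 * L + 1) * \<bar>t\<bar>)"
proof (rule le_mult_if_power2_le)
  show "(norm (\<phi> t - \<psi> t))\<^sup>2 \<le> (norm (\<phi> 0 - \<psi> 0))\<^sup>2 * exp ((2 * L + 1) * \<bar>t\<bar>)"
    using gronwall[of "\<lambda>t. \<phi> t - \<psi> t" "\<lambda>t. Y (\<phi> t) - Y (\<psi> t)" t L 0] lipschitz L_pos
    by (auto intro!: has_vector_derivative_diff assms)
qed (use L_pos in auto)

lemma flow_unique:
  assumes "\<And>t. (\<phi> has_vector_derivative Y (\<phi> t)) (at t)"
  shows "\<phi> t = flow Y t (\<phi> 0)"
  using solution_lipschitz[of \<phi> "\<lambda>t. flow Y t (\<phi> 0)" t] assms flow_deriv by simp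

lemma flow_lipschitz: "norm (flow Y t x - flow Y t y) \<le> norm (x - y) * exp ((2 * L + 1) * \<bar>t\<bar>)"
  using solution_lipschitz[of "\<lambda>t. flow Y t x" "\<lambda>t. flow Y t y" t] flow_deriv by simp

lemma flow_flow: "flow Y s (flow Y t x) = flow Y (s + t) x"
proof -
  have "((\<lambda>s. flow Y (s + t) x) has_vector_derivative Y (flow Y (s + t) x)) (at s)" for s
  proof -
    have "((\<lambda>s. s + t) has_vector_derivative 1) (at s)" by (auto intro!: derivative_eq_intros)
    from vector_diff_chain_at[OF this flow_deriv] show ?thesis by (simp add: o_def)
  qed
  from flow_unique[of "\<lambda>s. flow Y (s + t) x", OF this] show ?thesis by simp
qed

lemma flow_inverse [simp]: "flow Y (- t) (flow Y t x) = x" "flow Y t (flow Y (- t) x) = x"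
  by (simp_all add: flow_flow)

lemma flow_dist_le: "norm (flow Y t x - x) \<le> B * \<bar>t\<bar>"
proof -
  have "norm (flow Y t x - flow Y 0 x) \<le> B * norm (t - 0)"
  proof (rule differentiable_bound[OF convex_UNIV, where f' = "\<lambda>t s. s *\<^sub>R Y (flow Y t x)"])
    show "onorm (\<lambda>s. s *\<^sub>R Y (flow Y t x)) \<le> B" for t
      using norm_le[of "flow Y t x"] mult_left_mono[OF norm_le abs_ge_zero]
      by (intro onorm_le) (simp add: mult.commute)
    show "((\<lambda>t. flow Y t x) has_derivative (\<lambda>s. s *\<^sub>R Y (flow Y t x))) (at t within UNIV)" for t
      using flow_deriv[of x t] by (simp add: has_vector_derivative_def)
  qed auto
  then show ?thesis by simp
qed

lemma flow_cont: "continuous_on UNIV (\<lambda>(t, x). flow Y t x)"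
proof -
  have "continuous (at (t0, x0)) (\<lambda>(t, x). flow Y t x)" for t0 x0
    unfolding continuous_at
  proof (rule Lim_null_comparison[where g = "\<lambda>p. norm (snd p - x0) * exp ((2 * L + 1) * \<bar>t0\<bar>) + B * \<bar>fst p - t0\<bar>", THEN LIM_zero_cancel])
    have "norm (flow Y t x - flow Y t0 x0) \<le> norm (x - x0) * exp ((2 * L + 1) * \<bar>t0\<bar>) + B * \<bar>t - t0\<bar>" for t x
    proof -
      have "flow Y t x = flow Y (t - t0) (flow Y t0 x)" by (simp add: flow_flow)
      then have "norm (flow Y t x - flow Y t0 x) \<le> B * \<bar>t - t0\<bar>" using flow_dist_le by simp
      then show ?thesis using flow_lipschitz[of t0 x x0]
          norm_triangle_ineq[of "flow Y t x - flow Y t0 x" "flow Y t0 x - flow Y t0 x0"] by simp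
    qed
    then show "\<forall>\<^sub>F p in at (t0, x0). norm ((case p of (t, x) \<Rightarrow> flow Y t x) - (case (t0, x0) of (t, x) \<Rightarrow> flow Y t x))
        \<le> norm (snd p - x0) * exp ((2 * L + 1) * \<bar>t0\<bar>) + B * \<bar>fst p - t0\<bar>"
      by (auto simp: case_prod_beta)
    show "((\<lambda>p. norm (snd p - x0) * exp ((2 * L + 1) * \<bar>t0\<bar>) + B * \<bar>fst p - t0\<bar>) \<longlongrightarrow> 0) (at (t0, x0))"
      by (auto intro!: tendsto_eq_intros)
  qed
  then show ?thesis by (auto intro!: continuous_at_imp_continuous_on)
qed

lemma flow_cont_compose [continuous_intros]:
  assumes "continuous_on S f" "continuous_on S g"
  shows "continuous_on S (\<lambda>z. flow Y (f z) (g z))"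
  using continuous_on_compose2[OF flow_cont continuous_on_Pair[OF assms]] by simp

section \<open>The variational equation and differentiability of the flow\<close>

lemma dflow_ex: "\<exists>\<psi>. \<psi> 0 = id_blinfun \<and> (\<forall>s. (\<psi> has_vector_derivative (Y' (flow Y s x) o\<^sub>L \<psi> s)) (at s))"
proof (rule picard_global[where L = L and B = L])
  have "continuous_on UNIV (\<lambda>p. Y' (flow Y (fst p) x) o\<^sub>L snd p)"
    by (intro continuous_intros continuous_on_compose2[OF cont_deriv]) auto
  then show "continuous_on UNIV (\<lambda>(s, M). Y' (flow Y s x) o\<^sub>L M)" by (simp add: case_prod_beta)
  fix s and M N :: "'a \<Rightarrow>\<^sub>L 'a"
  have "norm (Y' (flow Y s x) o\<^sub>L (M - N)) \<le> norm (Y' (flow Y s x)) * norm (M - N)"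
    by (rule norm_blinfun_compose)
  also have "\<dots> \<le> L * norm (M - N)" by (simp add: norm_deriv_le mult_right_mono)
  finally show "norm ((Y' (flow Y s x) o\<^sub>L M) - (Y' (flow Y s x) o\<^sub>L N)) \<le> L * norm (M - N)"
    by (simp add: bounded_bilinear.diff_right[OF bounded_bilinear_blinfun_compose])
  show "norm (Y' (flow Y s x) o\<^sub>L id_blinfun) \<le> L"
  proof -
    have "Y' (flow Y s x) o\<^sub>L id_blinfun = Y' (flow Y s x)" by (rule blinfun_eqI) simp
    then show ?thesis by (simp add: norm_deriv_le)
  qed
qed (rule L_pos)

lemma dflow_0 [simp]: "dflow Y Y' 0 x = id_blinfun"
  and dflow_deriv: "((\<lambda>t. dflow Y Y' t x) has_vector_derivative (Y' (flow Y t x) o\<^sub>L dflow Y Y' t x)) (at t)"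
  using someI_ex[OF dflow_ex[of x]] unfolding dflow_def by auto

lemma dflow_apply_deriv:
  "((\<lambda>t. dflow Y Y' t x v) has_vector_derivative Y' (flow Y t x) (dflow Y Y' t x v)) (at t)"
proof -
  have "bounded_linear (\<lambda>M::'a \<Rightarrow>\<^sub>L 'a. M v)" by simp
  from bounded_linear.has_vector_derivative[OF this dflow_deriv] show ?thesis by simp
qed

lemma dflow_bound: "norm (dflow Y Y' t x v) \<le> norm v * exp ((2 * L + 1) * \<bar>t\<bar>)"
proof (rule le_mult_if_power2_le)
  show "(norm (dflow Y Y' t x v))\<^sup>2 \<le> (norm v)\<^sup>2 * exp ((2 * L + 1) * \<bar>t\<bar>)"
    using gronwall[of "\<lambda>t. dflow Y Y' t x v" _ t L 0, OF dflow_apply_deriv] norm_deriv_apply_le L_pos by simp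
qed (use L_pos in auto)

text \<open>Up to time \<open>T\<close> the flow line moves at most \<open>B * T\<close> away from
  \<open>x\<close>; the radius of \<open>C\<close> leaves room \<open>1\<close> for
  \<open>z\<close>. Uniform continuity of \<open>Y'\<close> on this compact ball yields one
  \<open>\<delta>\<close> for all times, as the Gronwall estimates require.\<close>

lemma deriv_uniform:
  assumes "\<eta> > 0"
  shows "\<exists>\<delta>>0. \<forall>t z. \<bar>t\<bar> \<le> T \<and> norm (z - flow Y t x) < \<delta> \<longrightarrow> norm (Y' z - Y' (flow Y t x)) < \<eta>"
proof -
  define C where "C = cball x (B * T + 1)"
  have "uniformly_continuous_on C Y'"
    unfolding C_def by (intro compact_uniformly_continuous continuous_on_subset[OF cont_deriv]) auto
  then obtain \<delta> where \<delta>: "\<delta> > 0" "\<And>y z. y \<in> C \<Longrightarrow> z \<in> C \<Longrightarrow> dist z y < \<delta> \<Longrightarrow> dist (Y' z) (Y' y) < \<eta>"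
    using assms unfolding uniformly_continuous_on_def by metis
  have "norm (Y' z - Y' (flow Y t x)) < \<eta>" if "\<bar>t\<bar> \<le> T" "norm (z - flow Y t x) < min \<delta> 1" for t z
  proof -
    have "norm (flow Y t x - x) \<le> B * T"
      using flow_dist_le[of t x] mult_left_mono[OF that(1) B_nonneg] by linarith
    moreover have "norm (z - x) \<le> norm (z - flow Y t x) + norm (flow Y t x - x)"
      by (metis diff_add_cancel add_diff_eq norm_triangle_ineq)
    ultimately have "flow Y t x \<in> C" "z \<in> C"
      using that by (auto simp: C_def dist_norm norm_minus_commute)
    with \<delta>(2)[of "flow Y t x" z] that show ?thesis by (simp add: dist_norm)
  qed
  then show ?thesis using \<delta>(1) by (intro exI[of _ "min \<delta> 1"]) auto
qed

text \<open>The derivative of the error \<open>e\<close> is bounded by \<open>L * norm (e s)\<close>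
  plus the linearisation error of \<open>Y\<close> at \<open>flow Y s x\<close>, which is small
  relative to \<open>norm (y - x)\<close> uniformly in \<open>s\<close>; Gronwall applies with
  \<open>e 0 = 0\<close>.\<close>

lemma flow_has_derivative: "(flow Y t has_derivative blinfun_apply (dflow Y Y' t x)) (at x)"
  unfolding has_derivative_at_alt
proof (intro conjI allI impI)
  fix \<epsilon> :: real assume "\<epsilon> > 0"
  define E where "E = exp ((2 * L + 1) * \<bar>t\<bar>)"
  have E: "E \<ge> 1" using L_pos by (simp add: E_def)
  \<comment> \<open>One factor \<open>E\<close> is lost in \<open>flow_lipschitz\<close>, the other
    in Gronwall.\<close>
  define \<eta> where "\<eta> = \<epsilon> / E\<^sup>2"
  have "\<eta> > 0" using E \<open>\<epsilon> > 0\<close> by (simp add: \<eta>_def)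
  from deriv_uniform[OF this, of "\<bar>t\<bar>" x] obtain \<delta> where "\<delta> > 0"
    and \<delta>: "\<And>s z. \<bar>s\<bar> \<le> \<bar>t\<bar> \<Longrightarrow> norm (z - flow Y s x) < \<delta> \<Longrightarrow> norm (Y' z - Y' (flow Y s x)) < \<eta>" by blast
  have "norm (flow Y t y - flow Y t x - dflow Y Y' t x (y - x)) \<le> \<epsilon> * norm (y - x)"
    if y: "norm (y - x) < \<delta> / E" for y
  proof -
    define e where "e s = flow Y s y - flow Y s x - dflow Y Y' s x (y - x)" for s
    have "e 0 = 0" by (simp add: e_def)
    have "(norm (e t))\<^sup>2 \<le> ((norm (e 0))\<^sup>2 + (\<eta> * E * norm (y - x))\<^sup>2) * exp ((2 * L + 1) * \<bar>t\<bar>)"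
    proof (rule gronwall)
      show "(e has_vector_derivative Y (flow Y s y) - Y (flow Y s x) - Y' (flow Y s x) (dflow Y Y' s x (y - x))) (at s)" for s
        unfolding e_def by (intro has_vector_derivative_diff flow_deriv dflow_apply_deriv)
      fix s assume s: "\<bar>s\<bar> \<le> \<bar>t\<bar>"
      define a where "a = flow Y s x"
      define b where "b = flow Y s y"
      have "exp ((2 * L + 1) * \<bar>s\<bar>) \<le> E" using s L_pos by (simp add: E_def)
      then have ba: "norm (b - a) \<le> E * norm (y - x)"
        using flow_lipschitz[of s y x] mult_left_mono[of "exp ((2 * L + 1) * \<bar>s\<bar>)" E "norm (y - x)"]
        by (simp add: a_def b_def mult_ac)
      also have "\<dots> < \<delta>" using y E by (simp add: field_simps)
      finally have "norm (b - a) < \<delta>" .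
      have "norm (Y b - Y a - Y' a (b - a)) \<le> norm (b - a) * \<eta>"
      proof (rule differentiable_bound_linearization[where S = "ball a \<delta>" and f' = "\<lambda>x. blinfun_apply (Y' x)"])
        fix u :: real assume "u \<in> {0..1}"
        then have "norm (u *\<^sub>R (b - a)) \<le> norm (b - a)" by (simp add: mult_left_le_one_le)
        with \<open>norm (b - a) < \<delta>\<close> show "a + u *\<^sub>R (b - a) \<in> ball a \<delta>" by (simp add: dist_norm)
      next
        fix z assume "z \<in> ball a \<delta>"
        then have "norm (Y' z - Y' a) \<le> \<eta>" using \<delta>[OF s, of z] by (simp add: a_def dist_norm norm_minus_commute less_imp_le)
        then show "onorm (blinfun_apply (Y' z) - blinfun_apply (Y' a)) \<le> \<eta>" by (simp add: norm_blinfun.rep_eq minus_blinfun.rep_eq fun_diff_def)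
      qed (use \<open>\<delta> > 0\<close> deriv in \<open>auto intro: has_derivative_at_withinI\<close>)
      moreover have "norm (Y' a (e s)) \<le> L * norm (e s)" by (rule norm_deriv_apply_le)
      moreover have "norm (b - a) * \<eta> \<le> \<eta> * E * norm (y - x)"
        using mult_left_mono[OF ba, of \<eta>] \<open>\<eta> > 0\<close> by (simp add: mult_ac)
      ultimately have "norm ((Y b - Y a - Y' a (b - a)) + Y' a (e s)) \<le> L * norm (e s) + \<eta> * E * norm (y - x)"
        using norm_triangle_ineq[of "Y b - Y a - Y' a (b - a)" "Y' a (e s)"] by linarith
      moreover have "(Y b - Y a - Y' a (b - a)) + Y' a (e s) = Y b - Y a - Y' a (dflow Y Y' s x (y - x))"
        by (simp add: e_def a_def b_def blinfun.diff_right)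
      ultimately show "norm (Y (flow Y s y) - Y (flow Y s x) - Y' (flow Y s x) (dflow Y Y' s x (y - x)))
          \<le> L * norm (e s) + \<eta> * E * norm (y - x)"
        unfolding a_def b_def by (simp only:)
    qed (use L_pos in simp)
    note est = this
    have "norm (e t) \<le> (\<eta> * E * norm (y - x)) * E"
    proof (rule le_mult_if_power2_le)
      show "(norm (e t))\<^sup>2 \<le> (\<eta> * E * norm (y - x))\<^sup>2 * E"
        using est \<open>e 0 = 0\<close> unfolding E_def[symmetric] by simp
    qed (use \<open>\<eta> > 0\<close> E in auto)
    also have "\<dots> = \<epsilon> * norm (y - x)" using E by (simp add: \<eta>_def power2_eq_square)
    finally show ?thesis by (simp add: e_def)
  qed
  then show "\<exists>d>0. \<forall>y. norm (y - x) < d \<longrightarrow>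
      norm (flow Y t y - flow Y t x - dflow Y Y' t x (y - x)) \<le> \<epsilon> * norm (y - x)"
    using \<open>\<delta> > 0\<close> E by (intro exI[of _ "\<delta> / E"]) auto
qed (rule blinfun.bounded_linear_right)

text \<open>In \<open>x\<close>, uniformly for \<open>\<bar>t\<bar> \<le> T\<close>, two variational
  equations are compared by Gronwall, with the difference of the coefficients \<open>Y'\<close> as
  inhomogeneity; in \<open>t\<close>, differentiability at the fixed point \<open>x0\<close>
  suffices. Each contributes \<open>\<epsilon> / 2\<close>.\<close>

lemma dflow_cont: "continuous_on UNIV (\<lambda>(t, x). dflow Y Y' t x)"
proof -
  have "continuous (at (t0, x0)) (\<lambda>(t, x). dflow Y Y' t x)" for t0 x0
    unfolding continuous_at_eps_delta
  proof (intro allI impI)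
    fix \<epsilon> :: real assume "\<epsilon> > 0"
    define T where "T = \<bar>t0\<bar> + 1"
    define E where "E = exp ((2 * L + 1) * T)"
    have E: "E \<ge> 1" using L_pos by (simp add: E_def T_def)
    define \<eta> where "\<eta> = \<epsilon> / 2 / E\<^sup>2"
    have "\<eta> > 0" using E \<open>\<epsilon> > 0\<close> by (simp add: \<eta>_def)
    from deriv_uniform[OF this, of T x0] obtain \<delta> where "\<delta> > 0"
      and \<delta>: "\<And>s z. \<bar>s\<bar> \<le> T \<Longrightarrow> norm (z - flow Y s x0) < \<delta> \<Longrightarrow> norm (Y' z - Y' (flow Y s x0)) < \<eta>" by blast
    have near: "norm (dflow Y Y' t x - dflow Y Y' t x0) \<le> \<epsilon> / 2" if t: "\<bar>t\<bar> \<le> T" and x: "norm (x - x0) < \<delta> / E" for t x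
    proof (rule norm_blinfun_bound)
      fix v
      define e where "e s = dflow Y Y' s x v - dflow Y Y' s x0 v" for s
      have "e 0 = 0" by (simp add: e_def)
      have Et: "exp ((2 * L + 1) * \<bar>s\<bar>) \<le> E" if "\<bar>s\<bar> \<le> T" for s using that L_pos by (simp add: E_def)
      have "(norm (e t))\<^sup>2 \<le> ((norm (e 0))\<^sup>2 + (\<eta> * E * norm v)\<^sup>2) * exp ((2 * L + 1) * \<bar>t\<bar>)"
      proof (rule gronwall)
        show "(e has_vector_derivative Y' (flow Y s x) (dflow Y Y' s x v) - Y' (flow Y s x0) (dflow Y Y' s x0 v)) (at s)" for s
          unfolding e_def by (intro has_vector_derivative_diff dflow_apply_deriv)
        fix s assume "\<bar>s\<bar> \<le> \<bar>t\<bar>"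
        then have s: "\<bar>s\<bar> \<le> T" using t by simp
        have "norm (flow Y s x - flow Y s x0) \<le> norm (x - x0) * E"
          using flow_lipschitz[of s x x0] mult_left_mono[OF Et[OF s] norm_ge_zero[of "x - x0"]] by linarith
        also have "\<dots> < \<delta>" using x E by (simp add: field_simps)
        finally have "norm (Y' (flow Y s x) - Y' (flow Y s x0)) \<le> \<eta>" using \<delta>[OF s] by (simp add: less_imp_le)
        moreover have "norm (dflow Y Y' s x0 v) \<le> norm v * E"
          using dflow_bound[of s x0 v] mult_left_mono[OF Et[OF s] norm_ge_zero[of v]] by linarith
        ultimately have "norm ((Y' (flow Y s x) - Y' (flow Y s x0)) (dflow Y Y' s x0 v)) \<le> \<eta> * (norm v * E)"
          by (meson norm_blinfun mult_mono norm_ge_zero order_trans \<open>\<eta> > 0\<close> less_imp_le)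
        moreover have "norm (Y' (flow Y s x) (e s)) \<le> L * norm (e s)" by (rule norm_deriv_apply_le)
        ultimately have "norm (Y' (flow Y s x) (e s) + (Y' (flow Y s x) - Y' (flow Y s x0)) (dflow Y Y' s x0 v))
            \<le> L * norm (e s) + \<eta> * (norm v * E)"
          using norm_triangle_ineq[of "Y' (flow Y s x) (e s)" "(Y' (flow Y s x) - Y' (flow Y s x0)) (dflow Y Y' s x0 v)"]
          by linarith
        moreover have "Y' (flow Y s x) (e s) + (Y' (flow Y s x) - Y' (flow Y s x0)) (dflow Y Y' s x0 v)
            = Y' (flow Y s x) (dflow Y Y' s x v) - Y' (flow Y s x0) (dflow Y Y' s x0 v)"
          by (simp add: e_def blinfun.bilinear_simps)
        moreover have "\<eta> * (norm v * E) = \<eta> * E * norm v" by simp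
        ultimately show "norm (Y' (flow Y s x) (dflow Y Y' s x v) - Y' (flow Y s x0) (dflow Y Y' s x0 v))
            \<le> L * norm (e s) + \<eta> * E * norm v"
          by (simp only:)
      qed (use L_pos in simp)
      also have "\<dots> \<le> (\<eta> * E * norm v)\<^sup>2 * E"
        using Et[OF t] \<open>e 0 = 0\<close> by (simp add: mult_left_mono)
      finally have "norm (e t) \<le> (\<eta> * E * norm v) * E"
        by (rule le_mult_if_power2_le) (use \<open>\<eta> > 0\<close> E in auto)
      also have "\<dots> = \<epsilon> / 2 * norm v" using E by (simp add: \<eta>_def power2_eq_square)
      finally show "norm ((dflow Y Y' t x - dflow Y Y' t x0) v) \<le> \<epsilon> / 2 * norm v"
        by (simp add: e_def blinfun.diff_left)
    qed (use \<open>\<epsilon> > 0\<close> in simp)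
    have "continuous (at t0) (\<lambda>t. dflow Y Y' t x0)"
      by (rule has_vector_derivative_continuous[OF dflow_deriv])
    then obtain d where "d > 0" and d: "\<And>t. \<bar>t - t0\<bar> < d \<Longrightarrow> norm (dflow Y Y' t x0 - dflow Y Y' t0 x0) < \<epsilon> / 2"
      using \<open>\<epsilon> > 0\<close> unfolding continuous_at_eps_delta dist_norm real_norm_def by (metis half_gt_zero)
    have "dist (dflow Y Y' t x) (dflow Y Y' t0 x0) < \<epsilon>"
      if "dist (t, x) (t0, x0) < min (min 1 d) (\<delta> / E)" for t x
    proof -
      have "\<bar>t - t0\<bar> < min 1 d" "norm (x - x0) < \<delta> / E"
        using that dist_fst_le[of "(t, x)" "(t0, x0)"] dist_snd_le[of "(t, x)" "(t0, x0)"]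
        by (auto simp: dist_norm)
      then have "\<bar>t\<bar> \<le> T" "\<bar>t - t0\<bar> < d" by (auto simp: T_def)
      then show ?thesis using near[of t x] d[of t] \<open>norm (x - x0) < \<delta> / E\<close>
          norm_triangle_ineq[of "dflow Y Y' t x - dflow Y Y' t x0" "dflow Y Y' t x0 - dflow Y Y' t0 x0"]
        unfolding dist_norm by simp
    qed
    then show "\<exists>d>0. \<forall>p. dist p (t0, x0) < d \<longrightarrow>
        dist (case p of (t, x) \<Rightarrow> dflow Y Y' t x) (case (t0, x0) of (t, x) \<Rightarrow> dflow Y Y' t x) < \<epsilon>"
      using \<open>d > 0\<close> \<open>\<delta> > 0\<close> E by (intro exI[of _ "min (min 1 d) (\<delta> / E)"]) auto
  qed
  then show ?thesis by (auto intro!: continuous_at_imp_continuous_on)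
qed

text \<open>Chain rule for the total derivative of the flow in time and space. The latter follows
  from the partial derivatives, because the one in space, \<open>dflow\<close>, is jointly
  continuous.\<close>

lemma flow_compose_has_derivative:
  assumes f: "(f has_derivative f') (at z)" and g: "(g has_derivative g') (at z)"
  shows "((\<lambda>z. flow Y (f z) (g z)) has_derivative
    (\<lambda>v. f' v *\<^sub>R Y (flow Y (f z) (g z)) + dflow Y Y' (f z) (g z) (g' v))) (at z)"
proof -
  have "((\<lambda>(t, x). flow Y t x) has_derivative
      (\<lambda>(s, v). s *\<^sub>R Y (flow Y (f z) (g z)) + dflow Y Y' (f z) (g z) v)) (at (f z, g z) within UNIV \<times> UNIV)"
    by (rule has_derivative_partialsI)
      (use flow_deriv dflow_cont in \<open>auto simp: has_vector_derivative_def continuous_on_eq_continuous_at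
        intro: flow_has_derivative\<close>)
  then have "((\<lambda>(t, x). flow Y t x) has_derivative
      (\<lambda>(s, v). s *\<^sub>R Y (flow Y (f z) (g z)) + dflow Y Y' (f z) (g z) v)) (at (f z, g z))" by simp
  from has_derivative_compose[OF has_derivative_Pair[OF f g] this] show ?thesis by simp
qed

end

section \<open>Proximal normals and brackets\<close>

definition proximal_normal :: "'a::real_inner set \<Rightarrow> 'a \<Rightarrow> 'a \<Rightarrow> bool" where
  "proximal_normal S s \<nu> \<longleftrightarrow> (\<forall>y\<in>S. norm \<nu> \<le> norm (s + \<nu> - y))"

text \<open>With \<open>\<gamma> t = s + u t *\<^sub>R q t\<close>, squaring
  \<open>norm \<nu> \<le> norm (\<nu> - u t *\<^sub>R q t)\<close> gives
  \<open>2 * (\<nu> \<bullet> q t) \<le> u t * (q t \<bullet> q t)\<close>, whose right side tends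
  to \<open>0\<close>. The gauge \<open>u\<close> will be \<open>t\<close> for velocities of curves
  and \<open>t\<^sup>2\<close> for brackets.\<close>

lemma proximal_normal_contingent:
  assumes "proximal_normal S s \<nu>" and F: "F \<noteq> bot"
    and "\<forall>\<^sub>F t in F. \<gamma> t \<in> S" "\<forall>\<^sub>F t in F. u t > (0::real)" "(u \<longlongrightarrow> 0) F"
    and lim: "((\<lambda>t. (1 / u t) *\<^sub>R (\<gamma> t - s)) \<longlongrightarrow> w) F"
  shows "\<nu> \<bullet> w \<le> 0"
proof -
  define q where "q t = (1 / u t) *\<^sub>R (\<gamma> t - s)" for t
  have "\<forall>\<^sub>F t in F. 2 * (\<nu> \<bullet> q t) \<le> u t * (q t \<bullet> q t)"
    using assms(3,4)
  proof eventually_elim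
    case (elim t)
    have "norm \<nu> \<le> norm (s + \<nu> - \<gamma> t)" using assms(1) elim by (auto simp: proximal_normal_def)
    also have "s + \<nu> - \<gamma> t = \<nu> - u t *\<^sub>R q t" using elim by (simp add: q_def algebra_simps)
    finally have "\<nu> \<bullet> \<nu> \<le> (\<nu> - u t *\<^sub>R q t) \<bullet> (\<nu> - u t *\<^sub>R q t)"
      by (simp add: norm_le)
    then have "u t * (2 * (\<nu> \<bullet> q t)) \<le> u t * (u t * (q t \<bullet> q t))"
      by (simp add: inner_diff inner_commute algebra_simps)
    then show ?case using elim by simp
  qed
  moreover have "((\<lambda>t. u t * (q t \<bullet> q t)) \<longlongrightarrow> 0 * (w \<bullet> w)) F"
    using assms(5) lim unfolding q_def by (intro tendsto_intros)
  moreover have "((\<lambda>t. 2 * (\<nu> \<bullet> q t)) \<longlongrightarrow> 2 * (\<nu> \<bullet> w)) F"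
    using lim unfolding q_def by (intro tendsto_intros)
  ultimately have "2 * (\<nu> \<bullet> w) \<le> 0 * (w \<bullet> w)"
    using F tendsto_le by blast
  then show ?thesis by simp
qed

text \<open>Meant for squared distances, which need not be differentiable: a majorant touching
  \<open>h\<close> at \<open>t\<close> with nonpositive derivative bounds the upper right Dini
  derivative of \<open>h\<close> by \<open>0\<close>. The contradiction arises at the last point
  where the tilted function \<open>g\<close> is at most \<open>g a\<close>.\<close>

lemma nonincreasing_if_majorants:
  fixes h :: "real \<Rightarrow> real"
  assumes "a \<le> b" "continuous_on {a..b} h"
    and maj: "\<And>t. a \<le> t \<Longrightarrow> t < b \<Longrightarrow>
      \<exists>V D. V t = h t \<and> (\<forall>\<tau>. h \<tau> \<le> V \<tau>) \<and> (V has_real_derivative D) (at t) \<and> D \<le> 0"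
  shows "h b \<le> h a"
proof (rule ccontr)
  assume "\<not> h b \<le> h a"
  then have "h a < h b" "a < b" using \<open>a \<le> b\<close> by (auto simp: order_le_less)
  \<comment> \<open>Half the mean slope: positive, yet small enough that the tilted function still
    satisfies \<open>g a < g b\<close>.\<close>
  define \<epsilon> where "\<epsilon> = (h b - h a) / (b - a) / 2"
  have "\<epsilon> > 0" using \<open>h a < h b\<close> \<open>a < b\<close> by (simp add: \<epsilon>_def)
  define g where "g t = h t - \<epsilon> * (t - a)" for t
  have "\<epsilon> * (b - a) = (h b - h a) / 2" using \<open>a < b\<close> unfolding \<epsilon>_def by (simp only: times_divide_eq_left) simp
  then have "g a < g b" using \<open>h a < h b\<close> by (simp add: g_def)
  have "continuous_on {a..b} g" unfolding g_def by (intro continuous_intros assms)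
  then have "closed ({a..b} \<inter> g -` {..g a})"
    by (intro continuous_closed_preimage) auto
  then have "compact ({a..b} \<inter> g -` {..g a})"
    by (auto simp: compact_eq_bounded_closed intro: bounded_subset[OF bounded_closed_interval])
  moreover have "a \<in> {a..b} \<inter> g -` {..g a}" using \<open>a < b\<close> by simp
  ultimately obtain t0 where "t0 \<in> {a..b} \<inter> g -` {..g a}" "\<forall>t\<in>{a..b} \<inter> g -` {..g a}. t \<le> t0"
    using compact_attains_sup[of "{a..b} \<inter> g -` {..g a}"] by blast
  then have t0: "t0 \<in> {a..b}" "g t0 \<le> g a"
    and max: "\<And>t. t \<in> {a..b} \<Longrightarrow> g t \<le> g a \<Longrightarrow> t \<le> t0" by auto
  then have "t0 < b" using \<open>g a < g b\<close> by (cases "t0 = b") auto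
  then obtain V D where V: "V t0 = h t0" "\<And>\<tau>. h \<tau> \<le> V \<tau>" "(V has_real_derivative D) (at t0)" "D \<le> 0"
    using maj[of t0] t0 by auto
  have "((\<lambda>t. V t - \<epsilon> * (t - a)) has_real_derivative D - \<epsilon>) (at t0)"
    using V(3) by (auto intro!: derivative_eq_intros)
  from DERIV_neg_dec_right[OF this] obtain d where "d > 0"
    and d: "\<And>k. 0 < k \<Longrightarrow> k < d \<Longrightarrow> V (t0 + k) - \<epsilon> * (t0 + k - a) < V t0 - \<epsilon> * (t0 - a)"
    using \<open>\<epsilon> > 0\<close> V(4) by auto
  define k where "k = min (d / 2) (b - t0)"
  have k: "0 < k" "k < d" "t0 + k \<le> b" using \<open>d > 0\<close> \<open>t0 < b\<close> by (auto simp: k_def)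
  then have "g (t0 + k) < g t0" using d[of k] V(2)[of "t0 + k"] V(1) by (simp add: g_def)
  then have "t0 + k \<le> t0" using max[of "t0 + k"] k t0 by auto
  then show False using k by simp
qed

text \<open>Invariance in the style of Nagumo, Bony and Brezis: at time \<open>t\<close> the squared distance of \<open>\<phi>\<close> to \<open>S\<close>
  is majorised by the squared distance to the point of \<open>S\<close> nearest to \<open>\<phi> t\<close>.\<close>

lemma nagumo:
  fixes \<phi> :: "real \<Rightarrow> 'a::euclidean_space"
  assumes S: "closed S" and lip: "\<And>x y. norm (Z x - Z y) \<le> L * norm (x - y)"
    and \<phi>: "\<And>t. (\<phi> has_vector_derivative Z (\<phi> t)) (at t)"
    and normal: "\<And>s \<nu>. s \<in> S \<Longrightarrow> proximal_normal S s \<nu> \<Longrightarrow> \<nu> \<bullet> Z s \<le> 0"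
    and "\<phi> 0 \<in> S" "T \<ge> 0"
  shows "\<phi> T \<in> S"
proof -
  \<comment> \<open>The weight compensates the growth rate \<open>2 * L\<close> of the squared
    distance that results from replacing \<open>Z (\<phi> t)\<close> by the value of
    \<open>Z\<close> at the nearest point.\<close>
  define h where "h t = (infdist (\<phi> t) S)\<^sup>2 * exp (- 2 * L * t)" for t
  have S0: "S \<noteq> {}" using \<open>\<phi> 0 \<in> S\<close> by auto
  have "h T \<le> h 0"
  proof (rule nonincreasing_if_majorants[OF \<open>T \<ge> 0\<close>])
    show "continuous_on {0..T} h"
      unfolding h_def
      by (intro continuous_intros continuous_at_imp_continuous_on ballI has_vector_derivative_continuous[OF \<phi>])
    fix t :: real
    obtain s where s: "s \<in> S" "infdist (\<phi> t) S = dist (\<phi> t) s"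
      using infdist_attains_inf[OF S S0] by blast
    define \<nu> where "\<nu> = \<phi> t - s"
    have "proximal_normal S s \<nu>"
      using s infdist_le[of _ S "\<phi> t"] by (auto simp: proximal_normal_def \<nu>_def dist_norm)
    then have "\<nu> \<bullet> Z s \<le> 0" using normal s by blast
    have "\<nu> \<bullet> (Z (\<phi> t) - Z s) \<le> norm \<nu> * (L * norm \<nu>)"
      using norm_cauchy_schwarz[of \<nu> "Z (\<phi> t) - Z s"] mult_left_mono[OF lip[of "\<phi> t" s] norm_ge_zero[of \<nu>]]
      by (simp add: \<nu>_def)
    then have *: "\<nu> \<bullet> Z (\<phi> t) - L * (\<nu> \<bullet> \<nu>) \<le> 0"
      using \<open>\<nu> \<bullet> Z s \<le> 0\<close> by (simp add: inner_diff_right dot_square_norm power2_eq_square mult_ac)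
    define V where "V \<tau> = ((\<phi> \<tau> - s) \<bullet> (\<phi> \<tau> - s)) * exp (- 2 * L * \<tau>)" for \<tau>
    have "((\<lambda>\<tau>. \<phi> \<tau> - s) has_vector_derivative Z (\<phi> t)) (at t)"
      using \<phi>[of t] by (auto intro!: derivative_eq_intros)
    from bounded_bilinear.has_vector_derivative[OF bounded_bilinear_inner this this]
    have "((\<lambda>\<tau>. (\<phi> \<tau> - s) \<bullet> (\<phi> \<tau> - s)) has_real_derivative 2 * (\<nu> \<bullet> Z (\<phi> t))) (at t)"
      by (simp add: has_real_derivative_iff_has_vector_derivative inner_commute \<nu>_def)
    then have "(V has_real_derivative 2 * (\<nu> \<bullet> Z (\<phi> t)) * exp (- 2 * L * t)
        + (\<nu> \<bullet> \<nu>) * (exp (- 2 * L * t) * (- 2 * L))) (at t)"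
      unfolding V_def by (auto intro!: derivative_eq_intros simp: \<nu>_def)
    moreover have "2 * (\<nu> \<bullet> Z (\<phi> t)) * exp (- 2 * L * t) + (\<nu> \<bullet> \<nu>) * (exp (- 2 * L * t) * (- 2 * L))
        = 2 * (\<nu> \<bullet> Z (\<phi> t) - L * (\<nu> \<bullet> \<nu>)) * exp (- 2 * L * t)"
      by (simp add: algebra_simps)
    moreover have "2 * (\<nu> \<bullet> Z (\<phi> t) - L * (\<nu> \<bullet> \<nu>)) * exp (- 2 * L * t) \<le> 0"
      by (rule mult_nonpos_nonneg[OF _ exp_ge_zero]) (use * in simp)
    moreover have "V t = h t" using s by (simp add: V_def h_def dist_norm power2_norm_eq_inner)
    moreover have "h \<tau> \<le> V \<tau>" for \<tau>
      using infdist_le[OF s(1), of "\<phi> \<tau>"] power_mono[of "infdist (\<phi> \<tau>) S" "dist (\<phi> \<tau>) s" 2]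
      by (simp add: V_def h_def dist_norm power2_norm_eq_inner infdist_nonneg)
    ultimately show "\<exists>V D. V t = h t \<and> (\<forall>\<tau>. h \<tau> \<le> V \<tau>) \<and> (V has_real_derivative D) (at t) \<and> D \<le> 0"
      by metis
  qed
  also have "h 0 = 0" using \<open>\<phi> 0 \<in> S\<close> by (simp add: h_def)
  finally have "infdist (\<phi> T) S = 0" by (simp add: h_def mult_le_0_iff)
  then show ?thesis using S S0 by (simp add: in_closed_iff_infdist_zero)
qed

section \<open>Invariant sets and second order expansion of flows\<close>

context c1_field
begin

text \<open>Orthogonality, unlike an inequality, is inherited by \<open>- Y\<close>, so the flow
  preserves \<open>S\<close> in both time directions; the commutator of flows uses both.\<close>

lemma flow_invariant:
  assumes "closed S" "\<And>s \<nu>. s \<in> S \<Longrightarrow> proximal_normal S s \<nu> \<Longrightarrow> \<nu> \<bullet> Y s = 0" "q \<in> S"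
  shows "flow Y t q \<in> S"
proof (cases "t \<ge> 0")
  case True
  then show ?thesis
    using nagumo[OF assms(1) lipschitz flow_deriv, of q t] assms by simp
next
  case False
  have "flow Y (- (- t)) q \<in> S"
  proof (rule nagumo[OF assms(1), where \<phi> = "\<lambda>t. flow Y (- t) q" and Z = "\<lambda>x. - Y x" and L = L and T = "- t"])
    show "norm (- Y x - - Y y) \<le> L * norm (x - y)" for x y
      using lipschitz[of y x] by (simp add: norm_minus_commute)
    show "((\<lambda>t. flow Y (- t) q) has_vector_derivative - Y (flow Y (- t) q)) (at t)" for t
      by (rule has_vector_derivative_reflect[OF flow_deriv])
  qed (use False assms in auto)
  then show ?thesis by simp
qed

text \<open>For a C^1 field the velocity \<open>Y (flow Y t p)\<close> is still differentiable in
  \<open>t\<close>; two mean value estimates give the expansion, uniformly in \<open>p\<close> near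
  \<open>s\<close>. The second order coefficient may be frozen at \<open>s\<close>, but
  \<open>Y p\<close> may not be replaced by \<open>Y s\<close>: in the application \<open>p\<close>
  has distance of order \<open>\<tau>\<close> from \<open>s\<close>, which would cost a term of
  order \<open>\<tau>\<^sup>2\<close>.\<close>

lemma flow_taylor:
  assumes "\<eta> > 0"
  shows "\<exists>\<delta>>0. \<forall>\<tau> p. \<bar>\<tau>\<bar> < \<delta> \<and> norm (p - s) < \<delta> \<longrightarrow>
    norm (flow Y \<tau> p - p - \<tau> *\<^sub>R Y p - (\<tau>\<^sup>2 / 2) *\<^sub>R Y' s (Y s)) \<le> \<eta> * \<tau>\<^sup>2"
proof -
  have "continuous_on UNIV (\<lambda>z. Y' z (Y z))"
    by (intro continuous_intros cont_deriv continuous)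
  then have "continuous (at s) (\<lambda>z. Y' z (Y z))" by (simp add: continuous_on_eq_continuous_at)
  then obtain d where "d > 0" and d: "\<And>z. norm (z - s) < d \<Longrightarrow> norm (Y' z (Y z) - Y' s (Y s)) < \<eta>"
    using \<open>\<eta> > 0\<close> unfolding continuous_at_eps_delta dist_norm by blast
  \<comment> \<open>One half of \<open>d\<close> is for the distance from \<open>s\<close> to
    \<open>p\<close>, the other for the displacement by the flow at speed at most \<open>B\<close>;
    \<open>B + 1\<close> avoids division by \<open>0\<close>.\<close>
  define \<delta> where "\<delta> = min (d / 2) (d / (2 * (B + 1)))"
  have "\<delta> > 0" using \<open>d > 0\<close> B_nonneg by (simp add: \<delta>_def)
  have "norm (flow Y \<tau> p - p - \<tau> *\<^sub>R Y p - (\<tau>\<^sup>2 / 2) *\<^sub>R Y' s (Y s)) \<le> \<eta> * \<tau>\<^sup>2"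
    if \<tau>: "\<bar>\<tau>\<bar> < \<delta>" and p: "norm (p - s) < \<delta>" for \<tau> p
  proof -
    define I where "I = {- \<bar>\<tau>\<bar>..\<bar>\<tau>\<bar>}"
    have near: "norm (flow Y t p - s) < d" if "t \<in> I" for t
    proof -
      have "\<bar>t\<bar> \<le> \<bar>\<tau>\<bar>" using that by (auto simp: I_def)
      then have "\<bar>t\<bar> < d / (2 * (B + 1))" using \<tau> by (simp add: \<delta>_def)
      then have "(B + 1) * \<bar>t\<bar> < d / 2" using B_nonneg by (simp add: field_simps)
      then have "B * \<bar>t\<bar> < d / 2" by (simp add: algebra_simps)
      then have "norm (flow Y t p - p) < d / 2" using flow_dist_le[of t p] by simp
      moreover have "norm (p - s) < d / 2" using p by (simp add: \<delta>_def)
      ultimately show ?thesis using norm_triangle_ineq[of "flow Y t p - p" "p - s"] by simp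
    qed
    define c where "c = Y' s (Y s)"
    define \<psi>' where "\<psi>' t = Y (flow Y t p) - Y p - t *\<^sub>R c" for t
    have \<psi>': "norm (\<psi>' t) \<le> \<eta> * \<bar>\<tau>\<bar>" if t: "t \<in> I" for t
    proof -
      have "norm (\<psi>' t - \<psi>' 0) \<le> \<eta> * norm (t - 0)"
      proof (rule differentiable_bound[where S = I and f' = "\<lambda>t u. u *\<^sub>R (Y' (flow Y t p) (Y (flow Y t p)) - c)"])
        fix t assume "t \<in> I"
        have "((\<lambda>t. Y (flow Y t p)) has_vector_derivative Y' (flow Y t p) (Y (flow Y t p))) (at t)"
          using vector_derivative_diff_chain_within[of "\<lambda>t. flow Y t p" "Y (flow Y t p)" t UNIV Y "Y' (flow Y t p)"]
            flow_deriv deriv by (simp add: o_def has_derivative_at_withinI)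
        then have "(\<psi>' has_vector_derivative Y' (flow Y t p) (Y (flow Y t p)) - c) (at t)"
          unfolding \<psi>'_def by (auto intro!: derivative_eq_intros)
        then show "(\<psi>' has_derivative (\<lambda>u. u *\<^sub>R (Y' (flow Y t p) (Y (flow Y t p)) - c))) (at t within I)"
          by (simp add: has_vector_derivative_def has_derivative_at_withinI)
        have "norm (Y' (flow Y t p) (Y (flow Y t p)) - c) \<le> \<eta>"
          using d near[OF \<open>t \<in> I\<close>] by (simp add: c_def less_imp_le)
        then show "onorm (\<lambda>u. u *\<^sub>R (Y' (flow Y t p) (Y (flow Y t p)) - c)) \<le> \<eta>"
          by (intro onorm_le) (simp add: mult.commute[of \<eta>] mult_left_mono)
      qed (use t in \<open>auto simp: I_def\<close>)
      also have "\<dots> \<le> \<eta> * \<bar>\<tau>\<bar>" using t \<open>\<eta> > 0\<close> by (auto simp: I_def)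
      finally show ?thesis by (simp add: \<psi>'_def)
    qed
    define \<psi> where "\<psi> t = flow Y t p - p - t *\<^sub>R Y p - (t\<^sup>2 / 2) *\<^sub>R c" for t
    have "norm (\<psi> \<tau> - \<psi> 0) \<le> \<eta> * \<bar>\<tau>\<bar> * norm (\<tau> - 0)"
    proof (rule differentiable_bound[where S = I and f' = "\<lambda>t u. u *\<^sub>R \<psi>' t"])
      fix t assume "t \<in> I"
      have "((\<lambda>t. (t\<^sup>2 / 2) *\<^sub>R c) has_vector_derivative t *\<^sub>R c) (at t)"
        by (auto intro!: derivative_eq_intros simp: has_real_derivative_iff_has_vector_derivative[symmetric])
      then have "(\<psi> has_vector_derivative \<psi>' t) (at t)"
        unfolding \<psi>_def \<psi>'_def using flow_deriv[of p t] by (auto intro!: derivative_eq_intros)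
      then show "(\<psi> has_derivative (\<lambda>u. u *\<^sub>R \<psi>' t)) (at t within I)"
        by (simp add: has_vector_derivative_def has_derivative_at_withinI)
      show "onorm (\<lambda>u. u *\<^sub>R \<psi>' t) \<le> \<eta> * \<bar>\<tau>\<bar>"
        using mult_left_mono[OF \<psi>'[OF \<open>t \<in> I\<close>] abs_ge_zero] by (intro onorm_le) (simp add: mult_ac)
    qed (auto simp: I_def)
    then show ?thesis by (simp add: \<psi>_def c_def power2_eq_square mult_ac)
  qed
  with \<open>\<delta> > 0\<close> show ?thesis by blast
qed

end

text \<open>A one-sided Peano expansion of second order. Unlike a second derivative, it survives
  composition with flows that are only C^1 in space.\<close>

definition expands2 :: "(real \<Rightarrow> 'a::real_normed_vector) \<Rightarrow> 'a \<Rightarrow> 'a \<Rightarrow> 'a \<Rightarrow> bool" where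
  "expands2 p s a b \<longleftrightarrow>
    (\<forall>\<epsilon>>0. \<forall>\<^sub>F t in at_right 0. norm (p t - s - t *\<^sub>R a - t\<^sup>2 *\<^sub>R b) \<le> \<epsilon> * t\<^sup>2)"

text \<open>Insert \<open>Y (p t) = Y s + t *\<^sub>R Y' s a + o(t)\<close> into
  \<open>flow_taylor\<close> at the point \<open>p t\<close>. The prefactor
  \<open>\<sigma> * t\<close> turns the remainder into \<open>o(t\<^sup>2)\<close>, so one
  derivative of \<open>Y\<close> is enough.\<close>

lemma (in c1_field) expands2_flow:
  assumes p: "expands2 p s a b" and \<sigma>: "\<bar>\<sigma>\<bar> = 1"
  shows "expands2 (\<lambda>t. flow Y (\<sigma> * t) (p t)) s (a + \<sigma> *\<^sub>R Y s)
    (b + \<sigma> *\<^sub>R Y' s a + (1 / 2) *\<^sub>R Y' s (Y s))"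
  unfolding expands2_def
proof (intro allI impI)
  fix \<epsilon> :: real assume "\<epsilon> > 0"
  \<comment> \<open>The total error consists of three shares \<open>\<epsilon> / 3\<close>. In one
    of them the linearisation of \<open>Y\<close> at \<open>s\<close> enters with
    \<open>e * (norm a + 1)\<close> (\<open>A2\<close>) and the remainder of \<open>p\<close> with
    \<open>e\<close> (\<open>A1\<close>), together \<open>e * (norm a + 2)\<close>.\<close>
  define e where "e = \<epsilon> / 3 / (norm a + 2)"
  have "e > 0" using \<open>\<epsilon> > 0\<close> by (simp add: e_def add_nonneg_pos)
  from deriv[of s, unfolded has_derivative_at_alt] \<open>e > 0\<close> obtain d where "d > 0"
    and d: "\<And>y. norm (y - s) < d \<Longrightarrow> norm (Y y - Y s - Y' s (y - s)) \<le> e * norm (y - s)" by blast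
  obtain \<delta> where "\<delta> > 0" and \<delta>: "\<And>\<tau> p. \<bar>\<tau>\<bar> < \<delta> \<Longrightarrow> norm (p - s) < \<delta> \<Longrightarrow>
      norm (flow Y \<tau> p - p - \<tau> *\<^sub>R Y p - (\<tau>\<^sup>2 / 2) *\<^sub>R Y' s (Y s)) \<le> (\<epsilon> / 3) * \<tau>\<^sup>2"
    using flow_taylor[of "\<epsilon> / 3" s] \<open>\<epsilon> > 0\<close> by auto
  have small: "\<forall>\<^sub>F t in at_right (0::real). t < c" if "c > 0" for c
    using eventually_at_right_real[OF that] by (rule eventually_mono) simp
  have "\<forall>\<^sub>F t in at_right 0. norm (p t - s - t *\<^sub>R a - t\<^sup>2 *\<^sub>R b) \<le> \<epsilon> / 3 * t\<^sup>2"
    using p[unfolded expands2_def, rule_format, of "\<epsilon> / 3"] \<open>\<epsilon> > 0\<close> by simp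
  moreover have "\<forall>\<^sub>F t in at_right 0. norm (p t - s - t *\<^sub>R a - t\<^sup>2 *\<^sub>R b) \<le> 1 * t\<^sup>2"
    using p unfolding expands2_def by (meson zero_less_one)
  moreover have "\<forall>\<^sub>F t in at_right (0::real). 0 < t" by (simp add: eventually_at_right_less)
  moreover have "\<forall>\<^sub>F t in at_right (0::real). t < min 1 (1 / (norm b + 1))"
    by (rule small) (simp add: add_nonneg_pos)
  moreover have "\<forall>\<^sub>F t in at_right (0::real). t < e / (L * (norm b + 1))"
    by (rule small) (use \<open>e > 0\<close> L_pos in \<open>simp add: add_nonneg_pos\<close>)
  moreover have "\<forall>\<^sub>F t in at_right (0::real). t < min \<delta> (min d \<delta> / (norm a + 1))"
    by (rule small) (use \<open>d > 0\<close> \<open>\<delta> > 0\<close> in \<open>simp add: add_nonneg_pos\<close>)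
  ultimately show "\<forall>\<^sub>F t in at_right 0. norm (flow Y (\<sigma> * t) (p t) - s - t *\<^sub>R (a + \<sigma> *\<^sub>R Y s)
      - t\<^sup>2 *\<^sub>R (b + \<sigma> *\<^sub>R Y' s a + (1 / 2) *\<^sub>R Y' s (Y s))) \<le> \<epsilon> * t\<^sup>2"
  proof eventually_elim
    case (elim t)
    have na: "norm a + 1 > 0" "norm b + 1 > 0" by (simp_all add: add_nonneg_pos)
    have "t * (L * (norm b + 1)) < e" using elim na L_pos by (subst pos_less_divide_eq[symmetric]) auto
    then have t: "t > 0" "(norm b + 1) * t \<le> 1" "L * (norm b + 1) * t \<le> e" "t < \<delta>" "(norm a + 1) * t < min d \<delta>"
      using elim na by (auto simp: field_simps)
    define c where "c = Y' s (Y s)"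
    have "p t - s - t *\<^sub>R a = (p t - s - t *\<^sub>R a - t\<^sup>2 *\<^sub>R b) + t\<^sup>2 *\<^sub>R b" by simp
    then have "norm (p t - s - t *\<^sub>R a) \<le> norm (p t - s - t *\<^sub>R a - t\<^sup>2 *\<^sub>R b) + norm (t\<^sup>2 *\<^sub>R b)"
      by (metis norm_triangle_ineq)
    then have q: "norm (p t - s - t *\<^sub>R a) \<le> (norm b + 1) * t\<^sup>2"
      using elim(2) by (simp add: algebra_simps)
    also have "\<dots> \<le> 1 * t" using mult_right_mono[OF t(2), of t] t(1) by (simp add: power2_eq_square mult_ac)
    finally have ps: "norm (p t - s) \<le> (norm a + 1) * t"
      using norm_triangle_ineq[of "p t - s - t *\<^sub>R a" "t *\<^sub>R a"] t(1) by (simp add: algebra_simps)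
    then have psd: "norm (p t - s) < d" "norm (p t - s) < \<delta>" using t by auto
    have "norm (Y' s (p t - s - t *\<^sub>R a)) \<le> L * ((norm b + 1) * t\<^sup>2)"
      using norm_deriv_apply_le[of s "p t - s - t *\<^sub>R a"] mult_left_mono[OF q, of L] L_pos by linarith
    also have "\<dots> \<le> e * t" using mult_right_mono[OF t(3), of t] t(1) by (simp add: power2_eq_square mult_ac)
    finally have A1: "norm (Y' s (p t - s - t *\<^sub>R a)) \<le> e * t" .
    have A2: "norm (Y (p t) - Y s - Y' s (p t - s)) \<le> e * ((norm a + 1) * t)"
      using d[OF psd(1)] mult_left_mono[OF ps, of e] \<open>e > 0\<close> by linarith
    have eq: "Y (p t) - Y s - t *\<^sub>R Y' s a = (Y (p t) - Y s - Y' s (p t - s)) + Y' s (p t - s - t *\<^sub>R a)"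
      by (simp add: blinfun.diff_right blinfun.scaleR_right)
    have "norm (Y (p t) - Y s - t *\<^sub>R Y' s a) \<le> e * ((norm a + 1) * t) + e * t"
      unfolding eq by (rule norm_triangle_mono[OF A2 A1])
    also have "\<dots> = e * (norm a + 2) * t" by (simp add: algebra_simps)
    also have "e * (norm a + 2) = \<epsilon> / 3" using na(1) unfolding e_def by (intro nonzero_eq_divide_eq[THEN iffD1]) auto
    finally have A3: "norm ((\<sigma> * t) *\<^sub>R (Y (p t) - Y s - t *\<^sub>R Y' s a)) \<le> \<epsilon> / 3 * t\<^sup>2"
      using \<sigma> t(1) mult_left_mono[of _ "\<epsilon> / 3 * t" t] by (simp add: abs_mult power2_eq_square mult_ac)
    have "(\<sigma> * t)\<^sup>2 = t\<^sup>2" using \<sigma> by (metis abs_1 abs_mult mult_1 power2_abs)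
    then have A4: "norm (flow Y (\<sigma> * t) (p t) - p t - (\<sigma> * t) *\<^sub>R Y (p t) - (t\<^sup>2 / 2) *\<^sub>R c) \<le> \<epsilon> / 3 * t\<^sup>2"
      using \<delta>[of "\<sigma> * t" "p t"] psd t \<sigma> by (simp add: abs_mult c_def)
    have "flow Y (\<sigma> * t) (p t) - s - t *\<^sub>R (a + \<sigma> *\<^sub>R Y s) - t\<^sup>2 *\<^sub>R (b + \<sigma> *\<^sub>R Y' s a + (1 / 2) *\<^sub>R c)
      = (p t - s - t *\<^sub>R a - t\<^sup>2 *\<^sub>R b) + ((\<sigma> * t) *\<^sub>R (Y (p t) - Y s - t *\<^sub>R Y' s a)
        + (flow Y (\<sigma> * t) (p t) - p t - (\<sigma> * t) *\<^sub>R Y (p t) - (t\<^sup>2 / 2) *\<^sub>R c))"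
      by (simp add: algebra_simps power2_eq_square)
    then have "norm (flow Y (\<sigma> * t) (p t) - s - t *\<^sub>R (a + \<sigma> *\<^sub>R Y s) - t\<^sup>2 *\<^sub>R (b + \<sigma> *\<^sub>R Y' s a + (1 / 2) *\<^sub>R c))
        \<le> \<epsilon> / 3 * t\<^sup>2 + (\<epsilon> / 3 * t\<^sup>2 + \<epsilon> / 3 * t\<^sup>2)"
      by (simp only:) (intro norm_triangle_mono elim(1) A3 A4)
    also have "\<dots> = \<epsilon> * t\<^sup>2" by simp
    finally show ?case unfolding c_def .
  qed
qed

text \<open>The commutator curve \<open>p\<close> stays in \<open>S\<close> by
  \<open>flow_invariant\<close>; its first order terms cancel and the coefficient of
  \<open>t\<^sup>2\<close> is the bracket. Only one sign results, since the gauge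
  \<open>t\<^sup>2\<close> is positive; \<open>local_bracket_normal\<close> exchanges the fields to
  get the other.\<close>

lemma bracket_normal:
  assumes "c1_field Z Z' L1 B1" "c1_field W W' L2 B2" and S: "closed S" "s \<in> S" "proximal_normal S s \<nu>"
    and Z: "\<And>x \<mu>. x \<in> S \<Longrightarrow> proximal_normal S x \<mu> \<Longrightarrow> \<mu> \<bullet> Z x = 0"
    and W: "\<And>x \<mu>. x \<in> S \<Longrightarrow> proximal_normal S x \<mu> \<Longrightarrow> \<mu> \<bullet> W x = 0"
  shows "\<nu> \<bullet> (W' s (Z s) - Z' s (W s)) \<le> 0"
proof -
  interpret Z: c1_field Z Z' L1 B1 by fact
  interpret W: c1_field W W' L2 B2 by fact
  define p where "p t = flow W (- 1 * t) (flow Z (- 1 * t) (flow W (1 * t) (flow Z (1 * t) s)))" for t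
  define k where "k = W' s (Z s) - Z' s (W s)"
  have "expands2 (\<lambda>t. s) s 0 0" by (simp add: expands2_def)
  note e1 = Z.expands2_flow[OF this, of 1, simplified]
  note e2 = W.expands2_flow[OF e1, of 1, simplified]
  note e3 = Z.expands2_flow[OF e2, of "- 1", simplified]
  note e4 = W.expands2_flow[OF e3, of "- 1", simplified]
  have "expands2 p s 0 k"
  proof -
    have half: "(1 / 2) *\<^sub>R v + (1 / 2) *\<^sub>R v = v" for v :: 'a
      by (simp flip: scaleR_add_left)
    then have half': "(1 / 2) *\<^sub>R v + ((1 / 2) *\<^sub>R v + w) = v + w" for v w :: 'a
      by (metis add.assoc)
    show ?thesis
      using e4 unfolding p_def k_def
      by (simp add: blinfun.bilinear_simps algebra_simps half half')
  qed
  have "((\<lambda>t. (1 / t\<^sup>2) *\<^sub>R (p t - s)) \<longlongrightarrow> k) (at_right 0)"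
  proof (rule tendstoI)
    fix \<epsilon> :: real assume "\<epsilon> > 0"
    have "\<forall>\<^sub>F t in at_right 0. norm (p t - s - t *\<^sub>R 0 - t\<^sup>2 *\<^sub>R k) \<le> \<epsilon> / 2 * t\<^sup>2"
      using \<open>expands2 p s 0 k\<close> \<open>\<epsilon> > 0\<close> unfolding expands2_def by (meson half_gt_zero)
    then show "\<forall>\<^sub>F t in at_right 0. dist ((1 / t\<^sup>2) *\<^sub>R (p t - s)) k < \<epsilon>"
      using eventually_at_right_less[of 0]
    proof eventually_elim
      case (elim t)
      have "(1 / t\<^sup>2) *\<^sub>R (p t - s) - k = (1 / t\<^sup>2) *\<^sub>R (p t - s - t\<^sup>2 *\<^sub>R k)"
        using elim by (simp add: scaleR_diff_right)
      then have "dist ((1 / t\<^sup>2) *\<^sub>R (p t - s)) k = norm (p t - s - t\<^sup>2 *\<^sub>R k) / t\<^sup>2"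
        by (simp add: dist_norm)
      also have "\<dots> \<le> \<epsilon> / 2" using elim by (simp add: divide_simps)
      finally show ?case using \<open>\<epsilon> > 0\<close> by simp
    qed
  qed
  moreover have "p t \<in> S" for t
    unfolding p_def by (intro Z.flow_invariant W.flow_invariant S Z W)
  moreover have "((\<lambda>t::real. t\<^sup>2) \<longlongrightarrow> 0) (at_right 0)" by (auto intro!: tendsto_eq_intros)
  moreover have "\<forall>\<^sub>F t::real in at_right 0. 0 < t\<^sup>2"
    using eventually_at_right_less[of "0::real"] by eventually_elim simp
  ultimately show ?thesis
    using proximal_normal_contingent[OF S(3), of "at_right 0" p "\<lambda>t. t\<^sup>2" k] by (simp add: k_def)
qed

section \<open>Cutting off vector fields\<close>

lemma DERIV_max_0_square: "((\<lambda>u::real. (max 0 u)\<^sup>2) has_real_derivative 2 * max 0 u) (at u)"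
proof -
  consider "u < 0" | "u = 0" | "u > 0" by linarith
  then show ?thesis
  proof cases
    case 1
    have "((\<lambda>u::real. 0) has_real_derivative 2 * max 0 u) (at u)" using 1 by simp
    then show ?thesis
      by (rule has_field_derivative_transform_within_open[of _ _ _ "{..<0}"]) (use 1 in auto)
  next
    case 2
    have "((\<lambda>h::real. (max 0 (0 + h))\<^sup>2 / h) \<longlongrightarrow> 0) (at 0)"
      by (rule Lim_null_comparison[where g = "\<lambda>h. \<bar>h\<bar>"])
        (auto simp: max_def power2_eq_square intro!: always_eventually tendsto_eq_intros)
    then show ?thesis using 2 by (simp add: DERIV_def)
  next
    case 3
    have "((\<lambda>u::real. u\<^sup>2) has_real_derivative 2 * max 0 u) (at u)"
      using 3 by (auto intro!: derivative_eq_intros)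
    then show ?thesis
      by (rule has_field_derivative_transform_within_open[of _ _ _ "{0<..}"]) (use 3 in auto)
  qed
qed

text \<open>The quotient \<open>m (b - u) / (m (b - u) + m (u - a))\<close>. The cut-off only has to
  be C^1, so the squared positive part serves as \<open>m\<close> in place of a smooth flat
  function.\<close>

lemma bump_exists:
  fixes a b :: real
  assumes "a < b"
  obtains \<beta> \<beta>' :: "real \<Rightarrow> real" where "\<And>u. (\<beta> has_real_derivative \<beta>' u) (at u)" "continuous_on UNIV \<beta>'"
    "\<And>u. u \<le> a \<Longrightarrow> \<beta> u = 1" "\<And>u. u \<ge> b \<Longrightarrow> \<beta> u = 0" "\<And>u. u \<ge> b \<Longrightarrow> \<beta>' u = 0"
proof -
  define m where "m u = (max 0 u)\<^sup>2" for u :: real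
  define m' where "m' u = 2 * max 0 u" for u :: real
  have m: "(m has_real_derivative m' u) (at u)" for u
    unfolding m_def m'_def by (rule DERIV_max_0_square)
  have mc [continuous_intros]: "continuous_on S (\<lambda>u. m (f u))" "continuous_on S (\<lambda>u. m' (f u))"
    if "continuous_on S f" for f and S :: "real set"
    using that unfolding m_def m'_def by (auto intro!: continuous_intros)
  define D where "D u = m (b - u) + m (u - a)" for u
  have D: "D u > 0" for u
  proof -
    have "b - u > 0 \<or> u - a > 0" using \<open>a < b\<close> by linarith
    then show ?thesis by (auto simp: D_def m_def add_pos_nonneg add_nonneg_pos)
  qed
  have m1: "((\<lambda>u. m (b - u)) has_real_derivative - m' (b - u)) (at u)" for u
    by (rule DERIV_chain2[OF m, of "\<lambda>u. b - u" "-1" u UNIV, simplified]) (auto intro!: derivative_eq_intros)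
  have m2: "((\<lambda>u. m (u - a)) has_real_derivative m' (u - a)) (at u)" for u
    by (rule DERIV_chain2[OF m, of "\<lambda>u. u - a" 1 u UNIV, simplified]) (auto intro!: derivative_eq_intros)
  have Dd: "(D has_real_derivative - m' (b - u) + m' (u - a)) (at u)" for u
    unfolding D_def by (rule DERIV_add[OF m1 m2])
  define \<beta> where "\<beta> u = m (b - u) / D u" for u
  define \<beta>' where "\<beta>' u = (- m' (b - u) * D u - m (b - u) * (- m' (b - u) + m' (u - a))) / (D u * D u)" for u
  show ?thesis
  proof (rule that)
    show "(\<beta> has_real_derivative \<beta>' u) (at u)" for u
      unfolding \<beta>_def \<beta>'_def
      using DERIV_divide[OF m1 Dd] D[of u] by simp
    show "continuous_on UNIV \<beta>'"
      unfolding \<beta>'_def using D by (auto simp: D_def less_imp_neq[symmetric] intro!: continuous_intros)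
    show "\<beta> u = 1" if "u \<le> a" for u
    proof -
      have "D u = m (b - u)" using that by (simp add: D_def m_def)
      then show ?thesis using D[of u] by (simp add: \<beta>_def)
    qed
  qed (simp_all add: \<beta>_def \<beta>'_def m_def m'_def)
qed

text \<open>The product of \<open>f\<close> with a bump function. Being a multiple of
  \<open>f\<close> on \<open>\<Omega>\<close> and \<open>0\<close> elsewhere keeps \<open>Y\<close>
  orthogonal to the same normals, and \<open>Y' x0 = f' x0\<close> preserves brackets at the
  centre.\<close>

lemma cutoff_exists:
  fixes f :: "'a::euclidean_space \<Rightarrow> 'a" and f' :: "'a \<Rightarrow> 'a \<Rightarrow>\<^sub>L 'a"
  assumes "open \<Omega>" "cball x0 R \<subseteq> \<Omega>" "0 < r" "r < R"
    and f: "\<And>x. x \<in> \<Omega> \<Longrightarrow> (f has_derivative blinfun_apply (f' x)) (at x)" and f': "continuous_on \<Omega> f'"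
  obtains Y Y' L B where "c1_field Y Y' L B" "\<And>x. x \<in> cball x0 r \<Longrightarrow> Y x = f x" "Y' x0 = f' x0"
    "\<And>x. x \<in> \<Omega> \<Longrightarrow> \<exists>c. Y x = c *\<^sub>R f x" "\<And>x. x \<notin> \<Omega> \<Longrightarrow> Y x = 0"
proof -
  obtain \<beta> \<beta>' :: "real \<Rightarrow> real" where \<beta>: "\<And>u. (\<beta> has_real_derivative \<beta>' u) (at u)"
    and \<beta>': "continuous_on UNIV \<beta>'"
    and \<beta>1: "\<And>u. u \<le> r\<^sup>2 \<Longrightarrow> \<beta> u = 1" and \<beta>0: "\<And>u. u \<ge> R\<^sup>2 \<Longrightarrow> \<beta> u = 0" "\<And>u. u \<ge> R\<^sup>2 \<Longrightarrow> \<beta>' u = 0"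
    using bump_exists[of "r\<^sup>2" "R\<^sup>2"] assms(3,4) by (auto simp: power_strict_mono)
  \<comment> \<open>The squared distance is differentiable at \<open>x0\<close> as well, so the bump
    is composed with it rather than with the norm.\<close>
  define N where "N x = (x - x0) \<bullet> (x - x0)" for x
  have N_ge: "N x \<ge> R\<^sup>2" if "x \<notin> ball x0 R" for x
    using that assms(3,4) by (auto simp: N_def dist_norm norm_minus_commute power2_norm_eq_inner[symmetric] intro!: power_mono)
  have N_le: "N x \<le> r\<^sup>2" if "x \<in> cball x0 r" for x
    using that assms(3) by (auto simp: N_def dist_norm norm_minus_commute power2_norm_eq_inner[symmetric] intro!: power_mono)
  have N_cont: "continuous_on S N" for S unfolding N_def by (intro continuous_intros)
  have \<beta>N_cont: "continuous_on S (\<lambda>x. \<beta> (N x))" "continuous_on S (\<lambda>x. \<beta>' (N x))" for S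
    by (rule continuous_on_compose2[OF _ N_cont, of UNIV]; (rule \<beta>' DERIV_continuous_on[OF \<beta>] | simp))+
  define D where "D x v = (\<beta>' (N x) * (2 * ((x - x0) \<bullet> v))) *\<^sub>R f x + \<beta> (N x) *\<^sub>R f' x v" for x v
  have D_lin: "bounded_linear (D x)" for x
    unfolding D_def by (intro bounded_linear_intros)
  define Y where "Y x = (if x \<in> \<Omega> then \<beta> (N x) *\<^sub>R f x else 0)" for x
  define Y' where "Y' x = (if x \<in> \<Omega> then Blinfun (D x) else 0)" for x
  have Y'_out: "Y' x = 0" "Y x = 0" if "x \<notin> ball x0 R" for x
    using \<beta>0[OF N_ge[OF that]] by (simp_all add: Y'_def Y_def D_def[abs_def] zero_blinfun_def)
  \<comment> \<open>On \<open>\<Omega>\<close> the product formula holds, off the closed ball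
    everything vanishes; these two open sets cover the space, and continuity of \<open>Y'\<close> is
    checked on each.\<close>
  have cover: "\<Omega> \<union> (- cball x0 R) = UNIV" using assms(2) by auto
  have f_cont: "continuous_on \<Omega> f"
    using f by (meson has_derivative_continuous continuous_at_imp_continuous_on)
  have deriv: "(Y has_derivative blinfun_apply (Y' x)) (at x)" for x
  proof (cases "x \<in> \<Omega>")
    case True
    have "(N has_derivative (\<lambda>v. 2 * ((x - x0) \<bullet> v))) (at x)"
      unfolding N_def by (auto intro!: derivative_eq_intros simp: inner_commute)
    from DERIV_compose_FDERIV[OF \<beta> this]
    have "((\<lambda>x. \<beta> (N x)) has_derivative (\<lambda>v. \<beta>' (N x) * (2 * ((x - x0) \<bullet> v)))) (at x)"
      by (simp add: mult_ac)
    from has_derivative_scaleR[OF this f[OF True]]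
    have "((\<lambda>x. \<beta> (N x) *\<^sub>R f x) has_derivative D x) (at x)"
      by (simp add: D_def[abs_def] add.commute)
    then have "(Y has_derivative D x) (at x)"
      by (rule has_derivative_transform_within_open[OF _ \<open>open \<Omega>\<close> True]) (simp add: Y_def)
    then show ?thesis using True by (simp add: Y'_def bounded_linear_Blinfun_apply[OF D_lin])
  next
    case False
    then have x: "x \<in> - cball x0 R" using assms(2) by auto
    have "((\<lambda>x. 0) has_derivative (\<lambda>v. 0)) (at x)" by simp
    then have "(Y has_derivative (\<lambda>v. 0)) (at x)"
      by (rule has_derivative_transform_within_open[OF _ _ x]) (use Y'_out in auto)
    then show ?thesis using False by (simp add: Y'_def zero_blinfun.rep_eq)
  qed
  have cont: "continuous_on UNIV Y'"
  proof -
    have "continuous_on \<Omega> (\<lambda>x. Blinfun (D x))"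
    proof (rule continuous_on_blinfun_componentwise)
      fix v :: 'a
      have "continuous_on \<Omega> (\<lambda>x. D x v)"
        unfolding D_def by (intro continuous_intros \<beta>N_cont f_cont f')
      then show "continuous_on \<Omega> (\<lambda>x. Blinfun (D x) v)" by (simp add: bounded_linear_Blinfun_apply[OF D_lin])
    qed
    then have "continuous_on \<Omega> Y'" by (subst continuous_on_cong[OF refl]) (auto simp: Y'_def)
    moreover have "continuous_on (- cball x0 R) Y'"
      by (subst continuous_on_cong[OF refl, of _ _ "\<lambda>x. 0"]) (use Y'_out in auto)
    ultimately show ?thesis
      using continuous_on_open_Un[of \<Omega> "- cball x0 R" Y'] \<open>open \<Omega>\<close> cover by (simp add: open_Compl)
  qed
  have Y_cont: "continuous_on UNIV Y"
    using deriv by (meson has_derivative_continuous continuous_at_imp_continuous_on)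
  have bdd: "\<exists>K>0. \<forall>x. norm (g x) \<le> K"
    if g: "continuous_on UNIV g" "\<And>x. x \<notin> ball x0 R \<Longrightarrow> g x = 0" for g :: "'a \<Rightarrow> 'b::real_normed_vector"
  proof -
    have "bounded (g ` cball x0 R)"
      by (intro compact_imp_bounded compact_continuous_image continuous_on_subset[OF g(1)]) auto
    then obtain K where "K > 0" "\<And>x. x \<in> cball x0 R \<Longrightarrow> norm (g x) \<le> K"
      unfolding bounded_pos by auto
    then have "norm (g x) \<le> K" for x
      using g(2)[of x] by (cases "x \<in> ball x0 R") auto
    with \<open>K > 0\<close> show ?thesis by blast
  qed
  obtain L where "L > 0" "\<And>x. norm (Y' x) \<le> L" using bdd[OF cont Y'_out(1)] by blast
  moreover obtain B where "\<And>x. norm (Y x) \<le> B" using bdd[OF Y_cont Y'_out(2)] by blast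
  ultimately have "c1_field Y Y' L B"
    using deriv cont by unfold_locales auto
  moreover have Yf: "Y x = f x" if "x \<in> cball x0 r" for x
  proof -
    have "x \<in> \<Omega>" using that assms(2,4) by auto
    then show ?thesis using \<beta>1[OF N_le[OF that]] by (simp add: Y_def)
  qed
  moreover have "Y' x0 = f' x0"
  proof -
    have "x0 \<in> \<Omega>" using assms by auto
    have "(Y has_derivative blinfun_apply (f' x0)) (at x0)"
      by (rule has_derivative_transform_within_open[OF f[OF \<open>x0 \<in> \<Omega>\<close>], of "ball x0 r"])
        (use \<open>0 < r\<close> Yf in auto)
    from has_derivative_unique[OF deriv this] show ?thesis by (simp add: blinfun_apply_inject)
  qed
  moreover have "\<exists>c. Y x = c *\<^sub>R f x" if "x \<in> \<Omega>" for x using that by (auto simp: Y_def)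
  moreover have "Y x = 0" if "x \<notin> \<Omega>" for x using that by (simp add: Y_def)
  ultimately show ?thesis by (rule that)
qed

text \<open>Cutting off around \<open>s\<close> changes neither the values nor the derivatives at
  \<open>s\<close>, so the bracket there is that of globally defined fields; exchanging the fields
  gives both inequalities.\<close>

lemma local_bracket_normal:
  fixes f g :: "'a::euclidean_space \<Rightarrow> 'a"
  assumes S: "closed S" "s \<in> S" "proximal_normal S s \<nu>" and \<Omega>: "open \<Omega>" "s \<in> \<Omega>"
    and f: "\<And>x. x \<in> \<Omega> \<Longrightarrow> (f has_derivative blinfun_apply (f' x)) (at x)" "continuous_on \<Omega> f'"
    and g: "\<And>x. x \<in> \<Omega> \<Longrightarrow> (g has_derivative blinfun_apply (g' x)) (at x)" "continuous_on \<Omega> g'"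
    and fn: "\<And>x \<mu>. x \<in> S \<inter> \<Omega> \<Longrightarrow> proximal_normal S x \<mu> \<Longrightarrow> \<mu> \<bullet> f x = 0"
    and gn: "\<And>x \<mu>. x \<in> S \<inter> \<Omega> \<Longrightarrow> proximal_normal S x \<mu> \<Longrightarrow> \<mu> \<bullet> g x = 0"
  shows "\<nu> \<bullet> (g' s (f s) - f' s (g s)) = 0"
proof -
  obtain R where "R > 0" "cball s R \<subseteq> \<Omega>" using \<Omega> open_contains_cball by blast
  then have R: "cball s R \<subseteq> \<Omega>" "0 < R / 2" "R / 2 < R" by auto
  obtain Z Z' L1 B1 where Z: "c1_field Z Z' L1 B1" "\<And>x. x \<in> cball s (R / 2) \<Longrightarrow> Z x = f x" "Z' s = f' s"
    "\<And>x. x \<in> \<Omega> \<Longrightarrow> \<exists>c. Z x = c *\<^sub>R f x" "\<And>x. x \<notin> \<Omega> \<Longrightarrow> Z x = 0"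
    using cutoff_exists[OF \<Omega>(1) R f] by blast
  obtain W W' L2 B2 where W: "c1_field W W' L2 B2" "\<And>x. x \<in> cball s (R / 2) \<Longrightarrow> W x = g x" "W' s = g' s"
    "\<And>x. x \<in> \<Omega> \<Longrightarrow> \<exists>c. W x = c *\<^sub>R g x" "\<And>x. x \<notin> \<Omega> \<Longrightarrow> W x = 0"
    using cutoff_exists[OF \<Omega>(1) R g] by blast
  have Zn: "\<mu> \<bullet> Z x = 0" if "x \<in> S" "proximal_normal S x \<mu>" for x \<mu>
    using that Z(4,5)[of x] fn[of x \<mu>] by (cases "x \<in> \<Omega>") auto
  have Wn: "\<mu> \<bullet> W x = 0" if "x \<in> S" "proximal_normal S x \<mu>" for x \<mu>
    using that W(4,5)[of x] gn[of x \<mu>] by (cases "x \<in> \<Omega>") auto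
  have "Z s = f s" "W s = g s" using Z(2)[of s] W(2)[of s] R(2) by auto
  then show ?thesis
    using bracket_normal[OF Z(1) W(1) S Zn Wn] bracket_normal[OF W(1) Z(1) S Wn Zn] Z(3) W(3)
    by (simp add: inner_diff_right)
qed

section \<open>Orbits of systems of vector fields\<close>

locale c1_system =
  fixes Y :: "nat \<Rightarrow> 'a::euclidean_space \<Rightarrow> 'a" and Y' :: "nat \<Rightarrow> 'a \<Rightarrow> 'a \<Rightarrow>\<^sub>L 'a"
    and L B :: "nat \<Rightarrow> real" and m :: nat and \<Omega> :: "'a set"
  assumes fields: "\<And>k. k \<in> {1..m} \<Longrightarrow> c1_field (Y k) (Y' k) (L k) (B k)"
    and open_dom: "open \<Omega>"
begin

text \<open>Demanding that the whole flow line lies in \<open>\<Omega>\<close> keeps it where the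
  cut-off fields agree with the original ones, so that a step is a segment of an original integral
  line.\<close>

definition step :: "'a \<Rightarrow> 'a \<Rightarrow> bool" where
  "step x y \<longleftrightarrow> (\<exists>k\<in>{1..m}. \<exists>t. y = flow (Y k) t x \<and> (\<forall>s\<in>closed_segment 0 t. flow (Y k) s x \<in> \<Omega>))"

lemma step_sym: "step x y \<Longrightarrow> step y x"
proof -
  assume "step x y"
  then obtain k t where k: "k \<in> {1..m}" and y: "y = flow (Y k) t x"
    and in_dom: "\<And>s. s \<in> closed_segment 0 t \<Longrightarrow> flow (Y k) s x \<in> \<Omega>" unfolding step_def by blast
  interpret c1_field "Y k" "Y' k" "L k" "B k" using fields k by blast
  have "flow (Y k) s y \<in> \<Omega>" if "s \<in> closed_segment 0 (- t)" for s
    using in_dom[of "s + t"] that by (auto simp: y flow_flow closed_segment_eq_real_ivl split: if_splits)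
  moreover have "x = flow (Y k) (- t) y" by (simp add: y)
  ultimately show "step y x" using k unfolding step_def by blast
qed

lemma relpowp_step_sym: "(step ^^ n) x y \<Longrightarrow> (step ^^ n) y x"
proof (induction n arbitrary: y)
  case (Suc n)
  then obtain z where "(step ^^ n) x z" "step z y" by (auto elim: relpowp_Suc_E)
  then show ?case using Suc.IH step_sym by (blast intro: relpowp_Suc_I2)
qed simp

text \<open>The starting points are found by running the same field backwards from \<open>y'\<close>
  for the same time. That these flow lines stay in \<open>\<Omega>\<close> for all \<open>y'\<close>
  near \<open>y\<close> is the tube lemma: the bad points \<open>P\<close> are the projection of a
  closed set along a compact segment.\<close>

lemma step_open:
  assumes "step x y" "open Q" "x \<in> Q"
  shows "\<exists>Q'. open Q' \<and> y \<in> Q' \<and> (\<forall>y'\<in>Q'. \<exists>x'\<in>Q. step x' y')"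
proof -
  from step_sym[OF assms(1)] obtain k t where k: "k \<in> {1..m}" and x: "x = flow (Y k) t y"
    and in_dom: "\<And>s. s \<in> closed_segment 0 t \<Longrightarrow> flow (Y k) s y \<in> \<Omega>" unfolding step_def by blast
  interpret c1_field "Y k" "Y' k" "L k" "B k" using fields k by blast
  define T where "T = {p. flow (Y k) (fst p) (snd p) \<notin> \<Omega>}"
  have "closed T"
  proof -
    have "closed ((\<lambda>p. flow (Y k) (fst p) (snd p)) -` (- \<Omega>))"
      by (rule continuous_closed_vimage)
        (use open_dom flow_cont in \<open>auto simp: closed_Compl case_prod_beta continuous_on_eq_continuous_at\<close>)
    then show ?thesis by (simp add: T_def vimage_def)
  qed
  define P where "P = {z. \<exists>s. s \<in> closed_segment 0 t \<and> (s, z) \<in> T}"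
  have "closed P" unfolding P_def by (rule closed_compact_projection[OF compact_segment \<open>closed T\<close>])
  have "open (flow (Y k) t -` Q)"
    by (rule open_vimage[OF \<open>open Q\<close>]) (intro continuous_intros)
  define Q' where "Q' = flow (Y k) t -` Q \<inter> - P"
  have "open Q'" unfolding Q'_def using \<open>open (flow (Y k) t -` Q)\<close> \<open>closed P\<close> by auto
  moreover have "y \<in> Q'" using in_dom assms(3) x by (auto simp: Q'_def P_def T_def)
  moreover have "\<exists>x'\<in>Q. step x' y'" if "y' \<in> Q'" for y'
  proof
    show "flow (Y k) t y' \<in> Q" using that by (simp add: Q'_def)
    have "step y' (flow (Y k) t y')"
      unfolding step_def using k that by (auto simp: Q'_def P_def T_def intro!: bexI[of _ k] exI[of _ t])
    then show "step (flow (Y k) t y') y'" by (rule step_sym)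
  qed
  ultimately show ?thesis by blast
qed

lemma relpowp_step_open:
  "(step ^^ n) x y \<Longrightarrow> open Q \<Longrightarrow> x \<in> Q \<Longrightarrow>
    \<exists>Q'. open Q' \<and> y \<in> Q' \<and> (\<forall>y'\<in>Q'. \<exists>x'\<in>Q. (step ^^ n) x' y')"
proof (induction n arbitrary: y)
  case 0
  then show ?case by (intro exI[of _ Q]) auto
next
  case (Suc n)
  then obtain z where z: "(step ^^ n) x z" "step z y" by (auto elim: relpowp_Suc_E)
  from Suc.IH[OF z(1) Suc.prems(2,3)] obtain P where
    P: "open P" "z \<in> P" "\<And>z'. z' \<in> P \<Longrightarrow> \<exists>x'\<in>Q. (step ^^ n) x' z'" by blast
  from step_open[OF z(2) P(1,2)] obtain Q' where
    Q': "open Q'" "y \<in> Q'" "\<And>y'. y' \<in> Q' \<Longrightarrow> \<exists>z'\<in>P. step z' y'" by blast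
  have "\<exists>x'\<in>Q. (step ^^ Suc n) x' y'" if "y' \<in> Q'" for y'
    using Q'(3)[OF that] P(3) relpowp_Suc_I by metis
  then show ?case using Q'(1,2) by blast
qed

text \<open>An immersed piece of the orbit of \<open>x0\<close>, parametrised by the coordinate subspace \<open>span I\<close>; keeping the
  whole space as the domain of \<open>F\<close> lets the dimension of the parameter space vary.\<close>

definition orbit_chart :: "'a \<Rightarrow> 'a set \<Rightarrow> ('a \<Rightarrow> 'a) \<Rightarrow> ('a \<Rightarrow> 'a \<Rightarrow>\<^sub>L 'a) \<Rightarrow> 'a \<Rightarrow> real \<Rightarrow> nat \<Rightarrow> bool" where
  "orbit_chart x0 I F F' w \<rho> n \<longleftrightarrow> I \<subseteq> Basis \<and> \<rho> > 0 \<and> w \<in> span I \<and>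
    (\<forall>x\<in>ball w \<rho>. (F has_derivative blinfun_apply (F' x)) (at x)) \<and> continuous_on (ball w \<rho>) F' \<and>
    (\<forall>x\<in>ball w \<rho>. \<forall>b\<in>Basis - I. F' x b = 0) \<and>
    (\<forall>x\<in>ball w \<rho>. (step ^^ n) x0 (F x) \<and> F x \<in> \<Omega>) \<and>
    (\<forall>v\<in>span I. F' w v = 0 \<longrightarrow> v = 0)"

text \<open>The new coordinate \<open>y \<bullet> b\<close> becomes the flow time of
  \<open>Y k\<close>. As \<open>x \<bullet> b = 0\<close>, the derivative of \<open>G\<close> at
  \<open>x\<close> is that of \<open>F\<close> plus \<open>Y k (F x)\<close> in the direction
  \<open>b\<close>, and \<open>notin\<close> makes it injective. The new chart is centred at
  \<open>x\<close>, the point where injectivity is known.\<close>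

lemma orbit_chart_extend:
  assumes F: "orbit_chart x0 I F F' w \<rho> n" and x: "x \<in> ball w \<rho>" "x \<in> span I"
    and inj: "\<And>v. v \<in> span I \<Longrightarrow> F' x v = 0 \<Longrightarrow> v = 0"
    and k: "k \<in> {1..m}" and notin: "Y k (F x) \<notin> F' x ` span I"
  shows "\<exists>b G G' \<rho>'. b \<notin> I \<and> orbit_chart x0 (insert b I) G G' x \<rho>' (Suc n)"
proof -
  interpret c1_field "Y k" "Y' k" "L k" "B k" using fields k by blast
  note F_simps = F[unfolded orbit_chart_def]
  have I: "I \<subseteq> Basis" and F_deriv: "\<And>y. y \<in> ball w \<rho> \<Longrightarrow> (F has_derivative blinfun_apply (F' y)) (at y)"
    and F'_cont: "continuous_on (ball w \<rho>) F'"
    and F'_0: "\<And>y b. y \<in> ball w \<rho> \<Longrightarrow> b \<in> Basis - I \<Longrightarrow> F' y b = 0"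
    and F_step: "\<And>y. y \<in> ball w \<rho> \<Longrightarrow> (step ^^ n) x0 (F y)" "\<And>y. y \<in> ball w \<rho> \<Longrightarrow> F y \<in> \<Omega>"
    using F_simps by auto
  have lin: "linear (blinfun_apply (F' x))"
    by (rule bounded_linear.linear[OF blinfun.bounded_linear_right])
  \<comment> \<open>A free basis vector exists, for otherwise the injective \<open>F' x\<close>
    would be onto and no vector could be transverse.\<close>
  have "span I \<noteq> UNIV"
  proof
    assume "span I = UNIV"
    then have "inj (blinfun_apply (F' x))"
      using inj by (auto simp: linear_injective_0[OF lin])
    then have "surj (blinfun_apply (F' x))"
      by (intro eucl.linear_inj_imp_surj lin)
    then show False using notin \<open>span I = UNIV\<close> by (metis UNIV_I)
  qed
  then have "\<not> Basis \<subseteq> I" using span_mono[of Basis I] by (auto simp: span_Basis)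
  then obtain b where b: "b \<in> Basis" "b \<notin> I" by blast
  have "a \<bullet> b = 0" if "a \<in> I" for a
    using that I b by (intro inner_not_same_Basis) auto
  note Ib = this
  have orth: "u \<bullet> b = 0" if "u \<in> span I" for u
    using that by (induction rule: span_induct_alt) (auto simp: inner_add_left Ib)
  have F_cont: "continuous_on (ball w \<rho>) F"
    using F_deriv by (meson has_derivative_continuous continuous_at_imp_continuous_on)
  define G where "G y = flow (Y k) (y \<bullet> b) (F y)" for y
  define D where "D y v = (v \<bullet> b) *\<^sub>R Y k (G y) + dflow (Y k) (Y' k) (y \<bullet> b) (F y) (F' y v)" for y v
  have D_lin: "bounded_linear (D y)" for y
    unfolding D_def by (intro bounded_linear_intros)
  define G' where "G' y = Blinfun (D y)" for y
  have G'_apply: "blinfun_apply (G' y) = D y" for y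
    by (simp add: G'_def bounded_linear_Blinfun_apply[OF D_lin])
  have G_deriv: "(G has_derivative blinfun_apply (G' y)) (at y)" if "y \<in> ball w \<rho>" for y
    unfolding G'_apply D_def G_def
    by (rule flow_compose_has_derivative[OF _ F_deriv[OF that]]) (auto intro!: derivative_eq_intros)
  have G_cont: "continuous_on (ball w \<rho>) G"
    unfolding G_def by (intro continuous_intros F_cont)
  have G'_cont: "continuous_on (ball w \<rho>) G'"
  proof (rule continuous_on_blinfun_componentwise)
    fix v :: 'a
    have "continuous_on (ball w \<rho>) (\<lambda>y. dflow (Y k) (Y' k) (y \<bullet> b) (F y))"
    proof -
      have "continuous_on (ball w \<rho>) (\<lambda>y. (y \<bullet> b, F y))" by (intro continuous_intros F_cont)
      from continuous_on_compose2[OF dflow_cont this] show ?thesis by simp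
    qed
    then show "continuous_on (ball w \<rho>) (\<lambda>y. G' y v)"
      unfolding G'_apply D_def
      by (intro continuous_intros continuous_on_compose2[OF continuous G_cont] F'_cont) auto
  qed
  obtain \<epsilon> where "\<epsilon> > 0" and \<epsilon>: "ball (F x) \<epsilon> \<subseteq> \<Omega>"
    using open_dom F_step(2)[OF x(1)] open_contains_ball by blast
  obtain d where "d > 0" and d: "ball x d \<subseteq> ball w \<rho>"
    using x(1) open_ball open_contains_ball by blast
  have "continuous (at x) F" using has_derivative_continuous[OF F_deriv[OF x(1)]] .
  then obtain d' where "d' > 0" and d': "\<And>y. dist y x < d' \<Longrightarrow> dist (F y) (F x) < \<epsilon> / 2"
    using \<open>\<epsilon> > 0\<close> unfolding continuous_at_eps_delta by (meson half_gt_zero)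
  \<comment> \<open>On this ball \<open>F\<close> moves by less than \<open>\<epsilon> / 2\<close>,
    and the flow time, at most \<open>norm (y - x)\<close> in size, is short enough for the flow to
    move by less than \<open>\<epsilon> / 2\<close>; the new step thus stays in
    \<open>\<Omega>\<close>.\<close>
  define \<rho>' where "\<rho>' = min (min d d') (\<epsilon> / (2 * (B k + 1)))"
  have "\<rho>' > 0" using \<open>d > 0\<close> \<open>d' > 0\<close> \<open>\<epsilon> > 0\<close> B_nonneg by (simp add: \<rho>'_def)
  have sub: "ball x \<rho>' \<subseteq> ball w \<rho>" using d by (auto simp: \<rho>'_def)
  have seg: "flow (Y k) s (F y) \<in> \<Omega>" if y: "y \<in> ball x \<rho>'" and s: "s \<in> closed_segment 0 (y \<bullet> b)" for y s
  proof -
    have "\<bar>s\<bar> \<le> \<bar>y \<bullet> b\<bar>" using s by (auto simp: closed_segment_eq_real_ivl split: if_splits)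
    also have "y \<bullet> b = (y - x) \<bullet> b" using orth[OF x(2)] by (simp add: inner_diff_left)
    also have "\<bar>\<dots>\<bar> \<le> norm (y - x)" using b by (simp add: Basis_le_norm)
    also have "\<dots> < \<epsilon> / (2 * (B k + 1))" using y by (simp add: \<rho>'_def dist_norm norm_minus_commute)
    finally have "(B k + 1) * \<bar>s\<bar> < \<epsilon> / 2" using B_nonneg by (simp add: field_simps)
    then have "B k * \<bar>s\<bar> < \<epsilon> / 2" by (simp add: algebra_simps)
    then have "norm (flow (Y k) s (F y) - F y) < \<epsilon> / 2" using flow_dist_le[of s "F y"] by simp
    moreover have "norm (F y - F x) < \<epsilon> / 2"
      using d'[of y] y by (simp add: \<rho>'_def dist_norm norm_minus_commute)
    ultimately have "norm (flow (Y k) s (F y) - F x) < \<epsilon>"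
      using norm_triangle_ineq[of "flow (Y k) s (F y) - F y" "F y - F x"] by simp
    then show ?thesis using \<epsilon> by (auto simp: dist_norm norm_minus_commute)
  qed
  have "orbit_chart x0 (insert b I) G G' x \<rho>' (Suc n)"
    unfolding orbit_chart_def
  proof (intro conjI ballI impI)
    show "continuous_on (ball x \<rho>') G'" by (rule continuous_on_subset[OF G'_cont sub])
    show "x \<in> span (insert b I)" using x(2) span_mono[of I "insert b I"] by auto
    fix y assume y: "y \<in> ball x \<rho>'"
    then have yw: "y \<in> ball w \<rho>" using sub by auto
    show "(G has_derivative blinfun_apply (G' y)) (at y)" by (rule G_deriv[OF yw])
    show "G y \<in> \<Omega>" unfolding G_def using seg[OF y, of "y \<bullet> b"] by simp
    have "step (F y) (G y)" unfolding step_def G_def using k seg[OF y] by blast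
    then show "(step ^^ Suc n) x0 (G y)" using F_step(1)[OF yw] by (rule relpowp_Suc_I[rotated])
    show "G' y b' = 0" if "b' \<in> Basis - insert b I" for b'
      using that F'_0[OF yw, of b'] b by (auto simp: G'_apply D_def inner_not_same_Basis)
  next
    fix v assume "v \<in> span (insert b I)" "G' x v = 0"
    then obtain \<beta> where "v - \<beta> *\<^sub>R b \<in> span I" by (auto simp: span_breakdown_eq)
    define u where "u = v - \<beta> *\<^sub>R b"
    have u: "u \<in> span I" "v = \<beta> *\<^sub>R b + u" using \<open>v - \<beta> *\<^sub>R b \<in> span I\<close> by (auto simp: u_def)
    have xb: "x \<bullet> b = 0" by (rule orth[OF x(2)])
    have "v \<bullet> b = \<beta>" using orth[OF u(1)] b by (simp add: u(2) inner_add_left)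
    moreover have "F' x v = F' x u" using F'_0[OF x(1), of b] b by (simp add: u(2) blinfun.add_right blinfun.scaleR_right)
    ultimately have 0: "\<beta> *\<^sub>R Y k (F x) + F' x u = 0"
      using \<open>G' x v = 0\<close> by (simp add: G'_apply D_def G_def xb)
    have "\<beta> = 0"
    proof (rule ccontr)
      assume "\<beta> \<noteq> 0"
      have "F' x ((- 1 / \<beta>) *\<^sub>R u) = (1 / \<beta>) *\<^sub>R (- F' x u)" by (simp add: blinfun.scaleR_right blinfun.minus_right)
      also have "- F' x u = \<beta> *\<^sub>R Y k (F x)" using 0 by (metis minus_unique add.commute)
      finally have "F' x ((- 1 / \<beta>) *\<^sub>R u) = Y k (F x)" using \<open>\<beta> \<noteq> 0\<close> by simp
      moreover have "(- 1 / \<beta>) *\<^sub>R u \<in> span I" using u(1) by (rule span_scale)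
      ultimately show False using notin by (metis imageI)
    qed
    then show "v = 0" using 0 inj[OF u(1)] u(2) by simp
  qed (use I b \<open>\<rho>' > 0\<close> in auto)
  then show ?thesis using b by blast
qed

lemma orbit_chart_maximal:
  assumes "x0 \<in> \<Omega>"
  obtains I F F' w \<rho> n where "orbit_chart x0 I F F' w \<rho> n"
    "\<And>x. x \<in> ball w \<rho> \<Longrightarrow> x \<in> span I \<Longrightarrow> (\<And>v. v \<in> span I \<Longrightarrow> F' x v = 0 \<Longrightarrow> v = 0) \<Longrightarrow>
      (\<And>k. k \<in> {1..m} \<Longrightarrow> Y k (F x) \<in> F' x ` span I)"
proof -
  define P where "P I \<longleftrightarrow> (\<exists>F F' w \<rho> n. orbit_chart x0 I F F' w \<rho> n)" for I
  \<comment> \<open>The start is the constant chart without parameters and without steps;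
    cardinalities are bounded by the dimension, so a maximal \<open>I\<close> exists.\<close>
  have "orbit_chart x0 {} (\<lambda>_. x0) (\<lambda>_. 0) 0 1 0"
    using assms by (auto simp: orbit_chart_def blinfun.zero_left zero_blinfun.rep_eq)
  then have "P {}" unfolding P_def by blast
  moreover have bd: "card I < DIM('a) + 1" if "P I" for I
    using that card_mono[OF finite_Basis, of I] by (auto simp: P_def orbit_chart_def)
  ultimately obtain I where I: "P I" "\<And>J. P J \<Longrightarrow> card J \<le> card I"
    using ex_has_greatest_nat[of P "{}" card "DIM('a) + 1"] by (metis less_imp_le)
  then obtain F F' w \<rho> n where F: "orbit_chart x0 I F F' w \<rho> n" unfolding P_def by blast
  show ?thesis
  proof (rule that[OF F], rule ccontr)
    fix x k assume "x \<in> ball w \<rho>" "x \<in> span I" "\<And>v. v \<in> span I \<Longrightarrow> F' x v = 0 \<Longrightarrow> v = 0"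
      "k \<in> {1..m}" "Y k (F x) \<notin> F' x ` span I"
    from orbit_chart_extend[OF F this] obtain b where "b \<notin> I" "P (insert b I)" unfolding P_def by blast
    moreover have "finite I" using F finite_subset[OF _ finite_Basis] by (auto simp: orbit_chart_def)
    ultimately show False using I(2)[of "insert b I"] by simp
  qed
qed

text \<open>Hypothesis \<open>gen\<close> is the bracket generating condition in abstract form: a
  closed set whose proximal normals in \<open>V\<close> are orthogonal to all fields has no nonzero
  normal there. It is local in \<open>V\<close> because \<open>S\<close> has a boundary, where the
  fields may be transverse to it.\<close>

theorem orbit_open:
  assumes x0: "x0 \<in> \<Omega>"
    and gen: "\<And>S V s \<nu>. closed S \<Longrightarrow> open V \<Longrightarrow> V \<subseteq> \<Omega> \<Longrightarrow>
      (\<And>x \<mu> k. x \<in> S \<inter> V \<Longrightarrow> proximal_normal S x \<mu> \<Longrightarrow> k \<in> {1..m} \<Longrightarrow> \<mu> \<bullet> Y k x = 0) \<Longrightarrow>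
      s \<in> S \<inter> V \<Longrightarrow> proximal_normal S s \<nu> \<Longrightarrow> \<nu> = 0"
  shows "\<exists>Q n. open Q \<and> x0 \<in> Q \<and> (\<forall>y\<in>Q. (step ^^ n) x0 y)"
proof -
  obtain I F F' w \<rho> n where F: "orbit_chart x0 I F F' w \<rho> n"
    and max: "\<And>x k. x \<in> ball w \<rho> \<Longrightarrow> x \<in> span I \<Longrightarrow> (\<And>v. v \<in> span I \<Longrightarrow> F' x v = 0 \<Longrightarrow> v = 0) \<Longrightarrow>
      k \<in> {1..m} \<Longrightarrow> Y k (F x) \<in> F' x ` span I"
    using orbit_chart_maximal[OF x0] by blast
  note F_simps = F[unfolded orbit_chart_def]
  have "\<rho> > 0" and w: "w \<in> span I" and F_deriv: "\<And>y. y \<in> ball w \<rho> \<Longrightarrow> (F has_derivative blinfun_apply (F' y)) (at y)"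
    and F'_cont: "continuous_on (ball w \<rho>) F'"
    and F_step: "\<And>y. y \<in> ball w \<rho> \<Longrightarrow> (step ^^ n) x0 (F y)" "\<And>y. y \<in> ball w \<rho> \<Longrightarrow> F y \<in> \<Omega>"
    and F_inj: "\<And>v. v \<in> span I \<Longrightarrow> F' w v = 0 \<Longrightarrow> v = 0"
    using F_simps by auto
  \<comment> \<open>\<open>F' w\<close> expands \<open>span I\<close> at least by the factor
    \<open>c\<close>. On the ball of radius \<open>r\<close> the derivative varies by at most
    \<open>c / 2\<close>, so there \<open>F\<close> remains an immersion (\<open>F'_lower\<close>)
    and expands distances along \<open>span I\<close> at least by \<open>c / 2\<close>
    (\<open>F_lower\<close>).\<close>
  obtain c where "c > 0" and c: "\<And>v. v \<in> span I \<Longrightarrow> c * norm v \<le> norm (F' w v)"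
    using injective_imp_isometric[OF closed_span[of I] subspace_span blinfun.bounded_linear_right[of "F' w"]] F_inj
    by (metis mult.commute)
  have "continuous (at w) F'"
    using F'_cont \<open>\<rho> > 0\<close> by (simp add: continuous_on_eq_continuous_at)
  then obtain d where "d > 0" and d: "\<And>x. dist x w < d \<Longrightarrow> dist (F' x) (F' w) < c / 2"
    using \<open>c > 0\<close> unfolding continuous_at_eps_delta by (meson half_gt_zero)
  define r where "r = min (d / 2) (\<rho> / 2)"
  have "r > 0" using \<open>d > 0\<close> \<open>\<rho> > 0\<close> by (simp add: r_def)
  have sub: "cball w r \<subseteq> ball w \<rho>" using \<open>\<rho> > 0\<close> by (auto simp: r_def)
  have F'_near: "norm (F' x - F' w) \<le> c / 2" if "x \<in> cball w r" for x
    using d[of x] that \<open>d > 0\<close> by (simp add: r_def dist_norm norm_minus_commute)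
  have F'_lower: "v = 0" if "x \<in> cball w r" "v \<in> span I" "F' x v = 0" for x v
  proof -
    have "c * norm v \<le> norm ((F' x - F' w) v)"
      using c[OF that(2)] that(3) by (simp add: blinfun.diff_left)
    also have "\<dots> \<le> c / 2 * norm v"
      using norm_blinfun[of "F' x - F' w" v] mult_right_mono[OF F'_near[OF that(1)] norm_ge_zero[of v]] by linarith
    finally show ?thesis using \<open>c > 0\<close> by (simp add: mult_le_cancel_right)
  qed
  have F_lower: "c / 2 * norm (x - y) \<le> norm (F x - F y)"
    if "x \<in> cball w r" "y \<in> cball w r" "x - y \<in> span I" for x y
  proof -
    have "norm ((F x - F' w x) - (F y - F' w y)) \<le> c / 2 * norm (x - y)"
    proof (rule differentiable_bound[OF convex_cball _ _ that(1,2), where f' = "\<lambda>z v. F' z v - F' w v"])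
      fix z assume z: "z \<in> cball w r"
      have "(F has_derivative blinfun_apply (F' z)) (at z within cball w r)"
        by (rule has_derivative_at_withinI[OF F_deriv]) (use z sub in blast)
      then show "((\<lambda>x. F x - F' w x) has_derivative (\<lambda>v. F' z v - F' w v)) (at z within cball w r)"
        by (auto intro!: derivative_eq_intros)
      show "onorm (\<lambda>v. F' z v - F' w v) \<le> c / 2"
        using F'_near[OF z] by (simp add: norm_blinfun.rep_eq minus_blinfun.rep_eq)
    qed
    moreover have "(F x - F' w x) - (F y - F' w y) = (F x - F y) - F' w (x - y)"
      by (simp add: blinfun.diff_right)
    moreover have "norm (F' w (x - y)) \<le> norm (F x - F y) + norm ((F x - F y) - F' w (x - y))"
      using norm_triangle_ineq4[of "F x - F y" "(F x - F y) - F' w (x - y)"] by simp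
    ultimately show ?thesis using c[OF that(3)] by simp
  qed
  define S where "S = F ` (cball w r \<inter> span I)"
  define q where "q = F w"
  have "continuous_on (cball w r \<inter> span I) F"
  proof (intro continuous_at_imp_continuous_on ballI)
    show "isCont F x" if "x \<in> cball w r \<inter> span I" for x
      by (rule has_derivative_continuous[OF F_deriv]) (use that sub in blast)
  qed
  then have "compact S"
    unfolding S_def by (intro compact_continuous_image compact_Int_closed compact_cball closed_span)
  then have "closed S" by (rule compact_imp_closed)
  have qS: "q \<in> S" using w \<open>r > 0\<close> by (auto simp: S_def q_def)
  obtain \<epsilon>0 where "\<epsilon>0 > 0" "ball q \<epsilon>0 \<subseteq> \<Omega>"
    using open_dom F_step(2)[of w] \<open>\<rho> > 0\<close> open_contains_ball unfolding q_def by force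
  \<comment> \<open>A point \<open>F x\<close> of \<open>S\<close> closer to \<open>q\<close> than
    \<open>c / 2 * r\<close> has \<open>x\<close> in the open ball, by \<open>F_lower\<close>; near
    \<open>q\<close> the set \<open>S\<close> thus avoids the image of the boundary of the
    disc.\<close>
  define \<epsilon> where "\<epsilon> = min \<epsilon>0 (c / 2 * r)"
  have "\<epsilon> > 0" using \<open>\<epsilon>0 > 0\<close> \<open>c > 0\<close> \<open>r > 0\<close> by (simp add: \<epsilon>_def)
  have tangent: "\<mu> \<bullet> Y k s = 0" if s: "s \<in> S \<inter> ball q \<epsilon>" and \<mu>: "proximal_normal S s \<mu>" and k: "k \<in> {1..m}" for s \<mu> k
  proof -
    obtain x where x: "x \<in> cball w r" "x \<in> span I" "s = F x" using s by (auto simp: S_def)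
    have "c / 2 * norm (x - w) \<le> norm (F x - F w)"
      using \<open>r > 0\<close> by (intro F_lower x) (auto intro: span_diff x w)
    also have "\<dots> < c / 2 * r" using s by (auto simp: \<epsilon>_def q_def x(3) dist_norm norm_minus_commute)
    finally have xr: "x \<in> ball w r" using \<open>c > 0\<close> by (simp add: dist_norm norm_minus_commute)
    \<comment> \<open>As \<open>x\<close> is an interior parameter, the curve in direction
      \<open>v\<close> stays in \<open>S\<close> for a short time. Applied to \<open>v\<close> and
      \<open>- v\<close>, this yields orthogonality to the image of \<open>span I\<close> under
      \<open>F' x\<close>, which contains the fields by \<open>max\<close>.\<close>
    have dir: "\<mu> \<bullet> F' x v \<le> 0" if v: "v \<in> span I" for v
    proof (rule proximal_normal_contingent[OF \<mu>, where F = "at_right 0" and u = "\<lambda>t. t" and \<gamma> = "\<lambda>t. F (x + t *\<^sub>R v)"])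
      have "((\<lambda>t. x + t *\<^sub>R v) \<longlongrightarrow> x + 0 *\<^sub>R v) (at_right 0)" by (intro tendsto_intros)
      then have "\<forall>\<^sub>F t in at_right 0. x + t *\<^sub>R v \<in> ball w r"
        using xr by (intro topological_tendstoD) auto
      then show "\<forall>\<^sub>F t in at_right 0. F (x + t *\<^sub>R v) \<in> S"
      proof eventually_elim
        case (elim t)
        then show ?case using x(2) v unfolding S_def by (auto intro!: imageI span_add span_scale)
      qed
      have "((\<lambda>t. x + t *\<^sub>R v) has_derivative (\<lambda>t. t *\<^sub>R v)) (at 0)" by (auto intro!: derivative_eq_intros)
      moreover have "(F has_derivative blinfun_apply (F' x)) (at (x + 0 *\<^sub>R v))"
        using F_deriv[of x] sub x(1) by auto
      ultimately have "((\<lambda>t. F (x + t *\<^sub>R v)) has_derivative (\<lambda>t. F' x (t *\<^sub>R v))) (at 0)"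
        by (rule has_derivative_compose)
      then have "((\<lambda>t. F (x + t *\<^sub>R v)) has_derivative (\<lambda>t. t *\<^sub>R F' x v)) (at 0 within {0<..})"
        by (simp add: blinfun.scaleR_right has_derivative_at_withinI)
      then have "((\<lambda>t. (1 / norm (t - 0)) *\<^sub>R (F (x + t *\<^sub>R v) - (F (x + 0 *\<^sub>R v) + (t - 0) *\<^sub>R F' x v))) \<longlongrightarrow> 0) (at_right 0)"
        unfolding has_derivative_within by blast
      then have "((\<lambda>t. (1 / t) *\<^sub>R (F (x + t *\<^sub>R v) - s) - F' x v) \<longlongrightarrow> 0) (at_right 0)"
      proof (rule Lim_transform_eventually)
        show "\<forall>\<^sub>F t in at_right 0. (1 / norm (t - 0)) *\<^sub>R (F (x + t *\<^sub>R v) - (F (x + 0 *\<^sub>R v) + (t - 0) *\<^sub>R F' x v))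
            = (1 / t) *\<^sub>R (F (x + t *\<^sub>R v) - s) - F' x v"
          using eventually_at_right_less[of "0::real"]
          by eventually_elim (simp add: x(3) algebra_simps)
      qed
      then show "((\<lambda>t. (1 / t) *\<^sub>R (F (x + t *\<^sub>R v) - s)) \<longlongrightarrow> F' x v) (at_right 0)"
        by (rule LIM_zero_cancel)
    qed (auto simp: eventually_at_right_less)
    obtain v where v: "v \<in> span I" "Y k s = F' x v"
    proof -
      have "x \<in> ball w \<rho>" using sub x(1) by blast
      from max[OF this x(2) F'_lower[OF x(1)] k] show ?thesis using that x(3) by auto
    qed
    have "\<mu> \<bullet> F' x v \<le> 0" "\<mu> \<bullet> F' x (- v) \<le> 0" by (intro dir span_neg v(1))+
    then show ?thesis by (simp add: v(2) blinfun.minus_right)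
  qed
  have no_normal: "\<nu> = 0" if "s \<in> S \<inter> ball q \<epsilon>" "proximal_normal S s \<nu>" for s \<nu>
    by (rule gen[OF \<open>closed S\<close> open_ball _ tangent that])
      (use \<open>ball q \<epsilon>0 \<subseteq> \<Omega>\<close> in \<open>auto simp: \<epsilon>_def\<close>)
  have "ball q (\<epsilon> / 2) \<subseteq> S"
  proof
    fix p assume p: "p \<in> ball q (\<epsilon> / 2)"
    obtain s where s: "s \<in> S" "infdist p S = dist p s"
      using infdist_attains_inf[OF \<open>closed S\<close>] qS by blast
    have "proximal_normal S s (p - s)"
      using s infdist_le[of _ S p] by (auto simp: proximal_normal_def dist_norm)
    \<comment> \<open>The nearest point is no farther from \<open>p\<close> than \<open>q\<close>
      is, so its distance to \<open>q\<close> is below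
      \<open>\<epsilon> / 2 + \<epsilon> / 2\<close>, where nonzero normals are excluded.\<close>
    moreover have "dist p s \<le> dist p q" using s infdist_le[OF qS, of p] by simp
    then have "dist q s < \<epsilon>" using p dist_triangle[of q s p] by (simp add: dist_commute)
    ultimately have "p - s = 0" using s(1) by (intro no_normal[of s]) auto
    then show "p \<in> S" using s(1) by simp
  qed
  then have reach: "(step ^^ n) x0 p" if p: "p \<in> ball q (\<epsilon> / 2)" for p
  proof -
    obtain x where "x \<in> cball w r" "p = F x" using p \<open>ball q (\<epsilon> / 2) \<subseteq> S\<close> unfolding S_def by blast
    then show ?thesis using F_step(1)[of x] sub by blast
  qed
  \<comment> \<open>So far a ball about \<open>q\<close>, not about \<open>x0\<close>, has been
    reached. The return from \<open>q\<close> to \<open>x0\<close> carries it to a neighbourhood of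
    \<open>x0\<close>, at the cost of another \<open>n\<close> steps.\<close>
  have "(step ^^ n) q x0" using reach[of q] \<open>\<epsilon> > 0\<close> by (auto intro: relpowp_step_sym)
  from relpowp_step_open[OF this, of "ball q (\<epsilon> / 2)"] obtain Q where
    Q: "open Q" "x0 \<in> Q" "\<And>y. y \<in> Q \<Longrightarrow> \<exists>p\<in>ball q (\<epsilon> / 2). (step ^^ n) p y"
    using \<open>\<epsilon> > 0\<close> by auto
  have "(step ^^ (n + n)) x0 y" if "y \<in> Q" for y
    using Q(3)[OF that] reach unfolding relpowp_add by blast
  then show ?thesis using Q(1,2) by blast
qed

end

section \<open>Segments of integral lines\<close>

lemma has_velocity_cong:
  assumes v: "has_velocity A \<gamma> w t I" and eq: "\<And>s. s \<in> I \<Longrightarrow> \<gamma>' s = \<gamma> s" and t: "t \<in> I"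
  shows "has_velocity A \<gamma>' w t I"
proof -
  have "continuous (at t within I) \<gamma>'"
    using v t eq Lim_cong_within[of t t "\<gamma> t" "\<gamma>' t" I I \<gamma> \<gamma>']
    by (simp add: has_velocity_def continuous_within)
  moreover have "((chart_map c \<circ> \<gamma>') has_vector_derivative w c) (at t within I)"
    if "((chart_map c \<circ> \<gamma>) has_vector_derivative w c) (at t within I)" for c
    by (rule has_vector_derivative_transform[OF t _ that]) (simp add: eq)
  ultimately show ?thesis using v eq[OF t] by (simp add: has_velocity_def)
qed

lemma has_velocity_shift:
  assumes v: "has_velocity A \<gamma> w t {a..b}"
  shows "has_velocity A (\<lambda>s. \<gamma> (s - r)) w (t + r) {a + r..b + r}"
proof -
  have im: "(\<lambda>s. s - r) ` {a + r..b + r} = {a..b}"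
    by (simp add: image_diff_atLeastAtMost)
  have c1: "continuous (at (t + r) within {a + r..b + r}) (\<lambda>s. s - r)"
    by (intro continuous_intros)
  have d1: "((\<lambda>s. s - r) has_vector_derivative 1) (at (t + r) within {a + r..b + r})"
    by (auto intro!: derivative_eq_intros)
  have "continuous (at (t + r) within {a + r..b + r}) (\<lambda>s. \<gamma> (s - r))"
    by (rule continuous_within_compose2[OF c1]) (use v in \<open>simp add: im has_velocity_def\<close>)
  moreover have "((chart_map c \<circ> (\<lambda>s. \<gamma> (s - r))) has_vector_derivative w c) (at (t + r) within {a + r..b + r})"
    if "((chart_map c \<circ> \<gamma>) has_vector_derivative w c) (at t within {a..b})" for c
    using vector_diff_chain_within[OF d1, of "chart_map c \<circ> \<gamma>" "w c"] that by (simp add: im o_def)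
  ultimately show ?thesis using v by (simp add: has_velocity_def)
qed

lemma integral_segmentsE:
  assumes "integral_segments A F n T \<gamma>"
  obtains \<tau> where "\<tau> 0 = 0" "\<tau> n = T" "\<And>i. i < n \<Longrightarrow> \<tau> i \<le> \<tau> (Suc i)"
    "\<And>i. i \<le> n \<Longrightarrow> 0 \<le> \<tau> i" "\<And>i. i \<le> n \<Longrightarrow> \<tau> i \<le> T"
    "\<And>i. i < n \<Longrightarrow> \<exists>W Y \<sigma>. (W, Y) \<in> F \<and> \<sigma> \<in> {1, -1} \<and> (\<forall>t\<in>{\<tau> i..\<tau> (Suc i)}.
       \<gamma> t \<in> W \<and> has_velocity A \<gamma> (\<sigma> *\<^sub>R Y (\<gamma> t)) t {\<tau> i..\<tau> (Suc i)})"
proof -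
  obtain \<tau> where *: "\<tau> 0 = 0 \<and> \<tau> n = T \<and> (\<forall>i<n. \<tau> i \<le> \<tau> (Suc i) \<and>
        (\<exists>(W, Y)\<in>F. \<exists>\<sigma>\<in>{1, -1}. \<forall>t\<in>{\<tau> i..\<tau> (Suc i)}.
           \<gamma> t \<in> W \<and> has_velocity A \<gamma> (\<sigma> *\<^sub>R Y (\<gamma> t)) t {\<tau> i..\<tau> (Suc i)}))"
    using assms[unfolded integral_segments_def] by (elim exE)
  have \<tau>: "\<tau> 0 = 0" "\<tau> n = T" "\<And>i. i < n \<Longrightarrow> \<tau> i \<le> \<tau> (Suc i)" using * by simp_all
  have "0 \<le> \<tau> i" if "i \<le> n" for i
    using that
  proof (induction i)
    case (Suc i)
    then show ?case using \<tau>(3)[of i] by simp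
  qed (simp add: \<tau>)
  moreover have "\<tau> i \<le> T" if "i \<le> n" for i
    using that
  proof (induction i rule: inc_induct)
    case (step i)
    then show ?case using \<tau>(3)[of i] by simp
  qed (simp add: \<tau>)
  moreover have "\<exists>W Y \<sigma>. (W, Y) \<in> F \<and> \<sigma> \<in> {1, -1} \<and> (\<forall>t\<in>{\<tau> i..\<tau> (Suc i)}.
       \<gamma> t \<in> W \<and> has_velocity A \<gamma> (\<sigma> *\<^sub>R Y (\<gamma> t)) t {\<tau> i..\<tau> (Suc i)})" if "i < n" for i
    using *[THEN conjunct2, THEN conjunct2, rule_format, OF that, THEN conjunct2]
    by (elim bexE case_prodE) auto
  ultimately show ?thesis using that[of \<tau>] \<tau> by simp
qed

lemma integral_segmentsI:
  assumes "\<tau> 0 = 0" "\<tau> n = T" "\<And>i. i < n \<Longrightarrow> \<tau> i \<le> \<tau> (Suc i)"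
    "\<And>i. i < n \<Longrightarrow> \<exists>W Y \<sigma>. (W, Y) \<in> F \<and> \<sigma> \<in> {1, -1} \<and> (\<forall>t\<in>{\<tau> i..\<tau> (Suc i)}.
       \<gamma> t \<in> W \<and> has_velocity A \<gamma> (\<sigma> *\<^sub>R Y (\<gamma> t)) t {\<tau> i..\<tau> (Suc i)})"
  shows "integral_segments A F n T \<gamma>"
  unfolding integral_segments_def
proof (intro exI[of _ \<tau>] conjI allI impI)
  fix i assume "i < n"
  from assms(4)[OF this] obtain W Y \<sigma> where "(W, Y) \<in> F" "\<sigma> \<in> {1, -1}" "\<forall>t\<in>{\<tau> i..\<tau> (Suc i)}.
       \<gamma> t \<in> W \<and> has_velocity A \<gamma> (\<sigma> *\<^sub>R Y (\<gamma> t)) t {\<tau> i..\<tau> (Suc i)}" by (elim exE conjE)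
  then show "\<exists>(W, Y)\<in>F. \<exists>\<sigma>\<in>{1, -1}. \<forall>t\<in>{\<tau> i..\<tau> (Suc i)}.
       \<gamma> t \<in> W \<and> has_velocity A \<gamma> (\<sigma> *\<^sub>R Y (\<gamma> t)) t {\<tau> i..\<tau> (Suc i)}"
    by (intro bexI[of _ "(W, Y)"] case_prodI bexI[of _ \<sigma>])
qed (use assms in auto)

lemma integral_segments_0: "integral_segments A F 0 0 \<gamma>"
  by (rule integral_segmentsI[of "\<lambda>_. 0"]) auto

lemma integral_segments_mono:
  assumes "integral_segments A F n T \<gamma>" "F \<subseteq> F'"
  shows "integral_segments A F' n T \<gamma>"
  using assms(1)
proof (rule integral_segmentsE)
  fix \<tau> assume "\<tau> 0 = 0" "\<tau> n = T" "\<And>i. i < n \<Longrightarrow> \<tau> i \<le> \<tau> (Suc i)"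
    and F: "\<And>i. i < n \<Longrightarrow> \<exists>W Y \<sigma>. (W, Y) \<in> F \<and> \<sigma> \<in> {1, -1} \<and> (\<forall>t\<in>{\<tau> i..\<tau> (Suc i)}.
       \<gamma> t \<in> W \<and> has_velocity A \<gamma> (\<sigma> *\<^sub>R Y (\<gamma> t)) t {\<tau> i..\<tau> (Suc i)})"
  then show ?thesis
  proof (intro integral_segmentsI[of \<tau>])
    show "\<exists>W Y \<sigma>. (W, Y) \<in> F' \<and> \<sigma> \<in> {1, -1} \<and> (\<forall>t\<in>{\<tau> i..\<tau> (Suc i)}.
       \<gamma> t \<in> W \<and> has_velocity A \<gamma> (\<sigma> *\<^sub>R Y (\<gamma> t)) t {\<tau> i..\<tau> (Suc i)})" if "i < n" for i
      using F[OF that] assms(2) by (elim exE conjE) blast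
  qed
qed

lemma integral_segments_nonneg: "integral_segments A F n T \<gamma> \<Longrightarrow> 0 \<le> T"
  by (erule integral_segmentsE) auto

lemma integral_segments_append:
  assumes 1: "integral_segments A F n T \<gamma>" and 2: "integral_segments A F k S \<delta>" and eq: "\<gamma> T = \<delta> 0"
  defines "\<eta> \<equiv> \<lambda>t. if t \<le> T then \<gamma> t else \<delta> (t - T)"
  shows "integral_segments A F (n + k) (T + S) \<eta>"
proof -
  obtain \<tau> where \<tau>: "\<tau> 0 = 0" "\<tau> n = T" "\<And>i. i < n \<Longrightarrow> \<tau> i \<le> \<tau> (Suc i)"
      and \<tau>_ge: "\<And>i. i \<le> n \<Longrightarrow> 0 \<le> \<tau> i" and \<tau>_le: "\<And>i. i \<le> n \<Longrightarrow> \<tau> i \<le> T"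
      and \<tau>_seg: "\<And>i. i < n \<Longrightarrow> \<exists>W Y \<sigma>. (W, Y) \<in> F \<and> \<sigma> \<in> {1, -1} \<and> (\<forall>t\<in>{\<tau> i..\<tau> (Suc i)}.
         \<gamma> t \<in> W \<and> has_velocity A \<gamma> (\<sigma> *\<^sub>R Y (\<gamma> t)) t {\<tau> i..\<tau> (Suc i)})"
    using 1 by (rule integral_segmentsE) blast
  obtain \<rho> where \<rho>: "\<rho> 0 = 0" "\<rho> k = S" "\<And>i. i < k \<Longrightarrow> \<rho> i \<le> \<rho> (Suc i)"
      and \<rho>_ge: "\<And>i. i \<le> k \<Longrightarrow> 0 \<le> \<rho> i" and \<rho>_le: "\<And>i. i \<le> k \<Longrightarrow> \<rho> i \<le> S"
      and \<rho>_seg: "\<And>i. i < k \<Longrightarrow> \<exists>W Y \<sigma>. (W, Y) \<in> F \<and> \<sigma> \<in> {1, -1} \<and> (\<forall>t\<in>{\<rho> i..\<rho> (Suc i)}.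
         \<delta> t \<in> W \<and> has_velocity A \<delta> (\<sigma> *\<^sub>R Y (\<delta> t)) t {\<rho> i..\<rho> (Suc i)})"
    using 2 by (rule integral_segmentsE) blast
  \<comment> \<open>The junction \<open>t = T\<close> belongs to both pieces, and by
    \<open>eq\<close> both formulas agree there; hence each closed piece has its one-sided
    velocities up to the endpoints.\<close>
  have \<eta>2: "\<eta> t = \<delta> (t - T)" if "T \<le> t" for t
    using that eq by (cases "t = T") (auto simp: \<eta>_def)
  define \<kappa> where "\<kappa> i = (if i \<le> n then \<tau> i else T + \<rho> (i - n))" for i
  have \<kappa>2: "\<kappa> i = \<rho> (i - n) + T" if "n \<le> i" for i
    using that \<tau>(2) \<rho>(1) by (cases "i = n") (auto simp: \<kappa>_def)
  show ?thesis
  proof (rule integral_segmentsI[of \<kappa>])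
    show "\<kappa> 0 = 0" using \<tau> by (simp add: \<kappa>_def)
    show "\<kappa> (n + k) = T + S" using \<rho>(2) \<kappa>2[of "n + k"] by simp
    fix i assume i: "i < n + k"
    show "\<kappa> i \<le> \<kappa> (Suc i)"
    proof (cases "i < n")
      case True
      then show ?thesis using \<tau>(3) by (simp add: \<kappa>_def)
    next
      case False
      then show ?thesis using \<rho>(3)[of "i - n"] i by (simp add: \<kappa>2 Suc_diff_le)
    qed
    show "\<exists>W Y \<sigma>. (W, Y) \<in> F \<and> \<sigma> \<in> {1, -1} \<and> (\<forall>t\<in>{\<kappa> i..\<kappa> (Suc i)}.
           \<eta> t \<in> W \<and> has_velocity A \<eta> (\<sigma> *\<^sub>R Y (\<eta> t)) t {\<kappa> i..\<kappa> (Suc i)})"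
    proof (cases "i < n")
      case True
      obtain W Y \<sigma> where WY: "(W, Y) \<in> F" "\<sigma> \<in> {1, -1}" and
        *: "\<And>t. t \<in> {\<tau> i..\<tau> (Suc i)} \<Longrightarrow> \<gamma> t \<in> W \<and> has_velocity A \<gamma> (\<sigma> *\<^sub>R Y (\<gamma> t)) t {\<tau> i..\<tau> (Suc i)}"
        using \<tau>_seg[OF True] by (elim exE conjE) blast
      have \<kappa>: "\<kappa> i = \<tau> i" "\<kappa> (Suc i) = \<tau> (Suc i)" using True by (auto simp: \<kappa>_def)
      have e: "\<eta> s = \<gamma> s" if "s \<in> {\<tau> i..\<tau> (Suc i)}" for s
        using that \<tau>_le[of "Suc i"] True by (auto simp: \<eta>_def)
      have "\<eta> t \<in> W \<and> has_velocity A \<eta> (\<sigma> *\<^sub>R Y (\<eta> t)) t {\<tau> i..\<tau> (Suc i)}" if "t \<in> {\<tau> i..\<tau> (Suc i)}" for t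
        using *[OF that] has_velocity_cong[OF _ e that] e[OF that] by auto
      then show ?thesis using WY unfolding \<kappa> by blast
    next
      case False
      define j where "j = i - n"
      have j: "j < k" using i False by (simp add: j_def)
      obtain W Y \<sigma> where WY: "(W, Y) \<in> F" "\<sigma> \<in> {1, -1}" and
        *: "\<And>t. t \<in> {\<rho> j..\<rho> (Suc j)} \<Longrightarrow> \<delta> t \<in> W \<and> has_velocity A \<delta> (\<sigma> *\<^sub>R Y (\<delta> t)) t {\<rho> j..\<rho> (Suc j)}"
        using \<rho>_seg[OF j] by (elim exE conjE) blast
      have \<kappa>: "\<kappa> i = \<rho> j + T" "\<kappa> (Suc i) = \<rho> (Suc j) + T"
        using False by (auto simp: \<kappa>2 j_def Suc_diff_le)
      have e: "\<eta> s = \<delta> (s - T)" if "s \<in> {\<rho> j + T..\<rho> (Suc j) + T}" for s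
        using that \<rho>_ge[of j] j by (intro \<eta>2) auto
      have "\<eta> t \<in> W \<and> has_velocity A \<eta> (\<sigma> *\<^sub>R Y (\<eta> t)) t {\<rho> j + T..\<rho> (Suc j) + T}"
        if t: "t \<in> {\<rho> j + T..\<rho> (Suc j) + T}" for t
      proof -
        have t': "t - T \<in> {\<rho> j..\<rho> (Suc j)}" using t by auto
        have "has_velocity A (\<lambda>s. \<delta> (s - T)) (\<sigma> *\<^sub>R Y (\<delta> (t - T))) (t - T + T) {\<rho> j + T..\<rho> (Suc j) + T}"
          using *[OF t'] by (intro has_velocity_shift) auto
        then show ?thesis using *[OF t'] has_velocity_cong[OF _ e t] e[OF t] by auto
      qed
      then show ?thesis using WY unfolding \<kappa> by blast
    qed
  qed
qed

section \<open>Absolute continuity and horizontality of concatenated segments\<close>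

lemma lipschitz_imp_abs_continuous_on:
  assumes lip: "L-lipschitz_on {a..b} f"
  shows "abs_continuous_on a b f"
  unfolding abs_continuous_on_def
proof (intro allI impI)
  fix \<epsilon> :: real assume "\<epsilon> > 0"
  have L: "L \<ge> 0" using lip by (rule lipschitz_on_nonneg)
  \<comment> \<open>Dividing by \<open>L + 1\<close> covers \<open>L = 0\<close>.\<close>
  have "(\<Sum>i<n. dist (f (s i)) (f (t i))) < \<epsilon>"
    if st: "\<forall>i<n. a \<le> s i \<and> s i \<le> t i \<and> t i \<le> b" and sum: "(\<Sum>i<n. t i - s i) < \<epsilon> / (L + 1)"
    for n :: nat and s t :: "nat \<Rightarrow> real"
  proof -
    have "(\<Sum>i<n. dist (f (s i)) (f (t i))) \<le> (\<Sum>i<n. L * (t i - s i))"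
    proof (rule sum_mono)
      fix i assume "i \<in> {..<n}"
      then have "a \<le> s i" "s i \<le> t i" "t i \<le> b" using st by auto
      then show "dist (f (s i)) (f (t i)) \<le> L * (t i - s i)"
        using lipschitz_onD[OF lip, of "s i" "t i"] by (simp add: dist_real_def)
    qed
    also have "\<dots> = L * (\<Sum>i<n. t i - s i)" by (simp add: sum_distrib_left)
    also have "\<dots> \<le> (L + 1) * (\<Sum>i<n. t i - s i)"
      using st by (intro mult_right_mono sum_nonneg) auto
    also have "\<dots> < \<epsilon>" using sum L by (simp add: pos_less_divide_eq mult.commute)
    finally show ?thesis .
  qed
  then show "\<exists>\<delta>>0. \<forall>(n::nat) s t. (\<forall>i<n. a \<le> s i \<and> s i \<le> t i \<and> t i \<le> b) \<and>
      (\<forall>i. Suc i < n \<longrightarrow> t i \<le> s (Suc i)) \<and> (\<Sum>i<n. t i - s i) < \<delta> \<longrightarrow>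
      (\<Sum>i<n. dist (f (s i)) (f (t i))) < \<epsilon>"
    using \<open>\<epsilon> > 0\<close> L by (intro exI[of _ "\<epsilon> / (L + 1)"]) auto
qed

text \<open>Only the norm of the velocity is compared with a continuous function: on a segment the
  velocity is \<open>\<sigma> *\<^sub>R Y\<close>, and the sign drops out.\<close>

lemma lipschitz_if_continuous_velocity:
  fixes f :: "real \<Rightarrow> 'a::real_normed_vector"
  assumes "\<And>t. t \<in> {a..b} \<Longrightarrow> (f has_vector_derivative f' t) (at t within {a..b})"
    and g: "continuous_on {a..b} g" "\<And>t. t \<in> {a..b} \<Longrightarrow> norm (f' t) = norm (g t)"
  shows "\<exists>L. L-lipschitz_on {a..b} f"
proof -
  have "bounded (g ` {a..b})"
    by (intro compact_imp_bounded compact_continuous_image g(1)) auto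
  then obtain K where K: "K > 0" "\<And>t. t \<in> {a..b} \<Longrightarrow> norm (g t) \<le> K" unfolding bounded_pos by auto
  have "K-lipschitz_on {a..b} f"
  proof (rule bounded_derivative_imp_lipschitz)
    fix t assume t: "t \<in> {a..b}"
    show "(f has_derivative (\<lambda>u. u *\<^sub>R f' t)) (at t within {a..b})"
      using assms(1)[OF t] by (simp add: has_vector_derivative_def)
    show "onorm (\<lambda>u. u *\<^sub>R f' t) \<le> K"
      using K(2)[OF t] g(2)[OF t] by (intro onorm_le) (simp add: mult.commute[of K] mult_left_mono)
  qed (use K in auto)
  then show ?thesis ..
qed

text \<open>In a chart each piece is Lipschitz, because its velocity is continuous on a compact
  interval; finitely many pieces glue to a Lipschitz curve. Horizontality can fail only at the
  breakpoints, a null set, since inside a piece the velocity relative to the piece is that relative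
  to \<open>{0..T}\<close>.\<close>

lemma joined_if_segments:
  assumes seg: "integral_segments A F n T \<gamma>" and charts: "\<And>c. c \<in> A \<Longrightarrow> is_chart c"
    and FK: "\<And>W Y p. (W, Y) \<in> F \<Longrightarrow> p \<in> W \<Longrightarrow> Y p \<in> K p \<and> - Y p \<in> K p"
    and F_cont: "\<And>W Y c. (W, Y) \<in> F \<Longrightarrow> c \<in> A \<Longrightarrow> continuous_on (chart_map c ` (chart_dom c \<inter> W)) (coord c Y)"
  shows "joined_by_segments A K F n (\<gamma> 0) (\<gamma> T)"
proof -
  obtain \<tau> where \<tau>: "\<tau> 0 = 0" "\<tau> n = T" "\<And>i. i < n \<Longrightarrow> \<tau> i \<le> \<tau> (Suc i)"
      and \<tau>_ge: "\<And>i. i \<le> n \<Longrightarrow> 0 \<le> \<tau> i" and \<tau>_le: "\<And>i. i \<le> n \<Longrightarrow> \<tau> i \<le> T"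
      and \<tau>_seg: "\<And>i. i < n \<Longrightarrow> \<exists>W Y \<sigma>. (W, Y) \<in> F \<and> \<sigma> \<in> {1, -1} \<and> (\<forall>t\<in>{\<tau> i..\<tau> (Suc i)}.
         \<gamma> t \<in> W \<and> has_velocity A \<gamma> (\<sigma> *\<^sub>R Y (\<gamma> t)) t {\<tau> i..\<tau> (Suc i)})"
    using seg by (rule integral_segmentsE) blast
  \<comment> \<open>The additional set \<open>J n = {T}\<close> makes the pieces cover
    \<open>{0..T}\<close> also for \<open>n = 0\<close>.\<close>
  define J where "J i = {\<tau> i..\<tau> (if i < n then Suc i else n)}" for i
  have J: "J i = {\<tau> i..\<tau> (Suc i)}" if "i < n" for i using that by (simp add: J_def)
  have Jn: "J n = {T}" using \<tau>(2) by (simp add: J_def)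
  have cover: "\<exists>i\<le>n. t \<in> J i" if "t \<in> {0..T}" for t
  proof -
    have "k \<le> n \<Longrightarrow> t \<le> \<tau> k \<Longrightarrow> \<exists>i\<le>n. t \<in> J i" for k
    proof (induction k)
      case 0
      then have "t = 0" using that \<tau>(1) by simp
      then have "t \<in> J 0" using \<tau> \<tau>_ge[of 1] by (cases n) (auto simp: J_def)
      then show ?case by blast
    next
      case (Suc k)
      show ?case
      proof (cases "t \<le> \<tau> k")
        case True
        then show ?thesis using Suc by simp
      next
        case False
        then have "t \<in> J k" using Suc.prems J[of k] by auto
        then show ?thesis using Suc.prems by (intro exI[of _ k]) simp
      qed
    qed
    from this[of n] show ?thesis using that \<tau>(2) by simp
  qed
  have cont_J: "continuous_on (J i) \<gamma>" if "i \<le> n" for i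
  proof (cases "i = n")
    case True
    then show ?thesis by (simp add: Jn)
  next
    case False
    then have i: "i < n" using that by simp
    show ?thesis
      using \<tau>_seg[OF i] unfolding continuous_on_eq_continuous_within J[OF i] has_velocity_def
      by (elim exE conjE) blast
  qed
  have cont: "continuous_on {0..T} \<gamma>"
  proof (rule continuous_on_subset)
    show "continuous_on (\<Union>i\<in>{..n}. J i) \<gamma>"
    proof (rule continuous_on_closed_Union)
      show "closed (J i)" for i unfolding J_def by (rule closed_real_atLeastAtMost)
    qed (auto intro: cont_J)
  qed (use cover in blast)
  have "abs_continuous_curve A T \<gamma>"
    unfolding abs_continuous_curve_def
  proof (intro conjI cont ballI allI impI)
    fix c a b assume c: "c \<in> A" and ab: "0 \<le> a \<and> a \<le> b \<and> b \<le> T \<and> \<gamma> ` {a..b} \<subseteq> chart_dom c"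
    have hom: "homeomorphism (chart_dom c) (chart_map c ` chart_dom c) (chart_map c) (chart_inv c)"
      using charts[OF c] by (simp add: is_chart_def)
    then have map_cont: "continuous_on (chart_dom c) (chart_map c)" by (simp add: homeomorphism_def)
    have "\<exists>L. L-lipschitz_on (J i \<inter> {a..b}) (chart_map c \<circ> \<gamma>)" if "i \<le> n" for i
    proof (cases "i = n")
      case True
      then show ?thesis by (intro exI[of _ 0]) (auto simp: Jn lipschitz_on_def)
    next
      case False
      then have i: "i < n" using that by simp
      obtain W Y \<sigma> where WY: "(W, Y) \<in> F" "\<sigma> \<in> {1, -1}" and
        v: "\<And>t. t \<in> J i \<Longrightarrow> \<gamma> t \<in> W \<and> has_velocity A \<gamma> (\<sigma> *\<^sub>R Y (\<gamma> t)) t (J i)"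
        using \<tau>_seg[OF i] unfolding J[OF i] by (elim exE conjE) blast
      define l where "l = max a (\<tau> i)"
      define u where "u = min b (\<tau> (Suc i))"
      have lu: "J i \<inter> {a..b} = {l..u}" unfolding J[OF i] l_def u_def by auto
      have sub: "\<gamma> t \<in> chart_dom c" "\<gamma> t \<in> W" "t \<in> J i" if "t \<in> {l..u}" for t
        using that ab v unfolding lu[symmetric] by auto
      have "\<exists>L. L-lipschitz_on {l..u} (chart_map c \<circ> \<gamma>)"
      proof (rule lipschitz_if_continuous_velocity)
        fix t assume t: "t \<in> {l..u}"
        have "((chart_map c \<circ> \<gamma>) has_vector_derivative (\<sigma> *\<^sub>R Y (\<gamma> t)) c) (at t within J i)"
          using v[OF sub(3)[OF t]] sub(1)[OF t] c unfolding has_velocity_def by blast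
        then show "((chart_map c \<circ> \<gamma>) has_vector_derivative (\<sigma> *\<^sub>R Y (\<gamma> t)) c) (at t within {l..u})"
          by (rule has_vector_derivative_within_subset) (use sub(3) in blast)
        have "chart_inv c (chart_map c (\<gamma> t)) = \<gamma> t"
          using hom sub(1)[OF t] by (simp add: homeomorphism_def)
        then show "norm ((\<sigma> *\<^sub>R Y (\<gamma> t)) c) = norm ((coord c Y \<circ> (chart_map c \<circ> \<gamma>)) t)"
          using WY(2) by (auto simp: coord_def scaleR_fun_def)
      next
        have "continuous_on {l..u} \<gamma>"
          by (rule continuous_on_subset[OF cont_J[OF that]]) (use sub(3) in blast)
        then have "continuous_on {l..u} (chart_map c \<circ> \<gamma>)"
          by (rule continuous_on_compose) (use sub(1) in \<open>auto intro: continuous_on_subset[OF map_cont]\<close>)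
        then show "continuous_on {l..u} (coord c Y \<circ> (chart_map c \<circ> \<gamma>))"
          by (rule continuous_on_compose)
            (use sub(1,2) in \<open>auto intro!: continuous_on_subset[OF F_cont[OF WY(1) c]]\<close>)
      qed
      then show ?thesis by (simp add: lu)
    qed
    then obtain L :: "nat \<Rightarrow> real" where L: "\<And>i. i \<le> n \<Longrightarrow> (L i)-lipschitz_on (J i \<inter> {a..b}) (chart_map c \<circ> \<gamma>)" by metis
    then have L0: "L i \<ge> 0" if "i \<le> n" for i using that lipschitz_on_nonneg by blast
    have "(\<Sum>i\<le>n. L i)-lipschitz_on {a..b} (chart_map c \<circ> \<gamma>)"
    proof (rule lipschitz_on_closed_Union)
      show "(\<Sum>i\<le>n. L i)-lipschitz_on (J i \<inter> {a..b}) (chart_map c \<circ> \<gamma>)" if "i \<in> {..n}" for i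
      proof (rule lipschitz_on_le[OF L])
        show "L i \<le> (\<Sum>i\<le>n. L i)" using that L0 by (intro member_le_sum) simp_all
      qed (use that in simp)
      show "{a..b} \<subseteq> (\<Union>i\<in>{..n}. J i \<inter> {a..b})"
      proof
        fix t assume t: "t \<in> {a..b}"
        then have "t \<in> {0..T}" using ab by simp
        from cover[OF this] show "t \<in> (\<Union>i\<in>{..n}. J i \<inter> {a..b})" using t by blast
      qed
      show "closed (J i \<inter> {a..b})" for i
        unfolding J_def by (intro closed_Int closed_real_atLeastAtMost)
      show "0 \<le> (\<Sum>i\<le>n. L i)" using L0 by (intro sum_nonneg) simp
    qed simp
    then show "abs_continuous_on a b (chart_map c \<circ> \<gamma>)" by (rule lipschitz_imp_abs_continuous_on)
  qed
  moreover have "horizontal A K T \<gamma>"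
  proof -
    have "negligible (\<tau> ` {..n})" by (rule negligible_finite) simp
    then have "AE t in lebesgue. t \<notin> \<tau> ` {..n}"
      by (intro AE_not_in) (simp add: negligible_iff_null_sets)
    moreover have "\<exists>w\<in>K (\<gamma> t). has_velocity A \<gamma> w t {0..T}" if t: "t \<notin> \<tau> ` {..n}" "t \<in> {0..T}" for t
    proof -
      obtain i where "i \<le> n" "t \<in> J i" using cover t(2) by blast
      then have i: "i < n" using t(1) Jn \<tau>(2) by (cases "i = n") auto
      have "\<tau> i \<noteq> t" "\<tau> (Suc i) \<noteq> t" using t(1) i by auto
      then have ti: "\<tau> i < t" "t < \<tau> (Suc i)" using \<open>t \<in> J i\<close> unfolding J[OF i] by auto
      moreover have "0 \<le> \<tau> i" "\<tau> (Suc i) \<le> T" using i by (auto intro: \<tau>_le \<tau>_ge)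
      ultimately have at: "at t within {\<tau> i..\<tau> (Suc i)} = at t within {0..T}"
        by (simp add: at_within_Icc_at)
      obtain W Y \<sigma> where "(W, Y) \<in> F" "\<sigma> \<in> {1, -1}" "\<gamma> t \<in> W"
        "has_velocity A \<gamma> (\<sigma> *\<^sub>R Y (\<gamma> t)) t {\<tau> i..\<tau> (Suc i)}"
        using \<tau>_seg[OF i] ti by (elim exE conjE) auto
      then show ?thesis using FK[of W Y "\<gamma> t"] unfolding has_velocity_def at
        by (intro bexI[of _ "\<sigma> *\<^sub>R Y (\<gamma> t)"]) auto
    qed
    ultimately show ?thesis unfolding horizontal_def by (auto elim: eventually_mono)
  qed
  ultimately show ?thesis
    using seg integral_segments_nonneg[OF seg] unfolding joined_by_segments_def by blast
qed

section \<open>Carnot-Caratheodory spaces\<close>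

text \<open>\<open>C_k_on\<close> speaks of the derivative in each fixed direction; in finite
  dimension its continuity there amounts to continuity in the operator norm.\<close>

lemma C_k_on_1_blinfun:
  fixes f :: "'a::euclidean_space \<Rightarrow> 'b::real_normed_vector"
  assumes "C_k_on 1 f S"
  obtains f' where "\<And>x. x \<in> S \<Longrightarrow> (f has_derivative blinfun_apply (f' x)) (at x)" "continuous_on S f'"
proof -
  define f' where "f' x = Blinfun (frechet_derivative f (at x))" for x
  have d: "(f has_derivative frechet_derivative f (at x)) (at x)" if "x \<in> S" for x
    using assms that by (simp add: frechet_derivative_works[symmetric])
  then have f': "blinfun_apply (f' x) = frechet_derivative f (at x)" if "x \<in> S" for x
    using bounded_linear_Blinfun_apply[OF has_derivative_bounded_linear[OF d[OF that]]] by (simp add: f'_def)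
  have "continuous_on S f'"
  proof (rule continuous_on_blinfun_componentwise)
    fix i :: 'a
    have "continuous_on S (\<lambda>x. frechet_derivative f (at x) i)" using assms by simp
    then show "continuous_on S (\<lambda>x. f' x i)"
      by (subst continuous_on_cong[OF refl]) (auto simp: f')
  qed
  then show ?thesis using that[of f'] d f' by simp
qed

lemma
  assumes "is_chart c"
  shows chart_inv_map: "p \<in> chart_dom c \<Longrightarrow> chart_inv c (chart_map c p) = p"
    and chart_map_inv: "x \<in> chart_map c ` chart_dom c \<Longrightarrow> chart_map c (chart_inv c x) = x"
    and chart_inv_in: "x \<in> chart_map c ` chart_dom c \<Longrightarrow> chart_inv c x \<in> chart_dom c"
    and chart_map_cont: "continuous_on (chart_dom c) (chart_map c)"
    and chart_inv_cont: "continuous_on (chart_map c ` chart_dom c) (chart_inv c)"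
    and chart_open_dom: "open (chart_dom c)"
    and chart_open_image: "open W \<Longrightarrow> open (chart_map c ` (chart_dom c \<inter> W))"
proof -
  have hom: "homeomorphism (chart_dom c) (chart_map c ` chart_dom c) (chart_map c) (chart_inv c)"
    and op: "open (chart_dom c)" "open (chart_map c ` chart_dom c)"
    using assms by (auto simp: is_chart_def)
  show "p \<in> chart_dom c \<Longrightarrow> chart_inv c (chart_map c p) = p"
    using hom by (simp add: homeomorphism_def)
  show "x \<in> chart_map c ` chart_dom c \<Longrightarrow> chart_map c (chart_inv c x) = x"
    by (rule homeomorphism_apply2[OF hom])
  show "x \<in> chart_map c ` chart_dom c \<Longrightarrow> chart_inv c x \<in> chart_dom c"
    using hom by (auto simp: homeomorphism_def)
  show "continuous_on (chart_dom c) (chart_map c)" "continuous_on (chart_map c ` chart_dom c) (chart_inv c)"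
    using hom by (auto simp: homeomorphism_def)
  show "open (chart_dom c)" by (rule op)
  assume "open W"
  then have "openin (top_of_set (chart_dom c)) (chart_dom c \<inter> W)" by (simp add: openin_open_Int)
  from homeomorphism_imp_open_map[OF hom this] show "open (chart_map c ` (chart_dom c \<inter> W))"
    using op(2) by (simp add: openin_open_eq)
qed

lemma linear_eval: "linear (\<lambda>w::'c \<Rightarrow> 'e::real_vector. w c)"
  by (rule linearI) (simp_all add: plus_fun_def scaleR_fun_def)

lemma tangent_space_eqI:
  assumes "v \<in> tangent_space A p" "w \<in> tangent_space A p" "c \<in> A" "p \<in> chart_dom c" "v c = w c"
  shows "v = w"
proof
  fix c'
  show "v c' = w c'"
  proof (cases "c' \<in> A \<and> p \<in> chart_dom c'")
    case True
    have *: "u c' = frechet_derivative (transition c c') (at (chart_map c p)) (u c)"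
      if "u \<in> tangent_space A p" for u
      using that True assms(3,4) unfolding tangent_space_def by blast
    show ?thesis using *[OF assms(1)] *[OF assms(2)] assms(5) by simp
  next
    case False
    have *: "u c' = 0" if "u \<in> tangent_space A p" for u
      using that False unfolding tangent_space_def by blast
    show ?thesis using *[OF assms(1)] *[OF assms(2)] by simp
  qed
qed

text \<open>\<open>has_velocity\<close> asks for the derivative in every chart around the point. One
  chart suffices, by the chain rule for the transition map and the transformation law of
  \<open>w\<close>.\<close>

lemma has_velocity_chart:
  assumes A: "smooth_atlas A" and c: "c \<in> A" and t: "t \<in> I"
    and \<phi>: "\<phi> ` I \<subseteq> chart_map c ` chart_dom c" "(\<phi> has_vector_derivative v) (at t within I)"
    and \<gamma>: "\<And>s. s \<in> I \<Longrightarrow> \<gamma> s = chart_inv c (\<phi> s)"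
    and w: "w \<in> tangent_space A (\<gamma> t)" "w c = v"
  shows "has_velocity A \<gamma> w t I"
proof (rule has_velocity_cong[OF _ \<gamma> t])
  have charts: "\<And>c. c \<in> A \<Longrightarrow> is_chart c" using A by (simp add: smooth_atlas_def)
  have \<phi>t: "\<phi> t \<in> chart_map c ` chart_dom c" using \<phi>(1) t by auto
  have map_\<gamma>: "chart_map c (\<gamma> t) = \<phi> t" using chart_map_inv[OF charts[OF c] \<phi>t] \<gamma>[OF t] by simp
  have \<gamma>t: "\<gamma> t \<in> chart_dom c" using chart_inv_in[OF charts[OF c] \<phi>t] \<gamma>[OF t] by simp
  show "has_velocity A (\<lambda>s. chart_inv c (\<phi> s)) w t I"
    unfolding has_velocity_def
  proof (intro conjI ballI impI)
    show "w \<in> tangent_space A (chart_inv c (\<phi> t))" using w(1) \<gamma>[OF t] by simp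
    have "continuous (at (\<phi> t) within \<phi> ` I) (chart_inv c)"
      using chart_inv_cont[OF charts[OF c]] \<phi>t \<phi>(1) continuous_within_subset
      unfolding continuous_on_eq_continuous_within by metis
    then show "continuous (at t within I) (\<lambda>s. chart_inv c (\<phi> s))"
      by (rule continuous_within_compose2[OF has_vector_derivative_continuous[OF \<phi>(2)]])
    fix c' assume c': "c' \<in> A" "chart_inv c (\<phi> t) \<in> chart_dom c'"
    then have \<gamma>t': "\<gamma> t \<in> chart_dom c'" using \<gamma>[OF t] by simp
    have "C_k_on 1 (transition c c') (chart_map c ` (chart_dom c \<inter> chart_dom c'))"
      using A c c'(1) unfolding smooth_atlas_def smooth_on_def by blast
    then have "transition c c' differentiable at (chart_map c (\<gamma> t))"
      using \<gamma>t \<gamma>t' by simp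
    then have "(transition c c' has_derivative frechet_derivative (transition c c') (at (\<phi> t))) (at (\<phi> t) within \<phi> ` I)"
      unfolding map_\<gamma> frechet_derivative_works by (rule has_derivative_at_withinI)
    from vector_derivative_diff_chain_within[OF \<phi>(2) this]
    have "((transition c c' \<circ> \<phi>) has_vector_derivative frechet_derivative (transition c c') (at (\<phi> t)) v) (at t within I)" .
    moreover have "w c' = frechet_derivative (transition c c') (at (chart_map c (\<gamma> t))) (w c)"
      using w(1) \<gamma>t \<gamma>t' c c'(1) unfolding tangent_space_def by blast
    then have "w c' = frechet_derivative (transition c c') (at (\<phi> t)) v" by (simp only: map_\<gamma> w(2))
    ultimately show "((chart_map c' \<circ> (\<lambda>s. chart_inv c (\<phi> s))) has_vector_derivative w c') (at t within I)"
      by (simp add: transition_def o_def)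
  qed
qed

section \<open>Bracket generation in coordinates, and connectivity\<close>

context carnot_caratheodory_space
begin

lemma is_chart: "c \<in> A \<Longrightarrow> is_chart c"
  using atlas by (simp add: smooth_atlas_def)

lemma chart_ex: "\<exists>c\<in>A. p \<in> chart_dom c"
  using atlas unfolding smooth_atlas_def by blast

lemma frame_tangent:
  assumes "v \<in> U g" "k \<in> {1..DIM('e)}" shows "X g k v \<in> tangent_space A v"
  using frame_span[OF assms(1)] span_base[of "X g k v" "(\<lambda>k. X g k v) ` {1..DIM('e)}"] assms(2) by auto

text \<open>A dimension count: the \<open>DIM('e)\<close> frame vectors at \<open>p\<close> are
  independent and evaluation in \<open>c\<close> is injective on the tangent space, so their
  coordinates span the model space.\<close>

lemma tangent_coord_surj:
  assumes "c \<in> A" "p \<in> chart_dom c"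
  obtains w where "w \<in> tangent_space A p" "w c = (e :: 'e)"
proof -
  define T where "T = (\<lambda>k. X p k p) ` {1..DIM('e)}"
  have p: "p \<in> U p" using nhd by blast
  have span: "span T = tangent_space A p" unfolding T_def by (rule frame_span[OF p])
  have ind: "independent T" unfolding T_def by (rule frame_indep[OF p])
  have card: "card T = DIM('e)" unfolding T_def using card_image[OF frame_inj[OF p]] by simp
  have inj: "inj_on (\<lambda>w. w c) (span T)"
    unfolding span inj_on_def using assms by (blast intro: tangent_space_eqI)
  have ind': "independent ((\<lambda>w. w c) ` T)"
    by (rule linear_independent_injective_image[OF linear_eval ind inj])
  moreover have "card ((\<lambda>w. w c) ` T) = DIM('e)"
    using card_image[OF inj_on_subset[OF inj span_superset]] card by simp
  ultimately have "UNIV \<subseteq> span ((\<lambda>w. w c) ` T)"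
    by (intro card_ge_dim_independent) auto
  also have "span ((\<lambda>w. w c) ` T) = (\<lambda>w. w c) ` span T"
    by (rule linear_span_image[OF linear_eval])
  finally have "e \<in> (\<lambda>w. w c) ` tangent_space A p" unfolding span by (rule subsetD) simp
  then obtain w where "w \<in> tangent_space A p" "e = w c" by (rule imageE)
  then show ?thesis by (intro that[of w]) simp_all
qed

lemma H1_subset: "H 1 p \<subseteq> tangent_space A p"
proof -
  have "H 1 p \<subseteq> H i p" if "1 \<le> i" "i \<le> M" for i
    using that
  proof (induction i rule: dec_induct)
    case (step i)
    then show ?case using H_mono[of i p] by auto
  qed simp
  from this[of M] show ?thesis using M_pos H_top by simp
qed

text \<open>It places the basic horizontal fields among the frame fields, whose regularity is
  assumed for indices up to \<open>DIM('e)\<close>.\<close>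

lemma d1_le: "d 1 \<le> DIM('e)"
proof -
  obtain g :: 'm where True by blast
  have g: "g \<in> U g" using nhd by blast
  define T where "T = (\<lambda>k. X g k g) ` {1..DIM('e)}"
  obtain B where B: "B \<subseteq> H 1 g" "independent B" "card B = dim (H 1 g)"
    using basis_exists[of "H 1 g"] by metis
  have "B \<subseteq> span T" using B(1) H1_subset frame_span[OF g] by (auto simp: T_def)
  then have "card B \<le> card T" using independent_span_bound[OF _ B(2)] by (simp add: T_def)
  also have "\<dots> \<le> DIM('e)" using card_image_le[of "{1..DIM('e)}"] by (simp add: T_def)
  finally show ?thesis using B(3) H_dim[OF g _ M_pos] by simp
qed

text \<open>Orthogonality is propagated at all points of \<open>S \<inter> V\<close> simultaneously,
  since a bracket at one point requires it for both sections in a neighbourhood. In the end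
  \<open>\<nu>\<close> is orthogonal to the coordinates of every tangent vector, in particular to
  itself.\<close>

lemma bracket_generating:
  fixes S :: "'e set"
  assumes c: "c \<in> A" and S: "closed S" and V: "open V" "V \<subseteq> chart_map c ` (chart_dom c \<inter> U g)"
    and tangent: "\<And>x \<mu> k. x \<in> S \<inter> V \<Longrightarrow> proximal_normal S x \<mu> \<Longrightarrow> k \<in> {1..d 1} \<Longrightarrow> \<mu> \<bullet> coord c (X g k) x = 0"
    and s: "s \<in> S \<inter> V" "proximal_normal S s \<nu>"
  shows "\<nu> = 0"
proof -
  note ch = is_chart[OF c]
  have inv: "chart_inv c x \<in> chart_dom c" "chart_inv c x \<in> U g" "chart_map c (chart_inv c x) = x" if "x \<in> V" for x
  proof -
    obtain p where "p \<in> chart_dom c" "p \<in> U g" "x = chart_map c p" using V(2) \<open>x \<in> V\<close> by blast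
    then show "chart_inv c x \<in> chart_dom c" "chart_inv c x \<in> U g" "chart_map c (chart_inv c x) = x"
      using chart_inv_map[OF ch] by auto
  qed
  have span_normal: "\<mu> \<bullet> w c = 0" if "w \<in> span B" "\<And>b. b \<in> B \<Longrightarrow> \<mu> \<bullet> b c = 0" for \<mu> w B
    using that(1)
  proof (induction rule: span_induct)
    case base
    show ?case by (rule subspaceI) (auto simp: plus_fun_def scaleR_fun_def zero_fun_def inner_add_right)
  next
    case (step b)
    then show ?case using that(2) by simp
  qed
  have *: "\<mu> \<bullet> w c = 0"
    if "1 \<le> j" "j \<le> M" "x \<in> S \<inter> V" "proximal_normal S x \<mu>" "w \<in> H j (chart_inv c x)" for j x \<mu> w
    using that
  proof (induction j arbitrary: x \<mu> w rule: less_induct)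
    case (less j)
    have xU: "chart_inv c x \<in> U g" using inv less.prems by blast
    show ?case
    proof (cases "j = 1")
      case True
      have "w \<in> span ((\<lambda>k. X g k (chart_inv c x)) ` {1..d 1})"
        using less.prems(5) H_span[OF xU _ M_pos] True by simp
      then show ?thesis
        by (rule span_normal) (use tangent[OF less.prems(3,4)] in \<open>auto simp: coord_def\<close>)
    next
      case False
      define i where "i = j - 1"
      have i: "j = i + 1" "1 \<le> i" "i \<le> M - 1" using False less.prems by (auto simp: i_def)
      have "w \<in> span (H i (chart_inv c x) \<union>
          (\<Union>a\<in>{1..(i + 1) div 2}. bracket_set A (H a) (H (i + 1 - a)) (chart_inv c x)))"
        using H_bracket[OF xU i(2,3)] less.prems(5) unfolding i(1) by simp
      then show ?thesis
      proof (rule span_normal)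
        fix b assume "b \<in> H i (chart_inv c x) \<union>
          (\<Union>a\<in>{1..(i + 1) div 2}. bracket_set A (H a) (H (i + 1 - a)) (chart_inv c x))"
        then consider "b \<in> H i (chart_inv c x)"
          | a where "a \<in> {1..(i + 1) div 2}" "b \<in> bracket_set A (H a) (H (i + 1 - a)) (chart_inv c x)" by blast
        then show "\<mu> \<bullet> b c = 0"
        proof cases
          case 1
          then show ?thesis using less.IH[of i x \<mu> b] i less.prems by simp
        next
          case (2 a)
          define a' where "a' = i + 1 - a"
          \<comment> \<open>From \<open>1 \<le> a \<le> (i + 1) div 2 \<le> i\<close> also
            \<open>1 \<le> a' \<le> i\<close> follows; both indices are thus below \<open>j\<close>,
            and the induction hypothesis covers both sections.\<close>
          have a: "1 \<le> a" "a < j" "a \<le> M" "1 \<le> a'" "a' < j" "a' \<le> M"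
            using 2(1) i less.prems(2) by (auto simp: a'_def)
          obtain P Q W where b: "b = lie_bracket A P Q (chart_inv c x)" and W: "open W" "chart_inv c x \<in> W"
            and P: "C1_section A (H a) W P" and Q: "C1_section A (H a') W Q"
            using 2(2) unfolding bracket_set_def a'_def by blast
          \<comment> \<open>The sections live over \<open>W\<close>, orthogonality is known on
            \<open>V\<close>; this is the common part in the chart.\<close>
          define \<Omega> where "\<Omega> = V \<inter> chart_map c ` (chart_dom c \<inter> W)"
          have "open \<Omega>" unfolding \<Omega>_def by (intro open_Int V chart_open_image[OF ch] W)
          have "x \<in> chart_map c ` (chart_dom c \<inter> W)"
            using inv[of x] W(2) less.prems(3) by (metis Int_iff imageI)
          then have "x \<in> \<Omega>" using less.prems(3) by (simp add: \<Omega>_def)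
          have \<Omega>W: "chart_inv c y \<in> W" if "y \<in> \<Omega>" for y
            using that chart_inv_map[OF ch] by (auto simp: \<Omega>_def)
          have C1: "\<exists>f'. (\<forall>y\<in>\<Omega>. (coord c R has_derivative blinfun_apply (f' y)) (at y)) \<and> continuous_on \<Omega> f'"
            if "C1_section A K W R" for K R
          proof -
            have "C_k_on 1 (coord c R) (chart_map c ` (chart_dom c \<inter> W))"
              using that c unfolding C1_section_def C1_vector_field_def by blast
            then obtain f' where "\<And>y. y \<in> chart_map c ` (chart_dom c \<inter> W) \<Longrightarrow> (coord c R has_derivative blinfun_apply (f' y)) (at y)"
              "continuous_on (chart_map c ` (chart_dom c \<inter> W)) f'" by (rule C_k_on_1_blinfun) blast
            then show ?thesis unfolding \<Omega>_def by (blast intro: continuous_on_subset)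
          qed
          obtain P' where P': "\<And>y. y \<in> \<Omega> \<Longrightarrow> (coord c P has_derivative blinfun_apply (P' y)) (at y)" "continuous_on \<Omega> P'"
            using C1[OF P] by blast
          obtain Q' where Q': "\<And>y. y \<in> \<Omega> \<Longrightarrow> (coord c Q has_derivative blinfun_apply (Q' y)) (at y)" "continuous_on \<Omega> Q'"
            using C1[OF Q] by blast
          have Pn: "\<xi> \<bullet> coord c P y = 0" if "y \<in> S \<inter> \<Omega>" "proximal_normal S y \<xi>" for y \<xi>
            using less.IH[OF a(2,1,3) _ that(2), of "P (chart_inv c y)"] that(1) \<Omega>W[of y] P
            by (auto simp: coord_def C1_section_def \<Omega>_def)
          have Qn: "\<xi> \<bullet> coord c Q y = 0" if "y \<in> S \<inter> \<Omega>" "proximal_normal S y \<xi>" for y \<xi>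
            using less.IH[OF a(5,4,6) _ that(2), of "Q (chart_inv c y)"] that(1) \<Omega>W[of y] Q
            by (auto simp: coord_def C1_section_def \<Omega>_def)
          have "\<mu> \<bullet> (Q' x (coord c P x) - P' x (coord c Q x)) = 0"
            using less.prems by (intro local_bracket_normal[OF S _ _ \<open>open \<Omega>\<close> \<open>x \<in> \<Omega>\<close> P' Q' Pn Qn]) auto
          moreover have "b c = Q' x (coord c P x) - P' x (coord c Q x)"
            using inv[of x] less.prems(3) c frechet_derivative_at[OF P'(1)[OF \<open>x \<in> \<Omega>\<close>]]
              frechet_derivative_at[OF Q'(1)[OF \<open>x \<in> \<Omega>\<close>]]
            by (simp add: b lie_bracket_def coord_def)
          ultimately show ?thesis by simp
        qed
      qed
    qed
  qed
  have "chart_inv c s \<in> chart_dom c" using inv s(1) by blast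
  from tangent_coord_surj[OF c this] obtain w where "w \<in> tangent_space A (chart_inv c s)" "w c = \<nu>" by blast
  then have "\<nu> \<bullet> \<nu> = 0" using *[OF M_pos order_refl s, of w] by (simp add: H_top)
  then show ?thesis by simp
qed

text \<open>The inclusion admits the fields of a single frame, for the local claim, and those of all
  frames, for the global one.\<close>

lemma segments_imp_joined:
  assumes "integral_segments A F n T \<gamma>" "F \<subseteq> (\<Union>g. basic_horizontal_fields U X (d 1) g)"
  shows "joined_by_segments A (H 1) F n (\<gamma> 0) (\<gamma> T)"
proof (rule joined_if_segments[OF assms(1) is_chart])
  fix W and Y :: "'m \<Rightarrow> ('m, 'e) tvec" assume "(W, Y) \<in> F"
  then have "(W, Y) \<in> (\<Union>g. basic_horizontal_fields U X (d 1) g)" using assms(2) by (rule subsetD[rotated])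
  then obtain g k where k: "k \<in> {1..d 1}" and "(W, Y) = (U g, X g k)"
    unfolding basic_horizontal_fields_def by (elim UN_E imageE)
  then have WY: "W = U g" "Y = X g k" by simp_all
  show "Y p \<in> H 1 p \<and> - Y p \<in> H 1 p" if "p \<in> W" for p
  proof -
    have "H 1 p = span ((\<lambda>k. X g k p) ` {1..d 1})"
      using that unfolding WY by (intro H_span order_refl M_pos)
    moreover have "X g k p \<in> span ((\<lambda>k. X g k p) ` {1..d 1})" using k by (intro span_base imageI)
    ultimately show ?thesis unfolding WY using span_neg by metis
  qed
  have "k \<in> {1..DIM('e)}" using k d1_le by auto
  then have "C1_vector_field A W Y" unfolding WY by (rule frame_C1)
  then have C1: "C_k_on 1 (coord c Y) (chart_map c ` (chart_dom c \<inter> W))" if "c \<in> A" for c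
    using that unfolding C1_vector_field_def by blast
  show "continuous_on (chart_map c ` (chart_dom c \<inter> W)) (coord c Y)" if "c \<in> A" for c
    using C1[OF that] by (auto intro!: continuous_at_imp_continuous_on differentiable_imp_continuous_within)
qed

lemma local_connectivity:
  "\<exists>V L. open V \<and> g \<in> V \<and> (\<forall>u\<in>V. \<forall>v\<in>V. \<exists>n\<le>L.
     joined_by_segments A (H 1) (basic_horizontal_fields U X (d 1) g) n u v)"
proof -
  let ?F = "basic_horizontal_fields U X (d 1) g"
  obtain c where c: "c \<in> A" "g \<in> chart_dom c" using chart_ex by blast
  note ch = is_chart[OF c(1)]
  have g: "g \<in> U g" "open (U g)" using nhd by auto
  define D where "D = chart_map c ` (chart_dom c \<inter> U g)"
  define x0 where "x0 = chart_map c g"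
  have "open D" unfolding D_def by (rule chart_open_image[OF ch g(2)])
  moreover have "x0 \<in> D" using c(2) g(1) by (simp add: D_def x0_def)
  ultimately obtain R where "R > 0" "cball x0 R \<subseteq> D" using open_contains_cball by blast
  then have R: "cball x0 R \<subseteq> D" "0 < R / 2" "R / 2 < R" by auto
  \<comment> \<open>Cutting off in the chart gives complete fields; they agree with the frame on the
    closed ball whose interior will be \<open>\<Omega>\<close>.\<close>
  have "\<exists>Y Y' L B. c1_field Y Y' L B \<and> (\<forall>x\<in>cball x0 (R / 2). Y x = coord c (X g k) x)" if "k \<in> {1..d 1}" for k
  proof -
    have "k \<in> {1..DIM('e)}" using that d1_le by auto
    then have "C_k_on 1 (coord c (X g k)) D"
      using frame_C1[of k g] c(1) unfolding C1_vector_field_def D_def by blast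
    then obtain f' where "\<And>x. x \<in> D \<Longrightarrow> (coord c (X g k) has_derivative blinfun_apply (f' x)) (at x)" "continuous_on D f'"
      by (rule C_k_on_1_blinfun) blast
    from cutoff_exists[OF \<open>open D\<close> R this] show ?thesis by metis
  qed
  then obtain Y Y' L B where Y: "\<And>k. k \<in> {1..d 1} \<Longrightarrow> c1_field (Y k) (Y' k) (L k) (B k)"
    "\<And>k x. k \<in> {1..d 1} \<Longrightarrow> x \<in> cball x0 (R / 2) \<Longrightarrow> Y k x = coord c (X g k) x" by metis
  define \<Omega> where "\<Omega> = ball x0 (R / 2)"
  have \<Omega>D: "\<Omega> \<subseteq> D" using R by (auto simp: \<Omega>_def)
  have \<Omega>_Y: "Y k x = X g k (chart_inv c x) c" if "k \<in> {1..d 1}" "x \<in> \<Omega>" for k x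
    using Y(2)[OF that(1), of x] that(2) by (simp add: \<Omega>_def coord_def)
  interpret sys: c1_system Y Y' L B "d 1" \<Omega>
    by (rule c1_system.intro) (use Y(1) in \<open>auto simp: \<Omega>_def\<close>)
  have inv: "chart_inv c x \<in> U g" "chart_map c (chart_inv c x) = x" "x \<in> chart_map c ` chart_dom c" if x: "x \<in> \<Omega>" for x
  proof -
    obtain p where "p \<in> chart_dom c" "p \<in> U g" "x = chart_map c p" using \<Omega>D x unfolding D_def by blast
    then show "chart_inv c x \<in> U g" "chart_map c (chart_inv c x) = x" "x \<in> chart_map c ` chart_dom c"
      using chart_inv_map[OF ch] by auto
  qed
  have "\<exists>Q n. open Q \<and> x0 \<in> Q \<and> (\<forall>y\<in>Q. (sys.step ^^ n) x0 y)"
  proof (rule sys.orbit_open)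
    show "x0 \<in> \<Omega>" using R by (simp add: \<Omega>_def)
    fix S V and s \<nu> :: 'e
    assume S: "closed S" and V: "open V" "V \<subseteq> \<Omega>" and s: "s \<in> S \<inter> V" "proximal_normal S s \<nu>"
      and t: "\<And>x \<mu> k. x \<in> S \<inter> V \<Longrightarrow> proximal_normal S x \<mu> \<Longrightarrow> k \<in> {1..d 1} \<Longrightarrow> \<mu> \<bullet> Y k x = 0"
    show "\<nu> = 0"
    proof (rule bracket_generating[OF c(1) S V(1) _ _ s])
      show "V \<subseteq> chart_map c ` (chart_dom c \<inter> U g)" using V(2) \<Omega>D by (simp add: D_def)
      fix x \<mu> k assume "x \<in> S \<inter> V" "proximal_normal S x \<mu>" "k \<in> {1..d 1}"
      then show "\<mu> \<bullet> coord c (X g k) x = 0"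
        using t[of x \<mu> k] \<Omega>_Y[of k x] V(2) by (auto simp: coord_def)
    qed
  qed
  then obtain Q n where Q: "open Q" "x0 \<in> Q" "\<And>y. y \<in> Q \<Longrightarrow> (sys.step ^^ n) x0 y" by blast
  have step: "\<exists>T \<gamma>. integral_segments A ?F 1 T \<gamma> \<and> \<gamma> 0 = chart_inv c x \<and> \<gamma> T = chart_inv c y"
    if "sys.step x y" for x y
  proof -
    obtain k t where k: "k \<in> {1..d 1}" and y: "y = flow (Y k) t x"
      and in_\<Omega>: "\<And>s. s \<in> closed_segment 0 t \<Longrightarrow> flow (Y k) s x \<in> \<Omega>"
      using \<open>sys.step x y\<close> unfolding sys.step_def by blast
    interpret c1_field "Y k" "Y' k" "L k" "B k" by (rule Y(1)[OF k])
    \<comment> \<open>A step with negative time becomes a curve with increasing parameter, traversed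
      along \<open>- Y k\<close>.\<close>
    define \<sigma> :: real where "\<sigma> = (if t \<ge> 0 then 1 else - 1)"
    define T where "T = \<bar>t\<bar>"
    define \<phi> where "\<phi> s = flow (Y k) (\<sigma> * s) x" for s
    define \<gamma> where "\<gamma> s = chart_inv c (\<phi> s)" for s
    have \<phi>\<Omega>: "\<phi> s \<in> \<Omega>" if "s \<in> {0..T}" for s
      unfolding \<phi>_def
      by (rule in_\<Omega>) (use that in \<open>auto simp: \<sigma>_def T_def closed_segment_eq_real_ivl\<close>)
    have d\<phi>: "(\<phi> has_vector_derivative \<sigma> *\<^sub>R Y k (\<phi> s)) (at s within {0..T})" for s
    proof -
      have "((\<lambda>s. \<sigma> * s) has_vector_derivative \<sigma>) (at s)"
        by (auto intro!: derivative_eq_intros)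
      from vector_diff_chain_at[OF this flow_deriv] show ?thesis
        by (simp add: \<phi>_def[abs_def] o_def has_vector_derivative_at_within)
    qed
    have "integral_segments A ?F 1 T \<gamma>"
    proof (rule integral_segmentsI[of "\<lambda>i. if i = 0 then 0 else T"])
      fix i :: nat assume "i < 1"
      have "\<gamma> s \<in> U g \<and> has_velocity A \<gamma> (\<sigma> *\<^sub>R X g k (\<gamma> s)) s {0..T}" if s: "s \<in> {0..T}" for s
      proof
        show \<gamma>U: "\<gamma> s \<in> U g" unfolding \<gamma>_def using inv \<phi>\<Omega>[OF s] by blast
        show "has_velocity A \<gamma> (\<sigma> *\<^sub>R X g k (\<gamma> s)) s {0..T}"
        proof (rule has_velocity_chart[OF atlas c(1) s _ d\<phi>])
          show "\<phi> ` {0..T} \<subseteq> chart_map c ` chart_dom c" using inv(3) \<phi>\<Omega> by blast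
          have "k \<in> {1..DIM('e)}" using k d1_le by auto
          then show "\<sigma> *\<^sub>R X g k (\<gamma> s) \<in> tangent_space A (\<gamma> s)"
            using frame_tangent[OF \<gamma>U] frame_span[OF \<gamma>U] by (metis span_scale span_span)
          show "(\<sigma> *\<^sub>R X g k (\<gamma> s)) c = \<sigma> *\<^sub>R Y k (\<phi> s)"
            using \<Omega>_Y[OF k \<phi>\<Omega>[OF s]] by (simp add: scaleR_fun_def \<gamma>_def)
        qed (simp add: \<gamma>_def)
      qed
      moreover have "(U g, X g k) \<in> ?F" using k by (auto simp: basic_horizontal_fields_def)
      moreover have "\<sigma> \<in> {1, -1}" by (simp add: \<sigma>_def)
      ultimately show "\<exists>W Z \<sigma>. (W, Z) \<in> ?F \<and> \<sigma> \<in> {1, -1} \<and>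
          (\<forall>t\<in>{if i = 0 then 0 else T..if Suc i = 0 then 0 else T}. \<gamma> t \<in> W \<and>
            has_velocity A \<gamma> (\<sigma> *\<^sub>R Z (\<gamma> t)) t {if i = 0 then 0 else T..if Suc i = 0 then 0 else T})"
        using \<open>i < 1\<close> by (intro exI[of _ "U g"] exI[of _ "X g k"] exI[of _ \<sigma>]) simp
    qed (auto simp: T_def)
    moreover have "\<gamma> 0 = chart_inv c x" by (simp add: \<gamma>_def \<phi>_def)
    moreover have "\<gamma> T = chart_inv c y" by (simp add: \<gamma>_def \<phi>_def y \<sigma>_def T_def)
    ultimately show ?thesis by blast
  qed
  have steps: "\<exists>T \<gamma>. integral_segments A ?F n T \<gamma> \<and> \<gamma> 0 = chart_inv c x \<and> \<gamma> T = chart_inv c y"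
    if "(sys.step ^^ n) x y" for n x y
    using that
  proof (induction n arbitrary: y)
    case 0
    then show ?case using integral_segments_0[of A ?F "\<lambda>_. chart_inv c x"] by auto
  next
    case (Suc n)
    then obtain z where z: "(sys.step ^^ n) x z" "sys.step z y" by (auto elim: relpowp_Suc_E)
    obtain T \<gamma> where 1: "integral_segments A ?F n T \<gamma>" "\<gamma> 0 = chart_inv c x" "\<gamma> T = chart_inv c z"
      using Suc.IH[OF z(1)] by blast
    obtain T' \<delta> where 2: "integral_segments A ?F 1 T' \<delta>" "\<delta> 0 = chart_inv c z" "\<delta> T' = chart_inv c y"
      using step[OF z(2)] by blast
    have T: "0 \<le> T" "0 \<le> T'" using 1(1) 2(1) by (auto dest: integral_segments_nonneg)
    have eq: "\<gamma> T = \<delta> 0" using 1(3) 2(2) by simp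
    from integral_segments_append[OF 1(1) 2(1) eq] show ?case
      using T 1 2 eq by (intro exI[of _ "T + T'"] exI[of _ "\<lambda>t. if t \<le> T then \<gamma> t else \<delta> (t - T)"]) auto
  qed
  define V where "V = chart_dom c \<inter> chart_map c -` Q"
  have "open V" unfolding V_def
    by (rule continuous_open_preimage[OF chart_map_cont[OF ch] chart_open_dom[OF ch] Q(1)])
  moreover have "g \<in> V" using c(2) Q(2) by (simp add: V_def x0_def)
  \<comment> \<open>The path goes from \<open>u\<close> back to \<open>g\<close> and on to
    \<open>v\<close>; the number \<open>n + n\<close> is the same for all pairs.\<close>
  moreover have "joined_by_segments A (H 1) ?F (n + n) u v" if uv: "u \<in> V" "v \<in> V" for u v
  proof -
    have uvQ: "chart_map c u \<in> Q" "chart_map c v \<in> Q" using uv by (auto simp: V_def)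
    have "(sys.step ^^ n) (chart_map c u) x0" "(sys.step ^^ n) x0 (chart_map c v)"
      by (rule sys.relpowp_step_sym[OF Q(3)[OF uvQ(1)]], rule Q(3)[OF uvQ(2)])
    then have "(sys.step ^^ (n + n)) (chart_map c u) (chart_map c v)" unfolding relpowp_add by blast
    from steps[OF this] obtain T \<gamma> where "integral_segments A ?F (n + n) T \<gamma>" "\<gamma> 0 = u" "\<gamma> T = v"
      using uv chart_inv_map[OF ch] by (auto simp: V_def)
    then show ?thesis using segments_imp_joined by blast
  qed
  ultimately show ?thesis by blast
qed

lemma joined_append:
  assumes "joined_by_segments A (H 1) (\<Union>g. basic_horizontal_fields U X (d 1) g) n u v"
    and "joined_by_segments A (H 1) (\<Union>g. basic_horizontal_fields U X (d 1) g) k v w"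
  shows "joined_by_segments A (H 1) (\<Union>g. basic_horizontal_fields U X (d 1) g) (n + k) u w"
proof -
  let ?F = "\<Union>g. basic_horizontal_fields U X (d 1) g"
  obtain T \<gamma> where 1: "T \<ge> 0" "integral_segments A ?F n T \<gamma>" "\<gamma> 0 = u" "\<gamma> T = v"
    using assms(1) unfolding joined_by_segments_def by blast
  obtain S \<delta> where 2: "S \<ge> 0" "integral_segments A ?F k S \<delta>" "\<delta> 0 = v" "\<delta> S = w"
    using assms(2) unfolding joined_by_segments_def by blast
  have eq: "\<gamma> T = \<delta> 0" using 1 2 by simp
  from segments_imp_joined[OF integral_segments_append[OF 1(2) 2(2) eq] order_refl]
  \<comment> \<open>For \<open>S = 0\<close> the end point \<open>T + S\<close> falls into the first
    branch of the concatenation, where \<open>\<gamma> T = \<delta> 0\<close> helps.\<close>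
  show ?thesis using 1 2 by (cases "S = 0") auto
qed

text \<open>The local claim joins any two points of \<open>V\<close> in either order, so both the
  reachable set \<open>R\<close> and its complement are open, and connectedness applies.\<close>

lemma global_connectivity:
  "\<exists>n. joined_by_segments A (H 1) (\<Union>g. basic_horizontal_fields U X (d 1) g) n u v"
proof -
  let ?F = "\<Union>g. basic_horizontal_fields U X (d 1) g"
  let ?J = "\<lambda>u v. \<exists>n. joined_by_segments A (H 1) ?F n u v"
  define R where "R = {v. ?J u v}"
  have loc: "\<exists>V. open V \<and> g \<in> V \<and> (\<forall>u\<in>V. \<forall>v\<in>V. ?J u v)" for g
  proof -
    have sub: "basic_horizontal_fields U X (d 1) g \<subseteq> ?F" by blast
    have "joined_by_segments A (H 1) ?F n u v"
      if j: "joined_by_segments A (H 1) (basic_horizontal_fields U X (d 1) g) n u v" for n u v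
      using j integral_segments_mono[OF _ sub] unfolding joined_by_segments_def by blast
    then show ?thesis using local_connectivity[of g] by metis
  qed
  have trans: "?J a c" if "?J a b" "?J b c" for a b c
    using that joined_append by blast
  have "open R"
    unfolding open_subopen[of R]
  proof
    fix v assume "v \<in> R"
    obtain V where V: "open V" "v \<in> V" "\<forall>u\<in>V. \<forall>w\<in>V. ?J u w" using loc by blast
    have "V \<subseteq> R"
    proof
      fix w assume "w \<in> V"
      then show "w \<in> R" using trans[of u v w] V \<open>v \<in> R\<close> by (simp add: R_def)
    qed
    then show "\<exists>V. open V \<and> v \<in> V \<and> V \<subseteq> R" using V by blast
  qed
  moreover have "open (- R)"
    unfolding open_subopen[of "- R"]
  proof
    fix v assume "v \<in> - R"
    obtain V where V: "open V" "v \<in> V" "\<forall>u\<in>V. \<forall>w\<in>V. ?J u w" using loc by blast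
    have "V \<subseteq> - R"
    proof
      fix w assume "w \<in> V"
      then show "w \<in> - R" using trans[of u w v] V \<open>v \<in> - R\<close> by (auto simp: R_def)
    qed
    then show "\<exists>V. open V \<and> v \<in> V \<and> V \<subseteq> - R" using V by blast
  qed
  moreover have "u \<in> R" using loc[of u] by (auto simp: R_def)
  ultimately have "R = UNIV"
    using connected unfolding connected_clopen by (auto simp: closed_def)
  then show ?thesis by (auto simp: R_def)
qed

end

theorem theorem1p15:
  fixes A :: "('m::{t2_space, second_countable_topology}, 'e::euclidean_space) chart set"
    and G :: "'m \<Rightarrow> ('m, 'e) tvec \<Rightarrow> ('m, 'e) tvec \<Rightarrow> real"
    and M :: nat
    and H :: "nat \<Rightarrow> 'm \<Rightarrow> ('m, 'e) tvec set"
    and d :: "nat \<Rightarrow> nat"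
    and U :: "'m \<Rightarrow> 'm set"
    and X :: "'m \<Rightarrow> nat \<Rightarrow> 'm \<Rightarrow> ('m, 'e) tvec"
  assumes "carnot_caratheodory_space A G M H d U X"
  shows "(\<forall>g. \<exists>V L. open V \<and> g \<in> V \<and>
           (\<forall>u\<in>V. \<forall>v\<in>V. \<exists>n\<le>L.
              joined_by_segments A (H 1) (basic_horizontal_fields U X (d 1) g) n u v)) \<and>
         (\<forall>u v. \<exists>n.
            joined_by_segments A (H 1) (\<Union>g. basic_horizontal_fields U X (d 1) g) n u v)"
proof -
  interpret carnot_caratheodory_space A G M H d U X by fact
  show ?thesis using local_connectivity global_connectivity by blast
qed

end
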